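(* Suppose $\Gamma$ is a non-complete graph on $n$ vertices that is either $1$-regular or $(n-2)$-regular. Then $A_{\Gamma}$ has the $R_\infty$-property.
   Context: A graph is a finite simple non-empty graph $\Gamma(V,E)$; it is complete if every two distinct vertices are joined by an edge, and $k$-regular if every vertex has degree $k$. The right-angled Artin group associated to $\Gamma$ is $A_\Gamma=\langle V \mid [v,w],\ vw\in E\rangle$. For a group $G$ and $\varphi\in\operatorname{Aut}(G)$, elements $x,y\in G$ are $\varphi$-conjugate if $x=gy\varphi(g)^{-1}$ for some $g\in G$; the Reidemeister number $R(\varphi)$ is the number of $\varphi$-conjugacy classes ($\infty$ if there are infinitely many). $G$ has the $R_\infty$-property if $R(\varphi)=\infty$ for all $\varphi\in\operatorname{Aut}(G)$. *)

theory Defs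
  imports "HOL-Algebra.Algebra" "HOL-Library.Extended_Nat"
begin

definition simple_graph :: "'v set \<Rightarrow> 'v set set \<Rightarrow> bool" where
  "simple_graph V E \<longleftrightarrow>
     finite V \<and> V \<noteq> {} \<and> (\<forall>e\<in>E. \<exists>v\<in>V. \<exists>w\<in>V. v \<noteq> w \<and> e = {v, w})"

definition complete_graph :: "'v set \<Rightarrow> 'v set set \<Rightarrow> bool" where
  "complete_graph V E \<longleftrightarrow> (\<forall>v\<in>V. \<forall>w\<in>V. v \<noteq> w \<longrightarrow> {v, w} \<in> E)"

definition vertex_degree :: "'v set set \<Rightarrow> 'v \<Rightarrow> nat" where
  "vertex_degree E v = card {e \<in> E. v \<in> e}"

definition regular_graph :: "'v set \<Rightarrow> 'v set set \<Rightarrow> nat \<Rightarrow> bool" where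
  "regular_graph V E k \<longleftrightarrow> (\<forall>v\<in>V. vertex_degree E v = k)"

text \<open>The letter \<open>(x, True)\<close> stands for the generator \<open>x\<close>, and \<open>(x, False)\<close> for its inverse.\<close>

type_synonym 'a word = "('a \<times> bool) list"

definition words_over :: "'a set \<Rightarrow> 'a word set" where
  "words_over S = lists (S \<times> UNIV)"

text \<open>
  Two words over \<open>S\<close> represent the same element of \<open>\<langle>S | R\<rangle>\<close> iff one can be turned into the other
  by inserting and deleting trivial words \<open>x x\<inverse>\<close>, \<open>x\<inverse> x\<close> and relators \<open>r \<in> R\<close>.
\<close>

inductive pres_eq :: "'a set \<Rightarrow> 'a word set \<Rightarrow> 'a word \<Rightarrow> 'a word \<Rightarrow> bool"
  for S :: "'a set" and R :: "'a word set" where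
  cancel: "\<lbrakk>u \<in> words_over S; v \<in> words_over S; x \<in> S\<rbrakk>
             \<Longrightarrow> pres_eq S R (u @ [(x, b), (x, \<not> b)] @ v) (u @ v)"
| relator: "\<lbrakk>u \<in> words_over S; v \<in> words_over S; r \<in> R; r \<in> words_over S\<rbrakk>
             \<Longrightarrow> pres_eq S R (u @ r @ v) (u @ v)"
| refl: "u \<in> words_over S \<Longrightarrow> pres_eq S R u u"
| sym: "pres_eq S R u v \<Longrightarrow> pres_eq S R v u"
| trans: "\<lbrakk>pres_eq S R u v; pres_eq S R v w\<rbrakk> \<Longrightarrow> pres_eq S R u w"

definition pres_rel :: "'a set \<Rightarrow> 'a word set \<Rightarrow> ('a word \<times> 'a word) set" where
  "pres_rel S R = {(u, v). pres_eq S R u v}"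

definition presented_group :: "'a set \<Rightarrow> 'a word set \<Rightarrow> 'a word set monoid" where
  "presented_group S R =
     \<lparr>carrier = words_over S // pres_rel S R,
      monoid.mult = (\<lambda>A B. \<Union>a\<in>A. \<Union>b\<in>B. pres_rel S R `` {a @ b}),
      monoid.one = pres_rel S R `` {[]}\<rparr>"

lemma append_in_words_over [simp]:
  "u @ v \<in> words_over S \<longleftrightarrow> u \<in> words_over S \<and> v \<in> words_over S"
  by (auto simp: words_over_def)

lemma Nil_in_words_over [simp]: "[] \<in> words_over S"
  by (simp add: words_over_def)

lemma pres_eq_in_words_over:
  "pres_eq S R u v \<Longrightarrow> u \<in> words_over S \<and> v \<in> words_over S"
  by (induction rule: pres_eq.induct) (auto simp: words_over_def)

lemma equiv_pres_rel: "equiv (words_over S) (pres_rel S R)"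
  by (rule equivI)
    (auto simp: pres_rel_def refl_on_def sym_def trans_def
          intro: pres_eq.refl pres_eq.sym pres_eq.trans dest: pres_eq_in_words_over)

lemma pres_eq_append_context:
  assumes "pres_eq S R u v" "p \<in> words_over S" "q \<in> words_over S"
  shows "pres_eq S R (p @ u @ q) (p @ v @ q)"
  using assms
proof (induction rule: pres_eq.induct)
  case (cancel u v x b)
  then show ?case using pres_eq.cancel[of "p @ u" S "v @ q" x R b] by simp
next
  case (relator u v r)
  then show ?case using pres_eq.relator[of "p @ u" S "v @ q" r R] by simp
qed (auto intro: pres_eq.refl pres_eq.sym pres_eq.trans)

lemma pres_eq_append:
  assumes "pres_eq S R a a'" "pres_eq S R b b'"
  shows "pres_eq S R (a @ b) (a' @ b')"
  using pres_eq_append_context[OF assms(1), of "[]" b]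
    pres_eq_append_context[OF assms(2), of a' "[]"] pres_eq_in_words_over[OF assms(1)]
    pres_eq_in_words_over[OF assms(2)]
  by (auto intro: pres_eq.trans)

lemma presented_group_mult_class:
  assumes "a \<in> words_over S" "b \<in> words_over S"
  shows "pres_rel S R `` {a} \<otimes>\<^bsub>presented_group S R\<^esub> pres_rel S R `` {b} = pres_rel S R `` {a @ b}"
proof -
  have "congruent2 (pres_rel S R) (pres_rel S R) (\<lambda>a b. pres_rel S R `` {a @ b})"
    unfolding congruent2_def
    by (clarify, rule equiv_class_eq[OF equiv_pres_rel]) (simp add: pres_rel_def pres_eq_append)
  then show ?thesis
    using UN_equiv_class2[OF equiv_pres_rel equiv_pres_rel _ assms]
    by (simp add: presented_group_def)
qed

lemma pres_eq_inverse_word: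
  assumes "a \<in> words_over S"
  shows "pres_eq S R (map (\<lambda>(x, b). (x, \<not> b)) (rev a) @ a) []"
  using assms
proof (induction a)
  case Nil
  then show ?case by (simp add: pres_eq.refl)
next
  case (Cons l a)
  obtain x b where l: "l = (x, b)" by force
  let ?i = "map (\<lambda>(x, b). (x, \<not> b)) (rev a)"
  have a: "a \<in> words_over S" "x \<in> S" using Cons.prems l by (auto simp: words_over_def)
  have "?i \<in> words_over S" using a by (auto simp: words_over_def)
  from pres_eq.cancel[OF this a, of R "\<not> b"] show ?case
    using Cons.IH[OF a(1)] by (auto simp: l intro: pres_eq.trans)
qed

lemma group_presented_group: "group (presented_group S R)"
proof (rule groupI)
  let ?G = "presented_group S R"
  have carrierE: "\<exists>a\<in>words_over S. x = pres_rel S R `` {a}" if "x \<in> carrier ?G" for x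
    using that by (auto simp: presented_group_def elim: quotientE)
  have carrierI: "pres_rel S R `` {a} \<in> carrier ?G" if "a \<in> words_over S" for a
    using that by (auto simp: presented_group_def intro: quotientI)
  have one: "\<one>\<^bsub>?G\<^esub> = pres_rel S R `` {[]}"
    by (simp add: presented_group_def)
  show "\<one>\<^bsub>?G\<^esub> \<in> carrier ?G"
    using carrierI[of "[]"] by (simp add: one)
  show "x \<otimes>\<^bsub>?G\<^esub> y \<in> carrier ?G" if "x \<in> carrier ?G" "y \<in> carrier ?G" for x y
    using carrierE[OF that(1)] carrierE[OF that(2)]
    by (auto simp: presented_group_mult_class intro!: carrierI simp del: Image_singleton_iff)
  show "(x \<otimes>\<^bsub>?G\<^esub> y) \<otimes>\<^bsub>?G\<^esub> z = x \<otimes>\<^bsub>?G\<^esub> (y \<otimes>\<^bsub>?G\<^esub> z)"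
    if "x \<in> carrier ?G" "y \<in> carrier ?G" "z \<in> carrier ?G" for x y z
    using carrierE[OF that(1)] carrierE[OF that(2)] carrierE[OF that(3)]
    by (auto simp: presented_group_mult_class)
  show "\<one>\<^bsub>?G\<^esub> \<otimes>\<^bsub>?G\<^esub> x = x" if "x \<in> carrier ?G" for x
    using carrierE[OF that] by (auto simp: presented_group_mult_class one)
  show "\<exists>y\<in>carrier ?G. y \<otimes>\<^bsub>?G\<^esub> x = \<one>\<^bsub>?G\<^esub>" if x: "x \<in> carrier ?G" for x
  proof -
    obtain a where a: "a \<in> words_over S" "x = pres_rel S R `` {a}"
      using carrierE[OF x] by blast
    let ?i = "map (\<lambda>(x, b). (x, \<not> b)) (rev a)"
    have i: "?i \<in> words_over S" using a(1) by (auto simp: words_over_def)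
    have "pres_rel S R `` {?i} \<otimes>\<^bsub>?G\<^esub> x = \<one>\<^bsub>?G\<^esub>"
      unfolding a(2) one presented_group_mult_class[OF i a(1)]
      by (rule equiv_class_eq[OF equiv_pres_rel])
        (simp add: pres_rel_def pres_eq_inverse_word[OF a(1)])
    then show ?thesis using carrierI[OF i] by blast
  qed
qed

definition commutator_word :: "'a \<Rightarrow> 'a \<Rightarrow> 'a word" where
  "commutator_word v w = [(v, True), (w, True), (v, False), (w, False)]"

definition raag :: "'v set \<Rightarrow> 'v set set \<Rightarrow> 'v word set monoid" where
  "raag V E = presented_group V {commutator_word v w | v w. {v, w} \<in> E}"

definition twisted_conj :: "('g, 'm) monoid_scheme \<Rightarrow> ('g \<Rightarrow> 'g) \<Rightarrow> ('g \<times> 'g) set" where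
  "twisted_conj G \<phi> =
     {(x, y). x \<in> carrier G \<and> y \<in> carrier G \<and>
              (\<exists>g\<in>carrier G. x = g \<otimes>\<^bsub>G\<^esub> y \<otimes>\<^bsub>G\<^esub> inv\<^bsub>G\<^esub> (\<phi> g))}"

definition reidemeister_number :: "('g, 'm) monoid_scheme \<Rightarrow> ('g \<Rightarrow> 'g) \<Rightarrow> enat" where
  "reidemeister_number G \<phi> =
     (if finite (carrier G // twisted_conj G \<phi>)
      then enat (card (carrier G // twisted_conj G \<phi>)) else \<infinity>)"

definition R_infinity :: "('g, 'm) monoid_scheme \<Rightarrow> bool" where
  "R_infinity G \<longleftrightarrow> (\<forall>\<phi>\<in>auto G. reidemeister_number G \<phi> = \<infinity>)"

lemma (in group) equiv_twisted_conj:
  assumes "\<phi> \<in> hom G G"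
  shows "equiv (carrier G) (twisted_conj G \<phi>)"
proof -
  interpret group_hom G G \<phi>
    using assms by (simp add: group_hom_def group_hom_axioms_def is_group)
  show ?thesis
  proof (rule equivI)
    show "twisted_conj G \<phi> \<subseteq> carrier G \<times> carrier G"
      by (auto simp: twisted_conj_def)
    show "refl_on (carrier G) (twisted_conj G \<phi>)"
      by (auto simp: refl_on_def twisted_conj_def intro!: bexI[of _ \<one>])
    show "sym (twisted_conj G \<phi>)"
    proof (rule symI)
      fix x y assume "(x, y) \<in> twisted_conj G \<phi>"
      then obtain g where g: "g \<in> carrier G" "y \<in> carrier G" "x \<in> carrier G"
        "x = g \<otimes> y \<otimes> inv (\<phi> g)"
        by (auto simp: twisted_conj_def)
      have "y = inv g \<otimes> x \<otimes> inv (\<phi> (inv g))"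
        using g(1,2) unfolding g(4) by (simp add: m_assoc) (simp add: m_assoc [symmetric])
      then show "(y, x) \<in> twisted_conj G \<phi>"
        using g by (auto simp: twisted_conj_def intro!: bexI[of _ "inv g"])
    qed
    show "trans (twisted_conj G \<phi>)"
      apply (auto simp: trans_def twisted_conj_def)
      subgoal for z g h
        by (rule bexI[of _ "g \<otimes> h"]) (auto simp: m_assoc inv_mult_group)
      done
  qed
qed

end

theory Submission
  imports Defs
begin

text \<open>
  A non-complete 1-regular graph is a perfect matching with at least two edges, and an
  \<open>(n - 2)\<close>-regular graph is the complement of a perfect matching. So the group is either a free
  product of \<open>m \<ge> 2\<close> copies of \<open>\<int>\<^sup>2\<close> or a direct product of \<open>m \<ge> 1\<close> copies of the free group \<open>F\<^sub>2\<close>.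
  In both cases the generators come in \<open>m\<close> blocks of two, the abelianisation is \<open>H = \<int>\<^sup>2\<^sup>m\<close>, and the
  projection to \<open>H\<close> is called \<open>deg\<close>; let \<open>N\<close> be its kernel.

  \<^bold>\<open>Reduction to an invariant functional.\<close> Every automorphism \<open>\<phi>\<close> permutes the rank-two blocks of
  \<open>H\<close>. If a return map of \<open>\<phi>\<close> to some block has the eigenvalue 1, then a left eigenvector, summed over
  the cycle of that block, is a nonzero \<open>\<phi>\<close>-invariant homomorphism to \<open>\<int>\<close>; it takes infinitely
  many values and is constant on \<open>\<phi>\<close>-conjugacy classes. Otherwise \<open>\<phi>\<close> fixes no nonzero vector of
  \<open>H\<close>; then an equation \<open>x = g y \<phi>(g)\<inverse>\<close> with \<open>x, y \<in> N\<close> forces \<open>g \<in> N\<close>, and a nonzero additive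
  \<open>F : N \<rightarrow> \<int>\<close> with \<open>F \<circ> \<phi> = F\<close> separates infinitely many classes
  (\<open>reidemeister_infinite_if_invariant\<close>). It even suffices that \<open>F\<close> is invariant under the power
  \<open>\<phi>\<^sup>r\<close> that returns to the chosen blocks, if the sum of its translates does not vanish.

  \<^bold>\<open>Coordinates on \<open>N\<close>.\<close> The functional factors through the metabelian quotient, which is seen by
  crossed homomorphisms \<open>D(x y) = D(x) + deg(x) D(y)\<close> into the group ring \<open>\<int>[H]\<close>; on \<open>N\<close> they are
  homomorphisms. Since \<open>1 - x\<close> and \<open>1 - y\<close> are coprime in \<open>\<int>[H]\<close> for independent \<open>x, y\<close>
  (\<open>proportional_to_one_minus_mon\<close>), a crossed homomorphism is principal on a copy of \<open>\<int>\<^sup>2\<close>.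
  For a free product of planes, let \<open>D\<^sub>i\<^sub>j\<close> be zero on plane \<open>i\<close> and \<open>1 - b\<close> at the elements \<open>b\<close> of
  plane \<open>j\<close>, with the other planes killed. For a product of free groups the Fox derivatives of the
  factor \<open>k\<close> are multiples of one function \<open>area k\<close> on \<open>N\<close>. In either case an automorphism acts on
  these coordinates by the induced map of \<open>H\<close> followed by multiplication with a unit of a group ring
  (\<open>slope_iso\<close>, \<open>area_iso\<close>), and such a unit is a signed monomial (\<open>group_ring_unit\<close>). The
  augmentation determines the sign: it is \<open>1\<close> for free products and the determinant of the return
  map for \<open>F\<^sub>2\<close>. So \<open>\<phi>\<^sup>r\<close> acts by a signed affine permutation of the exponents, with no eigenvalue 1
  in its linear part.

  \<^bold>\<open>The functional.\<close> It remains to find a function \<open>f\<close> on the exponents that is invariant (up to that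
  sign) under an affine map \<open>h \<mapsto> h\<^sub>0 + M h\<close> of \<open>\<int>\<^sup>2\<close> with \<open>e = det (1 - M) \<noteq> 0\<close>. The map has a rational
  fixed point \<open>w / e\<close>, and \<open>e h - w\<close> transforms linearly. If \<open>det M = -1\<close>, the quadratic form
  \<open>v \<mapsto> det (v, M v)\<close> changes sign, as needed for \<open>F\<^sub>2\<close> (\<open>anti_invariant_quadratic\<close>). For free products,
  \<open>f\<close> is the indicator function of a product of two congruence conditions \<open>e h \<equiv> w\<close>, one for each
  plane (\<open>invariant_coset\<close>); it must have a nonzero mixed difference, as the values of \<open>D\<^sub>i\<^sub>j\<close> on \<open>N\<close>
  are divisible by products \<open>(1 - a) (1 - b)\<close>.
\<close>

section \<open>Integral group rings\<close>

lemma frag_induct [case_names zero single diff]: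
  assumes "P 0" "\<And>h. P (frag_of h)" "\<And>a b. P a \<Longrightarrow> P b \<Longrightarrow> P (a - b)"
  shows "P (x :: 'a \<Rightarrow>\<^sub>0 int)"
  by (rule frag_induction[of x UNIV]) (use assms in auto)

lemma mon_add: "frag_of (h + k) = frag_of h * frag_of (k::'h::monoid_add)"
  by (simp add: mult_single)

lemma mon_zero: "frag_of (0::'h::monoid_add) = 1"
  by simp

lemma mon_eq_1_iff [simp]: "frag_of h = 1 \<longleftrightarrow> h = (0::'h::monoid_add)"
  by (metis frag_of_eq mon_zero)

lemma one_minus_mon_eq_0_iff: "1 - frag_of h = 0 \<longleftrightarrow> h = (0::'h::monoid_add)"
  by (metis mon_eq_1_iff right_minus_eq)

text \<open>The ring homomorphism between group rings that \<open>\<theta>\<close> induces on exponents.\<close>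

definition push :: "('h \<Rightarrow> 'k) \<Rightarrow> ('h \<Rightarrow>\<^sub>0 int) \<Rightarrow> ('k \<Rightarrow>\<^sub>0 int)" where
  "push \<theta> = frag_extend (\<lambda>h. frag_of (\<theta> h))"

lemma push_simps [simp]:
  "push \<theta> 0 = 0" "push \<theta> (frag_of h) = frag_of (\<theta> h)"
  "push \<theta> (x + y) = push \<theta> x + push \<theta> y" "push \<theta> (x - y) = push \<theta> x - push \<theta> y"
  "push \<theta> (- x) = - push \<theta> x"
  by (simp_all add: push_def frag_extend_add frag_extend_diff frag_extend_minus)

text \<open>The linear extension of \<open>f\<close> to the group ring. A one-point exponent set makes the library's
  extension operator integer-valued.\<close>

definition lin :: "('h \<Rightarrow> int) \<Rightarrow> ('h \<Rightarrow>\<^sub>0 int) \<Rightarrow> int" where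
  "lin f x = Poly_Mapping.lookup (frag_extend (\<lambda>h. frag_cmul (f h) (frag_of ())) x) ()"

lemma lin_simps [simp]:
  "lin f 0 = 0" "lin f (frag_of h) = f h"
  "lin f (x + y) = lin f x + lin f y" "lin f (x - y) = lin f x - lin f y"
  "lin f (- x) = - lin f x"
  by (simp_all add: lin_def frag_extend_add frag_extend_diff frag_extend_minus lookup_add lookup_minus)

lemma single_eq_frag_cmul: "Poly_Mapping.single h s = frag_cmul s (frag_of h)"
  by (rule poly_mapping_eqI) (simp add: lookup_single when_def)

lemma lin_single [simp]: "lin f (Poly_Mapping.single h s) = s * f h"
  by (subst single_eq_frag_cmul) (simp add: lin_def frag_extend_cmul)

lemma lin_push: "lin f (push \<theta> x) = lin (\<lambda>h. f (\<theta> h)) x"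
  by (induction x rule: frag_induct) auto

lemma lin_mon_mult: "lin f (frag_of h * x) = lin (\<lambda>k. f (h + k)) x"
  for x :: "'h::comm_monoid_add \<Rightarrow>\<^sub>0 int"
  by (induction x rule: frag_induct) (auto simp: mult_single right_diff_distrib)

abbreviation aug :: "('h \<Rightarrow>\<^sub>0 int) \<Rightarrow> int" where
  "aug \<equiv> lin (\<lambda>_. 1)"

lemma aug_mult: "aug (x * y) = aug x * aug y" for x y :: "'h::comm_monoid_add \<Rightarrow>\<^sub>0 int"
proof (induction x rule: frag_induct)
  case (single h)
  then show ?case by (simp add: lin_mon_mult)
qed (auto simp: left_diff_distrib)

lemma lin_const: "lin (\<lambda>_. c) x = c * aug x"
  by (induction x rule: frag_induct) (auto simp: right_diff_distrib)

lemma lin_plus: "lin (\<lambda>h. f h + g h) x = lin f x + lin g x"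
  by (induction x rule: frag_induct) auto

lemma lin_uminus: "lin (\<lambda>h. - f h) x = - lin f x"
  by (induction x rule: frag_induct) auto

text \<open>An additive function of the exponents extends to a derivation over the augmentation; such
  derivations read off the linear part of a group ring element at the trivial character.\<close>

lemma lin_mult:
  fixes x y :: "'h::ab_group_add \<Rightarrow>\<^sub>0 int"
  assumes "additive l"
  shows "lin l (x * y) = aug x * lin l y + lin l x * aug y"
proof (induction x rule: frag_induct)
  case (single h)
  then show ?case by (simp add: lin_mon_mult additive.add[OF assms] lin_plus lin_const[of "l h"])
qed (auto simp: algebra_simps)

lemma push_mult:
  fixes x y :: "'h::ab_group_add \<Rightarrow>\<^sub>0 int" and \<theta> :: "'h \<Rightarrow> 'k::ab_group_add"
  assumes "additive \<theta>"
  shows "push \<theta> (x * y) = push \<theta> x * push \<theta> y"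
proof (induction x rule: frag_induct)
  case (single h)
  show ?case
  proof (induction y rule: frag_induct)
    case (single k)
    show ?case by (simp add: mult_single additive.add[OF assms])
  qed (auto simp: right_diff_distrib)
qed (auto simp: left_diff_distrib)

lemma push_one:
  assumes "\<theta> 0 = 0"
  shows "push \<theta> 1 = 1"
  using push_simps(2)[of \<theta> 0] assms by simp

lemma lin_one [simp]: "lin f 1 = f (0::'h::ab_group_add)"
  using lin_simps(2)[of f "0::'h"] by simp

lemma additive_zero_map: "additive (\<lambda>_. 0)"
  by (intro additive.intro) simp

lemma additive_lookup: "additive (\<lambda>h. Poly_Mapping.lookup h q :: int)"
  by (intro additive.intro) (simp add: lookup_add)

text \<open>Functionals are evaluated at commutators of generators, where crossed homomorphisms take values
  divisible by \<open>(1 - a) (1 - b)\<close>: only the mixed second difference of \<open>f\<close> matters.\<close>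

lemma lin_mixed_difference:
  fixes h a b :: "'h::ab_group_add"
  shows "lin f (frag_of h * - ((1 - frag_of a) * (1 - frag_of b)))
    = - (f h - f (h + a) - f (h + b) + f (h + a + b))"
proof -
  have "(1 - frag_of a) * (1 - frag_of b) = 1 - frag_of a - frag_of b + frag_of (a + b)"
    by (simp add: algebra_simps mult_single)
  then show ?thesis by (simp add: lin_mon_mult add.assoc)
qed

lemma lookup_mult_keys:
  fixes x y :: "'h::ab_group_add \<Rightarrow>\<^sub>0 int"
  shows "Poly_Mapping.lookup (x * y) k
    = (\<Sum>h\<in>Poly_Mapping.keys x. Poly_Mapping.lookup x h * Poly_Mapping.lookup y (k - h))"
proof -
  have 1: "Poly_Mapping.lookup (frag_of h * y) k = Poly_Mapping.lookup y (k - h)" for h k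
    by (induction y rule: frag_induct)
      (auto simp: right_diff_distrib lookup_minus mult_single algebra_simps)
  have 2: "frag_cmul c z * y = frag_cmul c (z * y)" for c and z :: "'h \<Rightarrow>\<^sub>0 int"
  proof (induction c)
    case (nonneg n)
    then show ?case by (induction n) (auto simp: frag_cmul_distrib algebra_simps)
  next
    case (neg n)
    have "frag_cmul (int j) z * y = frag_cmul (int j) (z * y)" for j
      by (induction j) (auto simp: frag_cmul_distrib algebra_simps)
    from this[of "Suc n"] show ?case
      by (metis minus_frag_cmul minus_mult_left)
  qed
  have "x * y = (\<Sum>h\<in>Poly_Mapping.keys x. frag_cmul (Poly_Mapping.lookup x h) (frag_of h * y))"
    by (subst frag_expansion[of x]) (simp add: frag_extend_def sum_distrib_right 2)
  then show ?thesis by (simp add: lookup_sum 1)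
qed

text \<open>An exponent that arises in only one way as a sum of exponents of the factors cannot cancel.\<close>

lemma lookup_mult_unique:
  fixes x y :: "'h::ab_group_add \<Rightarrow>\<^sub>0 int"
  assumes "p \<in> Poly_Mapping.keys x"
    and "\<And>h. h \<in> Poly_Mapping.keys x \<Longrightarrow> h \<noteq> p \<Longrightarrow> p + q - h \<notin> Poly_Mapping.keys y"
  shows "Poly_Mapping.lookup (x * y) (p + q) = Poly_Mapping.lookup x p * Poly_Mapping.lookup y q"
proof -
  have "Poly_Mapping.lookup (x * y) (p + q)
      = (\<Sum>h\<in>Poly_Mapping.keys x. Poly_Mapping.lookup x h * Poly_Mapping.lookup y (p + q - h))"
    by (rule lookup_mult_keys)
  also have "\<dots> = (\<Sum>h\<in>{p}. Poly_Mapping.lookup x h * Poly_Mapping.lookup y (p + q - h))"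
    using assms by (intro sum.mono_neutral_right) (auto simp: in_keys_iff)
  finally show ?thesis by simp
qed

text \<open>Only trivial units: neither the sum of the largest exponents of \<open>u\<close> and \<open>v\<close> nor that of the
  smallest ones can cancel, so both are \<open>0\<close>; hence the largest and the smallest exponent of \<open>u\<close>
  agree, and the augmentation shows that the coefficient is \<open>1\<close> or \<open>-1\<close>.\<close>

lemma group_ring_unit:
  fixes u v :: "'h::linordered_ab_group_add \<Rightarrow>\<^sub>0 int"
  assumes uv: "u * v = 1"
  obtains h s where "u = Poly_Mapping.single h s" "s = 1 \<or> s = -1"
proof -
  let ?U = "Poly_Mapping.keys u" and ?V = "Poly_Mapping.keys v"
  have ne: "?U \<noteq> {}" "?V \<noteq> {}" using uv by auto
  have nz: "p + q = 0" if "p \<in> ?U" "q \<in> ?V"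
    "\<And>h. h \<in> ?U \<Longrightarrow> h \<noteq> p \<Longrightarrow> p + q - h \<notin> ?V" for p q
  proof (rule ccontr)
    assume "p + q \<noteq> 0"
    then have "Poly_Mapping.lookup (u * v) (p + q) = 0"
      by (simp add: uv lookup_one)
    with lookup_mult_unique[OF that(1,3)] that(1,2) show False
      by (simp add: in_keys_iff)
  qed
  have mx: "Max ?U = - Max ?V"
  proof (subst eq_neg_iff_add_eq_0)
    show "Max ?U + Max ?V = 0"
    proof (rule nz)
      fix h assume h: "h \<in> ?U" "h \<noteq> Max ?U"
      then have "h < Max ?U" by (simp add: order_less_le)
      then have "Max ?V + h < Max ?U + Max ?V"
        by (subst add.commute) (rule add_strict_right_mono)
      then have "Max ?V < Max ?U + Max ?V - h" by (rule iffD2[OF less_diff_eq])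
      then show "Max ?U + Max ?V - h \<notin> ?V" by (meson Max_ge finite_keys leD)
    qed (use ne in auto)
  qed
  have mn: "Min ?U = - Min ?V"
  proof (subst eq_neg_iff_add_eq_0)
    show "Min ?U + Min ?V = 0"
    proof (rule nz)
      fix h assume h: "h \<in> ?U" "h \<noteq> Min ?U"
      then have "Min ?U < h" by (metis Min_le finite_keys order_less_le)
      then have "Min ?U + Min ?V < Min ?V + h"
        by (subst (2) add.commute) (rule add_strict_right_mono)
      then have "Min ?U + Min ?V - h < Min ?V" by (rule iffD2[OF diff_less_eq])
      then show "Min ?U + Min ?V - h \<notin> ?V" by (meson Min_le finite_keys leD)
    qed (use ne in auto)
  qed
  have "Min ?U \<le> Max ?U" "Min ?V \<le> Max ?V" using ne by auto
  then have eq: "Min ?U = Max ?U"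
    unfolding mx mn by (intro antisym) auto
  have "h = Min ?U" if "h \<in> ?U" for h
    by (metis Max_ge Min_le antisym eq finite_keys that)
  then have u: "u = Poly_Mapping.single (Min ?U) (Poly_Mapping.lookup u (Min ?U))" (is "u = ?w")
    by (intro poly_mapping_eqI) (auto simp: lookup_single when_def in_keys_iff)
  have "aug u = aug ?w" using u by (rule arg_cong)
  also have "\<dots> = Poly_Mapping.lookup u (Min ?U)" by simp
  finally have "aug u = Poly_Mapping.lookup u (Min ?U)" .
  moreover have "aug u * aug v = 1"
    using uv lin_simps(2)[of "\<lambda>_. 1" "0::'h"] by (simp flip: aug_mult)
  ultimately have "Poly_Mapping.lookup u (Min ?U) = 1 \<or> Poly_Mapping.lookup u (Min ?U) = -1"
    by (auto simp: zmult_eq_1_iff)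
  with u show ?thesis using that by blast
qed

text \<open>Finds an extremal degree for the next lemma, whatever the sign of the shift.\<close>

lemma shift_free_element:
  fixes S :: "int set"
  assumes "finite S" "S \<noteq> {}" "c \<noteq> 0"
  obtains s where "s \<in> S" "s - c \<notin> S"
proof (cases "c > 0")
  case True
  then have "Min S - c \<notin> S" using Min_le[OF assms(1), of "Min S - c"] by linarith
  with Min_in[OF assms(1,2)] show ?thesis by (rule that)
next
  case False
  then have "Max S - c \<notin> S" using Max_ge[OF assms(1), of "Max S - c"] assms(3) by linarith
  with Max_in[OF assms(1,2)] show ?thesis by (rule that)
qed

text \<open>Grade the group ring by \<open>l\<close>. Multiplication by \<open>1 - x\<close> preserves degrees and multiplication by \<open>y\<close>
  shifts them, so a component of \<open>A\<close> at an extremal degree is not affected by \<open>y A\<close> and must itself be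
  divisible by \<open>1 - x\<close>. Splitting it off leaves fewer degrees.\<close>

lemma divisible_by_one_minus_mon:
  fixes x y :: "'h::linordered_ab_group_add" and A B :: "'h \<Rightarrow>\<^sub>0 int"
  assumes l: "\<And>h k. l (h + k) = l h + (l k :: int)" "l x = 0" "l y \<noteq> 0"
    and eq: "(1 - frag_of y) * A = (1 - frag_of x) * B"
  shows "\<exists>c. A = (1 - frag_of x) * c"
  using eq
proof (induction "card (l ` Poly_Mapping.keys A)" arbitrary: A B rule: less_induct)
  case less
  define part where "part \<mu> = frag_extend (\<lambda>h. if l h = \<mu> then frag_of h else 0)" for \<mu>
  have part_diff: "part \<mu> (a - b) = part \<mu> a - part \<mu> b" for \<mu> a b
    by (simp add: part_def frag_extend_diff)
  have lookup_part: "Poly_Mapping.lookup (part \<mu> a) h = (if l h = \<mu> then Poly_Mapping.lookup a h else 0)" for \<mu> a h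
    unfolding part_def
    by (induction a rule: frag_induct) (auto simp: frag_extend_diff lookup_minus split: if_splits)
  have part_mon: "part \<mu> (frag_of k * a) = frag_of k * part (\<mu> - l k) a" for \<mu> k a
  proof (induction a rule: frag_induct)
    case (single h)
    then show ?case by (auto simp: part_def mult_single l(1))
  qed (auto simp: part_def right_diff_distrib frag_extend_diff)
  show ?case
  proof (cases "A = 0")
    case True
    then show ?thesis by (intro exI[of _ 0]) simp
  next
    case False
    obtain \<mu> where \<mu>: "\<mu> \<in> l ` Poly_Mapping.keys A" "\<mu> - l y \<notin> l ` Poly_Mapping.keys A"
      using shift_free_element[of "l ` Poly_Mapping.keys A" "l y"] l(3) False by auto
    have "part (\<mu> - l y) A = 0"
      by (rule poly_mapping_eqI) (metis image_eqI in_keys_iff lookup_part lookup_zero \<mu>(2))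
    then have "part \<mu> ((1 - frag_of y) * A) = part \<mu> A"
      by (simp add: left_diff_distrib part_diff part_mon)
    moreover have "part \<mu> ((1 - frag_of x) * B) = (1 - frag_of x) * part \<mu> B"
      by (simp add: left_diff_distrib part_diff part_mon l)
    ultimately have p: "part \<mu> A = (1 - frag_of x) * part \<mu> B"
      using less.prems by simp
    let ?A = "A - part \<mu> A"
    have "l ` Poly_Mapping.keys ?A \<subseteq> l ` Poly_Mapping.keys A - {\<mu>}"
      by (auto simp: in_keys_iff lookup_minus lookup_part split: if_splits)
    then have "card (l ` Poly_Mapping.keys ?A) < card (l ` Poly_Mapping.keys A)"
      using \<mu>(1) by (intro psubset_card_mono) (simp, blast)
    moreover have "(1 - frag_of y) * ?A = (1 - frag_of x) * (B - (1 - frag_of y) * part \<mu> B)"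
    proof -
      have "(1 - frag_of y) * ?A = (1 - frag_of y) * A - (1 - frag_of y) * part \<mu> A"
        by (rule right_diff_distrib)
      also have "\<dots> = (1 - frag_of x) * B - (1 - frag_of y) * ((1 - frag_of x) * part \<mu> B)"
        by (simp only: less.prems p)
      also have "\<dots> = (1 - frag_of x) * (B - (1 - frag_of y) * part \<mu> B)"
        by (simp only: right_diff_distrib mult.left_commute)
      finally show ?thesis .
    qed
    ultimately obtain c where "?A = (1 - frag_of x) * c" using less.hyps by blast
    then have "A = (1 - frag_of x) * c + part \<mu> A" by (simp only: diff_eq_eq)
    then have "A = (1 - frag_of x) * (c + part \<mu> B)" by (simp only: distrib_left p)
    then show ?thesis by blast
  qed
qed

text \<open>Coprimality of \<open>1 - x\<close> and \<open>1 - y\<close> for linearly independent \<open>x\<close> and \<open>y\<close>. The grading is the minor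
  formed with \<open>x\<close>, which kills \<open>x\<close> but not \<open>y\<close>.\<close>

lemma proportional_to_one_minus_mon:
  fixes x y :: "nat \<Rightarrow>\<^sub>0 int" and A B :: "(nat \<Rightarrow>\<^sub>0 int) \<Rightarrow>\<^sub>0 int"
  assumes indep: "Poly_Mapping.lookup x p * Poly_Mapping.lookup y q \<noteq> Poly_Mapping.lookup x q * Poly_Mapping.lookup y p"
    and eq: "(1 - frag_of y) * A = (1 - frag_of x) * B"
  shows "\<exists>c. A = (1 - frag_of x) * c \<and> B = (1 - frag_of y) * c"
proof -
  define l where "l h = Poly_Mapping.lookup x p * Poly_Mapping.lookup h q - Poly_Mapping.lookup x q * Poly_Mapping.lookup h p" for h
  have "\<exists>c. A = (1 - frag_of x) * c"
    by (rule divisible_by_one_minus_mon[where l = l, OF _ _ _ eq])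
      (use indep in \<open>auto simp: l_def lookup_add algebra_simps\<close>)
  then obtain c where c: "A = (1 - frag_of x) * c" by blast
  then have "(1 - frag_of x) * ((1 - frag_of y) * c) = (1 - frag_of x) * B"
    using eq by (simp only: mult.left_commute)
  moreover have "x \<noteq> 0" using indep by auto
  ultimately have "B = (1 - frag_of y) * c"
    using one_minus_mon_eq_0_iff[of x] by (simp only: mult_cancel_left) auto
  with c show ?thesis by blast
qed

section \<open>Invariants of twisted conjugacy\<close>

lemma (in group) inv_hom_eq:
  assumes "\<phi> \<in> hom G G" "x \<in> carrier G"
  shows "\<phi> (inv x) = inv (\<phi> x)"
  using assms by (metis group_hom.hom_inv group_hom.intro group_hom_axioms.intro is_group)

text \<open>If \<open>\<phi>\<close> acts without nontrivial fixed points on \<open>G / N\<close>, two elements of \<open>N\<close> that are twisted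
  conjugate in \<open>G\<close> are so by an element of \<open>N\<close>. There \<open>F\<close> is a homomorphism with \<open>F \<circ> \<phi> = F\<close>, so it
  is constant on each class inside \<open>N\<close>, while its values form an infinite subgroup of \<open>\<int>\<close>.\<close>

lemma (in group) reidemeister_infinite_if_invariant:
  fixes F :: "'a \<Rightarrow> int"
  assumes \<phi>: "\<phi> \<in> hom G G" and N: "N \<lhd> G" "\<And>x. x \<in> N \<Longrightarrow> \<phi> x \<in> N"
    and fix_free: "\<And>g. g \<in> carrier G \<Longrightarrow> g \<otimes> inv (\<phi> g) \<in> N \<Longrightarrow> g \<in> N"
    and F_mult: "\<And>x y. x \<in> N \<Longrightarrow> y \<in> N \<Longrightarrow> F (x \<otimes> y) = F x + F y"
    and F_inv: "\<And>x. x \<in> N \<Longrightarrow> F (\<phi> x) = F x"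
    and x0: "x0 \<in> N" "F x0 \<noteq> 0"
  shows "reidemeister_number G \<phi> = \<infinity>"
proof -
  interpret N: normal N G by (rule N(1))
  have F_one: "F \<one> = 0" using F_mult[of \<one> \<one>] by simp
  have F_inverse: "F (inv x) = - F x" if "x \<in> N" for x
    using F_mult[of x "inv x"] that F_one by simp
  have same: "F c = F c'" if c: "c \<in> N" "c' \<in> N" "(c, c') \<in> twisted_conj G \<phi>" for c c'
  proof -
    obtain g where g: "g \<in> carrier G" "c = g \<otimes> c' \<otimes> inv (\<phi> g)"
      using c(3) by (auto simp: twisted_conj_def)
    have \<phi>g: "\<phi> g \<in> carrier G" using g(1) \<phi> by (auto simp: hom_def)
    have c': "c' \<in> carrier G" using c(2) N.subset by blast
    have "inv (g \<otimes> c' \<otimes> inv g) \<otimes> c = g \<otimes> (inv c' \<otimes> (inv g \<otimes> (g \<otimes> (c' \<otimes> inv (\<phi> g)))))"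
      using g(1) c' \<phi>g unfolding g(2) by (simp add: inv_mult_group m_assoc)
    also have "\<dots> = g \<otimes> inv (\<phi> g)"
      using g(1) c' \<phi>g by (simp add: m_assoc[symmetric] del: m_assoc)
    finally have "inv (g \<otimes> c' \<otimes> inv g) \<otimes> c = g \<otimes> inv (\<phi> g)" .
    moreover have "g \<otimes> c' \<otimes> inv g \<in> N" using N.inv_op_closed2[OF g(1) c(2)] .
    ultimately have "g \<otimes> inv (\<phi> g) \<in> N" using c(1) N.m_closed N.m_inv_closed by metis
    then have gN: "g \<in> N" using fix_free g(1) by blast
    have "F c = F (g \<otimes> c') + F (inv (\<phi> g))"
      unfolding g(2) by (rule F_mult) (use gN c(2) N(2) in simp_all)
    also have "\<dots> = F g + F c' - F g"
      using gN c(2) by (simp add: F_mult F_inverse N(2) F_inv)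
    finally show ?thesis by simp
  qed
  have pow: "x0 [^] n \<in> N \<and> F (x0 [^] n) = int n * F x0" for n :: nat
    by (induction n) (auto simp: x0 F_one F_mult algebra_simps)
  have inf: "infinite (F ` N)"
  proof
    assume "finite (F ` N)"
    moreover have "range (\<lambda>n. int n * F x0) \<subseteq> F ` N"
    proof
      fix z assume "z \<in> range (\<lambda>n. int n * F x0)"
      then obtain n :: nat where "z = int n * F x0" by blast
      then have "z = F (x0 [^] n)" using pow by simp
      then show "z \<in> F ` N" using pow by blast
    qed
    moreover have "inj (\<lambda>n. int n * F x0)" using x0(2) by (auto simp: inj_on_def)
    ultimately show False using finite_subset range_inj_infinite by blast
  qed
  have "infinite (carrier G // twisted_conj G \<phi>)"
  proof
    assume fin: "finite (carrier G // twisted_conj G \<phi>)"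
    have "F ` N \<subseteq> (\<lambda>C. F (SOME x. x \<in> C \<inter> N)) ` (carrier G // twisted_conj G \<phi>)"
    proof
      fix z assume "z \<in> F ` N"
      then obtain y where y: "y \<in> N" "z = F y" by blast
      let ?C = "twisted_conj G \<phi> `` {y}"
      have C: "?C \<in> carrier G // twisted_conj G \<phi>" using y N.subset by (blast intro: quotientI)
      have "y \<in> ?C \<inter> N"
        using y equiv_class_self[OF equiv_twisted_conj[OF \<phi>]] N.subset by blast
      then have "(SOME x. x \<in> ?C \<inter> N) \<in> ?C \<inter> N" by (rule someI)
      then have "F (SOME x. x \<in> ?C \<inter> N) = z" using same y by (metis IntD1 IntD2 Image_singleton_iff)
      with C show "z \<in> (\<lambda>C. F (SOME x. x \<in> C \<inter> N)) ` (carrier G // twisted_conj G \<phi>)"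
        by blast
    qed
    with fin inf show False using finite_surj by blast
  qed
  then show ?thesis by (simp add: reidemeister_number_def)
qed

text \<open>Averaging over the first \<open>r\<close> iterates turns invariance under \<open>\<phi>\<^sup>r\<close> into invariance under \<open>\<phi>\<close>. This
  allows functionals that only look at blocks which \<open>\<phi>\<close> moves around in a cycle.\<close>

lemma (in group) reidemeister_infinite_if_power_invariant:
  fixes F :: "'a \<Rightarrow> int" and r :: nat
  assumes \<phi>: "\<phi> \<in> hom G G" and N: "N \<lhd> G" "\<And>x. x \<in> N \<Longrightarrow> \<phi> x \<in> N"
    and fix_free: "\<And>g. g \<in> carrier G \<Longrightarrow> g \<otimes> inv (\<phi> g) \<in> N \<Longrightarrow> g \<in> N"
    and F_mult: "\<And>x y. x \<in> N \<Longrightarrow> y \<in> N \<Longrightarrow> F (x \<otimes> y) = F x + F y"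
    and F_inv: "\<And>x. x \<in> N \<Longrightarrow> F ((\<phi> ^^ r) x) = F x"
    and x0: "x0 \<in> N" "(\<Sum>l<r. F ((\<phi> ^^ l) x0)) \<noteq> 0"
  shows "reidemeister_number G \<phi> = \<infinity>"
proof (rule reidemeister_infinite_if_invariant[OF \<phi> N fix_free, where F = "\<lambda>x. \<Sum>l<r. F ((\<phi> ^^ l) x)"])
  interpret N: normal N G by (rule N(1))
  have it: "(\<phi> ^^ l) x \<in> N" if "x \<in> N" for l x by (induction l) (auto simp: that N(2))
  have hom: "(\<phi> ^^ l) (x \<otimes> y) = (\<phi> ^^ l) x \<otimes> (\<phi> ^^ l) y" if "x \<in> N" "y \<in> N" for l x y
    using \<phi> it[OF that(1)] it[OF that(2)] N.subset
    by (induction l) (auto simp: hom_def subset_eq)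
  show "(\<Sum>l<r. F ((\<phi> ^^ l) (x \<otimes> y))) = (\<Sum>l<r. F ((\<phi> ^^ l) x)) + (\<Sum>l<r. F ((\<phi> ^^ l) y))"
    if "x \<in> N" "y \<in> N" for x y
    by (simp add: hom[OF that] F_mult it that sum.distrib)
  show "(\<Sum>l<r. F ((\<phi> ^^ l) (\<phi> x))) = (\<Sum>l<r. F ((\<phi> ^^ l) x))" if "x \<in> N" for x
  proof -
    have "(\<Sum>l<r. F ((\<phi> ^^ l) (\<phi> x))) = (\<Sum>l<r. F ((\<phi> ^^ Suc l) x))"
      by (simp add: funpow_swap1)
    moreover have "F ((\<phi> ^^ 0) x) + (\<Sum>l<r. F ((\<phi> ^^ Suc l) x)) = (\<Sum>l<r. F ((\<phi> ^^ l) x)) + F ((\<phi> ^^ r) x)"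
      using sum.lessThan_Suc[of "\<lambda>l. F ((\<phi> ^^ l) x)" r]
        sum.lessThan_Suc_shift[of "\<lambda>l. F ((\<phi> ^^ l) x)" r] by simp
    ultimately show ?thesis using F_inv[OF that] by simp
  qed
qed (use x0 in auto)

section \<open>Commuting generators, crossed homomorphisms and blocks\<close>

lemma left_null_vector:
  fixes a b c d :: int
  assumes "a * d - b * c = 0"
  obtains s t where "s \<noteq> 0 \<or> t \<noteq> 0" "s * a + t * c = 0" "s * b + t * d = 0"
proof (cases "a = 0 \<and> c = 0")
  case True
  show ?thesis
  proof (cases "b = 0 \<and> d = 0")
    case True
    then show ?thesis using \<open>a = 0 \<and> c = 0\<close> that[of 1 0] by simp
  next
    case False
    then show ?thesis using \<open>a = 0 \<and> c = 0\<close> that[of d "- b"] by (auto simp: mult.commute)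
  qed
next
  case False
  then show ?thesis using assms that[of c "- a"] by (auto simp: algebra_simps)
qed

text \<open>The generators \<open>2 k\<close> and \<open>2 k + 1\<close> form block \<open>k\<close>, and \<open>deg\<close> is the exponent sum vector of an element.
  The last assumption is the universal property of the presentation, for homomorphisms to semidirect
  products of the group ring with the exponent group: values on generators extend to a crossed
  homomorphism as soon as they respect the commutation relations.\<close>

locale commuting_generators = group G for G (structure) +
  fixes m :: nat and gen :: "nat \<Rightarrow> 'a" and deg :: "'a \<Rightarrow> (nat \<Rightarrow>\<^sub>0 int)"
    and comm :: "nat \<Rightarrow> nat \<Rightarrow> bool"
  assumes gen_closed [simp]: "p < 2 * m \<Longrightarrow> gen p \<in> carrier G"
    and generated: "carrier G = generate G (gen ` {..<2 * m})"
    and deg_mult [simp]: "x \<in> carrier G \<Longrightarrow> y \<in> carrier G \<Longrightarrow> deg (x \<otimes> y) = deg x + deg y"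
    and deg_gen [simp]: "p < 2 * m \<Longrightarrow> deg (gen p) = frag_of p"
    and gen_comm: "p < 2 * m \<Longrightarrow> q < 2 * m \<Longrightarrow> comm p q \<Longrightarrow> gen p \<otimes> gen q = gen q \<otimes> gen p"
    and crossed_exists: "additive \<theta> \<Longrightarrow>
      (\<And>p q. p < 2 * m \<Longrightarrow> q < 2 * m \<Longrightarrow> comm p q \<Longrightarrow>
        (1 - frag_of (\<theta> (frag_of q))) * d p = (1 - frag_of (\<theta> (frag_of p))) * d q) \<Longrightarrow>
      \<exists>D :: 'a \<Rightarrow> ((nat \<Rightarrow>\<^sub>0 int) \<Rightarrow>\<^sub>0 int).
        (\<forall>x\<in>carrier G. \<forall>y\<in>carrier G. D (x \<otimes> y) = D x + frag_of (\<theta> (deg x)) * D y) \<and>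
        (\<forall>p<2 * m. D (gen p) = d p)"
begin

lemma gen_induct [consumes 1, case_names one gen inv mult]:
  assumes "x \<in> carrier G" "P \<one>" "\<And>p. p < 2 * m \<Longrightarrow> P (gen p)"
    "\<And>x. x \<in> carrier G \<Longrightarrow> P x \<Longrightarrow> P (inv x)"
    "\<And>x y. x \<in> carrier G \<Longrightarrow> y \<in> carrier G \<Longrightarrow> P x \<Longrightarrow> P y \<Longrightarrow> P (x \<otimes> y)"
  shows "P x"
proof -
  have "x \<in> generate G (gen ` {..<2 * m})" using assms(1) generated by simp
  then show ?thesis
  proof (induction rule: generate.induct)
    case (eng h1 h2)
    then show ?case using assms(5) generated by blast
  qed (use assms in auto)
qed

lemma deg_one [simp]: "deg \<one> = 0"
  using deg_mult[of \<one> \<one>] by simp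

lemma deg_inv [simp]: "x \<in> carrier G \<Longrightarrow> deg (inv x) = - deg x"
  using deg_mult[of x "inv x"] by (simp add: eq_neg_iff_add_eq_0 add.commute)

lemma lookup_deg_outside: "x \<in> carrier G \<Longrightarrow> q \<ge> 2 * m \<Longrightarrow> Poly_Mapping.lookup (deg x) q = 0"
  by (induction x rule: gen_induct) (auto simp: lookup_add)

text \<open>Additive maps are only compared on degrees of group elements, which the generators control.\<close>

lemma additive_eq_on_deg:
  assumes "additive \<theta>" "additive \<theta>'" "\<And>p. p < 2 * m \<Longrightarrow> \<theta> (frag_of p) = \<theta>' (frag_of p)"
    and "x \<in> carrier G"
  shows "\<theta> (deg x) = \<theta>' (deg x)"
  using assms(4)
proof (induction x rule: gen_induct)
  case one
  then show ?case using assms(1,2) by (simp add: additive.zero)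
next
  case (inv x)
  then show ?case using assms(1,2) by (simp add: additive.minus)
next
  case (mult x y)
  then show ?case using assms(1,2) by (simp add: additive.add)
qed (use assms(3) in simp)

definition deg_kernel :: "'a set" where
  "deg_kernel = {x \<in> carrier G. deg x = 0}"

lemma deg_kernelD: "x \<in> deg_kernel \<Longrightarrow> x \<in> carrier G" "x \<in> deg_kernel \<Longrightarrow> deg x = 0"
  by (auto simp: deg_kernel_def)

lemma normal_deg_kernel: "deg_kernel \<lhd> G"
proof -
  have "subgroup deg_kernel G"
    by (rule subgroupI) (auto simp: deg_kernel_def intro!: exI[of _ \<one>])
  then show ?thesis
    by (auto simp: normal_inv_iff deg_kernel_def)
qed

lemma conj_in_deg_kernel: "x \<in> carrier G \<Longrightarrow> y \<in> deg_kernel \<Longrightarrow> x \<otimes> y \<otimes> inv x \<in> deg_kernel"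
  by (simp add: deg_kernel_def)

lemma ex_with_deg:
  "\<exists>x\<in>carrier G. \<forall>q<2 * m. Poly_Mapping.lookup (deg x) q = c q"
proof -
  have pow: "deg (x [^] (i::int)) = frag_cmul i (deg x)" if "x \<in> carrier G" for x i
  proof -
    have n: "deg (x [^] (n::nat)) = frag_cmul (int n) (deg x)" for n
      by (induction n) (auto simp: that frag_cmul_distrib)
    show ?thesis
      by (cases i rule: int_cases2) (auto simp: int_pow_int int_pow_neg that n)
  qed
  have "n \<le> 2 * m \<Longrightarrow> \<exists>x\<in>carrier G. \<forall>q. Poly_Mapping.lookup (deg x) q = (if q < n then c q else 0)" for n
  proof (induction n)
    case 0
    then show ?case by (intro bexI[of _ \<one>]) auto
  next
    case (Suc n)
    then obtain x where x: "x \<in> carrier G" "\<And>q. Poly_Mapping.lookup (deg x) q = (if q < n then c q else 0)"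
      by auto
    then show ?case using Suc.prems
      by (intro bexI[of _ "x \<otimes> gen n [^] c n"]) (auto simp: lookup_add pow less_Suc_eq)
  qed
  from this[OF order_refl] obtain x where "x \<in> carrier G"
    "\<And>q. Poly_Mapping.lookup (deg x) q = (if q < 2 * m then c q else 0)" by metis
  then show ?thesis by (intro bexI[of _ x]) simp_all
qed

text \<open>Written with the inverse of \<open>y x\<close>, so that a crossed homomorphism takes the value
  \<open>D (x y) - D (y x)\<close> on it.\<close>

definition commutator :: "'a \<Rightarrow> 'a \<Rightarrow> 'a" where
  "commutator x y = x \<otimes> y \<otimes> inv (y \<otimes> x)"

lemma hom_commutator:
  "\<phi> \<in> hom G G \<Longrightarrow> x \<in> carrier G \<Longrightarrow> y \<in> carrier G \<Longrightarrow> \<phi> (commutator x y) = commutator (\<phi> x) (\<phi> y)"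
  by (simp add: commutator_def inv_hom_eq hom_mult hom_in_carrier inv_mult_group m_assoc)

lemma commutator_in_kernel:
  "x \<in> carrier G \<Longrightarrow> y \<in> carrier G \<Longrightarrow> commutator x y \<in> deg_kernel"
  by (simp add: commutator_def deg_kernel_def)

definition crossed :: "((nat \<Rightarrow>\<^sub>0 int) \<Rightarrow> (nat \<Rightarrow>\<^sub>0 int)) \<Rightarrow> ('a \<Rightarrow> ((nat \<Rightarrow>\<^sub>0 int) \<Rightarrow>\<^sub>0 int)) \<Rightarrow> bool" where
  "crossed \<theta> D \<longleftrightarrow> additive \<theta> \<and>
     (\<forall>x\<in>carrier G. \<forall>y\<in>carrier G. D (x \<otimes> y) = D x + frag_of (\<theta> (deg x)) * D y)"

lemma crossedI:
  assumes "additive \<theta>"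
    "\<And>x y. x \<in> carrier G \<Longrightarrow> y \<in> carrier G \<Longrightarrow> D (x \<otimes> y) = D x + frag_of (\<theta> (deg x)) * D y"
  shows "crossed \<theta> D"
  using assms by (auto simp: crossed_def)

lemma crossed_mult:
  "crossed \<theta> D \<Longrightarrow> x \<in> carrier G \<Longrightarrow> y \<in> carrier G \<Longrightarrow> D (x \<otimes> y) = D x + frag_of (\<theta> (deg x)) * D y"
  by (simp add: crossed_def)

lemma crossed_additive: "crossed \<theta> D \<Longrightarrow> additive \<theta>"
  by (simp add: crossed_def)

lemma crossed_one: "crossed \<theta> D \<Longrightarrow> D \<one> = 0"
  using crossed_mult[of \<theta> D \<one> \<one>] by (simp add: additive.zero[OF crossed_additive])

lemma crossed_inv:
  assumes "crossed \<theta> D" "x \<in> carrier G"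
  shows "frag_of (\<theta> (deg x)) * D (inv x) = - D x"
  using crossed_mult[OF assms, of "inv x"] assms(2) crossed_one[OF assms(1)]
  by (simp add: eq_neg_iff_add_eq_0 add.commute)

lemma crossed_commutator:
  assumes "crossed \<theta> D" "x \<in> carrier G" "y \<in> carrier G"
  shows "D (commutator x y) = (1 - frag_of (\<theta> (deg y))) * D x - (1 - frag_of (\<theta> (deg x))) * D y"
proof -
  have "D (commutator x y) = D (x \<otimes> y) + frag_of (\<theta> (deg (y \<otimes> x))) * D (inv (y \<otimes> x))"
    using assms by (simp add: commutator_def crossed_mult[OF assms(1), of "x \<otimes> y"] add.commute)
  also have "\<dots> = D (x \<otimes> y) - D (y \<otimes> x)"
    using crossed_inv[OF assms(1), of "y \<otimes> x"] assms by simp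
  finally show ?thesis
    using assms by (simp add: crossed_mult[OF assms(1)] left_diff_distrib)
qed

lemma crossed_commuting:
  assumes "crossed \<theta> D" "x \<in> carrier G" "y \<in> carrier G" "x \<otimes> y = y \<otimes> x"
  shows "(1 - frag_of (\<theta> (deg y))) * D x = (1 - frag_of (\<theta> (deg x))) * D y"
  using crossed_commutator[OF assms(1-3)] assms crossed_one[OF assms(1)]
  by (simp add: commutator_def)

text \<open>On the kernel of \<open>deg\<close> the action is trivial, so crossed homomorphisms are homomorphisms there.\<close>

lemma crossed_kernel_add:
  assumes "crossed \<theta> D" "x \<in> deg_kernel" "y \<in> deg_kernel"
  shows "D (x \<otimes> y) = D x + D y"
  using crossed_mult[OF assms(1), of x y] assms
  by (simp add: deg_kernelD additive.zero[OF crossed_additive])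

lemma crossed_conj:
  assumes "crossed \<theta> D" "x \<in> carrier G" "y \<in> deg_kernel"
  shows "D (x \<otimes> y \<otimes> inv x) = frag_of (\<theta> (deg x)) * D y"
proof -
  have "D (x \<otimes> y \<otimes> inv x) = D (x \<otimes> y) + frag_of (\<theta> (deg (x \<otimes> y))) * D (inv x)"
    using assms by (intro crossed_mult) (auto simp: deg_kernelD)
  then show ?thesis
    using assms crossed_inv[OF assms(1,2)] by (simp add: deg_kernelD crossed_mult[OF assms(1)])
qed

lemma crossed_eqI:
  assumes D: "crossed \<theta> D" and D': "crossed \<theta>' D'"
    and gens: "\<And>p. p < 2 * m \<Longrightarrow> \<theta> (frag_of p) = \<theta>' (frag_of p)"
      "\<And>p. p < 2 * m \<Longrightarrow> D (gen p) = D' (gen p)"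
    and x: "x \<in> carrier G"
  shows "D x = D' x"
  using x
proof (induction x rule: gen_induct)
  case one
  show ?case using crossed_one[OF D] crossed_one[OF D'] by simp
next
  case (inv x)
  have eq: "\<theta> (deg x) = \<theta>' (deg x)"
    using additive_eq_on_deg crossed_additive D D' gens(1) inv(1) by blast
  have "frag_of (\<theta> (deg x)) * D (inv x) = frag_of (\<theta> (deg x)) * D' (inv x)"
    using crossed_inv[OF D inv(1)] crossed_inv[OF D' inv(1)] inv(2) eq by simp
  then show ?case by (subst (asm) mult_cancel_left) simp
next
  case (mult x y)
  have eq: "\<theta> (deg x) = \<theta>' (deg x)"
    using additive_eq_on_deg crossed_additive D D' gens(1) mult(1) by blast
  then show ?case using mult by (simp add: crossed_mult[OF D] crossed_mult[OF D'])
qed (use gens(2) in simp)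

lemma crossed_principal: "additive \<theta> \<Longrightarrow> crossed \<theta> (\<lambda>x. 1 - frag_of (\<theta> (deg x)))"
  by (rule crossedI) (simp_all add: additive.add right_diff_distrib mon_add)

lemma crossed_zero: "additive \<theta> \<Longrightarrow> crossed \<theta> (\<lambda>_. 0)"
  by (rule crossedI) simp_all

lemma crossed_combination:
  assumes "crossed \<theta> D" "crossed \<theta> D'"
  shows "crossed \<theta> (\<lambda>x. a * D x + b * D' x)"
  by (rule crossedI) (use assms in \<open>auto simp: crossed_mult crossed_additive algebra_simps\<close>)

lemma crossed_push:
  assumes "crossed \<theta> D" "additive \<eta>"
  shows "crossed (\<lambda>h. \<eta> (\<theta> h)) (\<lambda>x. push \<eta> (D x))"
proof (rule crossedI)
  show "additive (\<lambda>h. \<eta> (\<theta> h))"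
    using assms by (intro additive.intro) (simp add: crossed_additive additive.add)
qed (simp add: crossed_mult[OF assms(1)] push_mult[OF assms(2)])

text \<open>The action of \<open>\<phi>\<close> on the abelianisation. Exponents beyond the generators are sent to \<open>0\<close>, so that
  matrix entries with indices below \<open>2 m\<close> describe it on all exponent vectors.\<close>

definition bar :: "('a \<Rightarrow> 'a) \<Rightarrow> (nat \<Rightarrow>\<^sub>0 int) \<Rightarrow> (nat \<Rightarrow>\<^sub>0 int)" where
  "bar \<phi> = frag_extend (\<lambda>p. if p < 2 * m then deg (\<phi> (gen p)) else 0)"

definition entry :: "('a \<Rightarrow> 'a) \<Rightarrow> nat \<Rightarrow> nat \<Rightarrow> int" where
  "entry \<phi> q p = Poly_Mapping.lookup (deg (\<phi> (gen p))) q"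

lemma additive_bar: "additive (bar \<phi>)"
  by (intro additive.intro) (simp add: bar_def frag_extend_add)

lemma bar_gen: "p < 2 * m \<Longrightarrow> bar \<phi> (frag_of p) = deg (\<phi> (gen p))"
  by (simp add: bar_def)

lemma bar_deg:
  assumes "\<phi> \<in> hom G G" "x \<in> carrier G"
  shows "bar \<phi> (deg x) = deg (\<phi> x)"
  using assms(2)
proof (induction x rule: gen_induct)
  case one
  show ?case using hom_one[OF assms(1) is_group is_group] by (simp add: additive.zero[OF additive_bar])
next
  case (gen p)
  then show ?case by (simp add: bar_gen)
next
  case (inv x)
  have "\<phi> x \<in> carrier G" using assms(1) inv by (auto simp: hom_def)
  then show ?case using inv assms(1) by (simp add: inv_hom_eq additive.minus[OF additive_bar])
next
  case (mult x y)
  have "\<phi> x \<in> carrier G" "\<phi> y \<in> carrier G" "\<phi> (x \<otimes> y) = \<phi> x \<otimes> \<phi> y"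
    using assms(1) mult by (auto simp: hom_def)
  then show ?case using mult by (simp add: additive.add[OF additive_bar])
qed

lemma lookup_bar:
  "Poly_Mapping.lookup (bar \<phi> h) q = (\<Sum>p<2 * m. Poly_Mapping.lookup h p * entry \<phi> q p)"
proof (induction h rule: frag_induct)
  case zero
  then show ?case by (simp add: bar_def)
next
  case (single p)
  have "(\<Sum>i<2 * m. Poly_Mapping.lookup (frag_of p) i * entry \<phi> q i)
      = (\<Sum>i<2 * m. if i = p then entry \<phi> q i else 0)"
    by (intro sum.cong) auto
  then show ?case by (simp add: bar_def entry_def)
next
  case (diff a b)
  then show ?case
    by (simp add: additive.diff[OF additive_bar] lookup_minus left_diff_distrib sum_subtractf)
qed

lemma crossed_comp:
  assumes "crossed \<theta> D" "\<phi> \<in> hom G G"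
  shows "crossed (\<lambda>h. \<theta> (bar \<phi> h)) (\<lambda>x. D (\<phi> x))"
proof (rule crossedI)
  show "additive (\<lambda>h. \<theta> (bar \<phi> h))"
    using crossed_additive[OF assms(1)] by (intro additive.intro) (simp add: additive.add additive_bar)
  fix x y assume xy: "x \<in> carrier G" "y \<in> carrier G"
  then have "\<phi> x \<in> carrier G" "\<phi> y \<in> carrier G" "\<phi> (x \<otimes> y) = \<phi> x \<otimes> \<phi> y"
    using assms(2) by (auto simp: hom_def)
  then show "D (\<phi> (x \<otimes> y)) = D (\<phi> x) + frag_of (\<theta> (bar \<phi> (deg x))) * D (\<phi> y)"
    by (simp add: crossed_mult[OF assms(1)] bar_deg[OF assms(2) xy(1)])
qed

lemma hom_deg_kernel:
  assumes "\<phi> \<in> hom G G" "x \<in> deg_kernel"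
  shows "\<phi> x \<in> deg_kernel"
  using assms bar_deg[OF assms(1), of x]
  by (auto simp: deg_kernel_def hom_def additive.zero[OF additive_bar])

lemma iso_inverseE:
  assumes "\<phi> \<in> iso G G"
  obtains \<psi> where "\<psi> \<in> iso G G" "\<And>x. x \<in> carrier G \<Longrightarrow> \<psi> (\<phi> x) = x"
    "\<And>x. x \<in> carrier G \<Longrightarrow> \<phi> (\<psi> x) = x"
proof
  have b: "bij_betw \<phi> (carrier G) (carrier G)" using assms by (simp add: iso_def)
  show "inv_into (carrier G) \<phi> \<in> iso G G" by (rule iso_set_sym[OF assms])
  show "inv_into (carrier G) \<phi> (\<phi> x) = x" if "x \<in> carrier G" for x
    using b that by (simp add: bij_betw_def)
  show "\<phi> (inv_into (carrier G) \<phi> x) = x" if "x \<in> carrier G" for x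
    using b that by (simp add: bij_betw_inv_into_right)
qed

lemma iso_imp_hom: "\<phi> \<in> iso G G \<Longrightarrow> \<phi> \<in> hom G G"
  by (simp add: iso_def)

lemma iso_closed: "\<phi> \<in> iso G G \<Longrightarrow> x \<in> carrier G \<Longrightarrow> \<phi> x \<in> carrier G"
  by (auto simp: iso_def hom_def)

lemma deg_iso_eq_0_iff:
  assumes "\<phi> \<in> iso G G" "x \<in> carrier G"
  shows "deg (\<phi> x) = 0 \<longleftrightarrow> deg x = 0"
proof -
  obtain \<psi> where \<psi>: "\<psi> \<in> iso G G" "\<And>x. x \<in> carrier G \<Longrightarrow> \<psi> (\<phi> x) = x"
    by (rule iso_inverseE[OF assms(1)]) (simp add: that)
  show ?thesis
    using bar_deg[OF iso_imp_hom[OF \<psi>(1)] iso_closed[OF assms]] \<psi>(2)[OF assms(2)]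
      bar_deg[OF iso_imp_hom[OF assms(1)] assms(2)]
    by (metis additive.zero additive_bar)
qed

lemma iso_funpow: "\<phi> \<in> iso G G \<Longrightarrow> (\<phi> ^^ l) \<in> iso G G"
proof (induction l)
  case 0
  then show ?case by (auto simp: iso_def hom_def bij_betw_def)
next
  case (Suc l)
  then show ?case
    unfolding funpow.simps by (intro iso_set_trans) simp_all
qed

definition proj :: "nat set \<Rightarrow> (nat \<Rightarrow>\<^sub>0 int) \<Rightarrow> (nat \<Rightarrow>\<^sub>0 int)" where
  "proj S = frag_extend (\<lambda>p. if p div 2 \<in> S then frag_of p else 0)"

lemma additive_proj: "additive (proj S)"
  by (intro additive.intro) (simp add: proj_def frag_extend_add)

lemma proj_frag_of [simp]: "proj S (frag_of p) = (if p div 2 \<in> S then frag_of p else 0)"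
  by (simp add: proj_def)

lemma lookup_proj: "Poly_Mapping.lookup (proj S h) p = (if p div 2 \<in> S then Poly_Mapping.lookup h p else 0)"
  by (induction h rule: frag_induct)
    (auto simp: lookup_minus additive.diff[OF additive_proj] additive.zero[OF additive_proj])

lemma additive_proj_bar: "additive (\<lambda>h. proj S (bar \<phi> h))"
  by (intro additive.intro) (simp add: additive.add additive_proj additive_bar)

definition permutes_blocks :: "('a \<Rightarrow> 'a) \<Rightarrow> (nat \<Rightarrow> nat) \<Rightarrow> bool" where
  "permutes_blocks \<phi> \<sigma> \<longleftrightarrow> \<sigma> permutes {..<m} \<and>
     (\<forall>p<2 * m. \<forall>q. entry \<phi> q p \<noteq> 0 \<longrightarrow> q div 2 = \<sigma> (p div 2))"

lemma lookup_bar_block: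
  assumes "permutes_blocks \<phi> \<sigma>" "k < m" "q div 2 = \<sigma> k"
  shows "Poly_Mapping.lookup (bar \<phi> h) q
    = Poly_Mapping.lookup h (2 * k) * entry \<phi> q (2 * k)
      + Poly_Mapping.lookup h (2 * k + 1) * entry \<phi> q (2 * k + 1)"
proof -
  have "(\<Sum>p<2 * m. Poly_Mapping.lookup h p * entry \<phi> q p)
      = (\<Sum>p\<in>{2 * k, 2 * k + 1}. Poly_Mapping.lookup h p * entry \<phi> q p)"
  proof (rule sum.mono_neutral_right)
    show "\<forall>p\<in>{..<2 * m} - {2 * k, 2 * k + 1}. Poly_Mapping.lookup h p * entry \<phi> q p = 0"
    proof
      fix p assume p: "p \<in> {..<2 * m} - {2 * k, 2 * k + 1}"
      then have "p div 2 \<noteq> k" by auto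
      then have "\<sigma> (p div 2) \<noteq> \<sigma> k"
        using assms(1) by (metis permutes_blocks_def permutes_inj injD)
      then show "Poly_Mapping.lookup h p * entry \<phi> q p = 0"
        using assms(1,3) p by (auto simp: permutes_blocks_def)
    qed
  qed (use assms(2) in auto)
  then show ?thesis by (simp add: lookup_bar)
qed

lemma permutes_blocks_funpow:
  assumes "\<phi> \<in> iso G G" "permutes_blocks \<phi> \<sigma>"
  shows "permutes_blocks (\<phi> ^^ l) (\<sigma> ^^ l)"
proof (induction l)
  case 0
  then show ?case by (auto simp: permutes_blocks_def entry_def permutes_def split: if_splits)
next
  case (Suc l)
  have "q div 2 = (\<sigma> ^^ Suc l) (p div 2)" if p: "p < 2 * m" and nz: "entry (\<phi> ^^ Suc l) q p \<noteq> 0" for p q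
  proof -
    have c: "(\<phi> ^^ l) (gen p) \<in> carrier G" using iso_closed[OF iso_funpow[OF assms(1)]] p by simp
    have "Poly_Mapping.lookup (bar \<phi> (deg ((\<phi> ^^ l) (gen p)))) q \<noteq> 0"
      using nz by (simp add: bar_deg[OF iso_imp_hom[OF assms(1)] c] entry_def)
    then obtain p' where p': "p' < 2 * m" "entry (\<phi> ^^ l) p' p \<noteq> 0" "entry \<phi> q p' \<noteq> 0"
      unfolding lookup_bar entry_def by (metis (mono_tags, lifting) lessThan_iff mult_zero_left mult_zero_right sum.neutral)
    then show ?thesis
      using assms(2) Suc.IH p by (auto simp: permutes_blocks_def)
  qed
  moreover have "(\<sigma> ^^ Suc l) permutes {..<m}"
    using assms(2) Suc.IH unfolding permutes_blocks_def funpow.simps by (blast intro: permutes_compose)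
  ultimately show ?case unfolding permutes_blocks_def by blast
qed

lemma block_permutation_inverse:
  assumes "permutes_blocks \<phi> \<sigma>" "permutes_blocks \<psi> \<tau>" "\<phi> \<in> iso G G" "\<psi> \<in> iso G G"
    and "\<And>x. x \<in> carrier G \<Longrightarrow> \<psi> (\<phi> x) = x" and k: "k < m"
  shows "\<tau> (\<sigma> k) = k"
proof -
  have g: "gen (2 * k) \<in> carrier G" using k by simp
  have "Poly_Mapping.lookup (bar \<psi> (deg (\<phi> (gen (2 * k))))) (2 * k) \<noteq> 0"
    using bar_deg[OF iso_imp_hom[OF assms(4)] iso_closed[OF assms(3) g]] assms(5)[OF g] k by simp
  then obtain p where "p < 2 * m" "entry \<phi> p (2 * k) * entry \<psi> (2 * k) p \<noteq> 0"
    unfolding lookup_bar entry_def by (meson lessThan_iff sum.not_neutral_contains_not_neutral)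
  moreover have "entry \<phi> q (2 * k) \<noteq> 0 \<Longrightarrow> q div 2 = \<sigma> ((2 * k) div 2)" for q
    using assms(1) k unfolding permutes_blocks_def by (metis mult_less_cancel1 zero_less_numeral)
  ultimately have "p div 2 = \<sigma> k" by simp
  moreover note \<open>p < 2 * m\<close> \<open>entry \<phi> p (2 * k) * entry \<psi> (2 * k) p \<noteq> 0\<close>
  moreover have "\<forall>p<2 * m. \<forall>q. entry \<psi> q p \<noteq> 0 \<longrightarrow> q div 2 = \<tau> (p div 2)"
    using assms(2) unfolding permutes_blocks_def by blast
  ultimately have "(2 * k) div 2 = \<tau> (p div 2)" "p div 2 = \<sigma> k" by simp_all
  then show ?thesis by simp
qed

lemma block_permutation_unique:
  assumes "permutes_blocks \<phi> \<sigma>" "permutes_blocks \<phi> \<tau>" "\<phi> \<in> iso G G" "k < m"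
  shows "\<sigma> k = \<tau> k"
proof -
  have "deg (\<phi> (gen (2 * k))) \<noteq> 0" using deg_iso_eq_0_iff[OF assms(3), of "gen (2 * k)"] assms(4) by simp
  then obtain q where "entry \<phi> q (2 * k) \<noteq> 0"
    unfolding entry_def by (metis lookup_zero poly_mapping_eqI)
  then have "q div 2 = \<sigma> ((2 * k) div 2)" "q div 2 = \<tau> ((2 * k) div 2)"
    using assms unfolding permutes_blocks_def by (metis mult_less_cancel1 zero_less_numeral)+
  then show ?thesis by simp
qed

text \<open>The block of the inverse automorphism is an inverse integer matrix.\<close>

lemma block_unimodular:
  assumes \<phi>: "\<phi> \<in> iso G G" "permutes_blocks \<phi> \<sigma>" and \<psi>: "\<psi> \<in> iso G G" "permutes_blocks \<psi> \<tau>"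
    and inv: "\<And>x. x \<in> carrier G \<Longrightarrow> \<psi> (\<phi> x) = x" and k: "k < m" and j: "j = \<sigma> k"
  defines "d \<equiv> entry \<phi> (2 * j) (2 * k) * entry \<phi> (2 * j + 1) (2 * k + 1)
    - entry \<phi> (2 * j) (2 * k + 1) * entry \<phi> (2 * j + 1) (2 * k)"
  shows "d = 1 \<or> d = -1"
proof -
  have jm: "j < m" using permutes_in_image[of \<sigma> "{..<m}" k] \<phi>(2) k by (simp add: j permutes_blocks_def)
  have \<tau>: "\<tau> j = k" using block_permutation_inverse[OF \<phi>(2) \<psi>(2) \<phi>(1) \<psi>(1) inv k] j by simp
  let ?e = "\<lambda>c d. entry \<phi> (2 * j + c) (2 * k + d)" and ?f = "\<lambda>c d. entry \<psi> (2 * k + c) (2 * j + d)"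
  have prod: "?e 0 d * ?f c 0 + ?e 1 d * ?f c 1 = (if c = d then 1 else 0)" if "c < 2" "d < 2" for c d
  proof -
    have g: "gen (2 * k + d) \<in> carrier G" using k that by simp
    have "bar \<psi> (deg (\<phi> (gen (2 * k + d)))) = frag_of (2 * k + d)"
      using bar_deg[OF iso_imp_hom[OF \<psi>(1)] iso_closed[OF \<phi>(1) g]] inv[OF g] k that by simp
    moreover have "(2 * k + c) div 2 = \<tau> j" using that \<tau> by simp
    ultimately show ?thesis
      using lookup_bar_block[OF \<psi>(2) jm, of "2 * k + c" "deg (\<phi> (gen (2 * k + d)))"]
      by (simp add: entry_def)
  qed
  have "d * (?f 0 0 * ?f 1 1 - ?f 0 1 * ?f 1 0)
      = (?e 0 0 * ?f 0 0 + ?e 1 0 * ?f 0 1) * (?e 0 1 * ?f 1 0 + ?e 1 1 * ?f 1 1)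
        - (?e 0 1 * ?f 0 0 + ?e 1 1 * ?f 0 1) * (?e 0 0 * ?f 1 0 + ?e 1 0 * ?f 1 1)"
    by (simp add: d_def algebra_simps)
  also have "\<dots> = 1" using prod[of 0 0] prod[of 0 1] prod[of 1 0] prod[of 1 1] by simp
  finally show ?thesis using zmult_eq_1_iff by blast
qed

definition is_period :: "(nat \<Rightarrow> nat) \<Rightarrow> nat \<Rightarrow> nat \<Rightarrow> bool" where
  "is_period \<sigma> k r \<longleftrightarrow> r > 0 \<and> (\<sigma> ^^ r) k = k \<and> (\<forall>l. 0 < l \<longrightarrow> l < r \<longrightarrow> (\<sigma> ^^ l) k \<noteq> k)"

lemma period_exists:
  assumes "\<sigma> permutes {..<m}"
  obtains r where "is_period \<sigma> k r"
proof -
  have "\<exists>r>0. (\<sigma> ^^ r) k = k"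
  proof (cases "k < m")
    case True
    have "(\<sigma> ^^ n) k \<in> {..<m}" for n
      by (induction n) (use True permutes_in_image[OF assms] in auto)
    then have "finite {y. \<exists>n. y = (\<sigma> ^^ n) k}"
      by (intro finite_subset[OF _ finite_lessThan[of m]] subsetI) (elim CollectE exE, simp)
    then show ?thesis using funpow_inj_finite[OF permutes_inj[OF assms]] by metis
  next
    case False
    then have "\<sigma> k = k" using assms by (simp add: permutes_def)
    then show ?thesis by (intro exI[of _ 1]) simp
  qed
  then obtain r where r: "r > 0 \<and> (\<sigma> ^^ r) k = k"
    and least: "\<And>l. l < r \<Longrightarrow> \<not> (l > 0 \<and> (\<sigma> ^^ l) k = k)"
    using exists_least_iff[of "\<lambda>r. r > 0 \<and> (\<sigma> ^^ r) k = k"] by (metis (no_types, lifting))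
  then have "is_period \<sigma> k r" by (auto simp: is_period_def)
  then show ?thesis by (rule that)
qed

text \<open>The determinant of \<open>1 - M\<close>, where \<open>M\<close> is the diagonal block \<open>k\<close> of the matrix of \<open>\<phi>\<close>.\<close>

definition fix_det :: "('a \<Rightarrow> 'a) \<Rightarrow> nat \<Rightarrow> int" where
  "fix_det \<phi> k = (1 - entry \<phi> (2 * k) (2 * k)) * (1 - entry \<phi> (2 * k + 1) (2 * k + 1))
     - entry \<phi> (2 * k) (2 * k + 1) * entry \<phi> (2 * k + 1) (2 * k)"

text \<open>Here the abelianisation is enough. A left eigenvector of the return map with eigenvalue 1 gives a
  \<open>\<phi>\<^sup>r\<close>-invariant homomorphism; on a generator of block \<open>k\<close> the other terms of the averaged sum vanish,
  because the images lie in different blocks.\<close>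

lemma reidemeister_infinite_if_fix_det_eq_0:
  assumes \<phi>: "\<phi> \<in> iso G G" "permutes_blocks \<phi> \<sigma>" and k: "k < m" and r: "is_period \<sigma> k r"
    and det: "fix_det (\<phi> ^^ r) k = 0"
  shows "reidemeister_number G \<phi> = \<infinity>"
proof -
  let ?e = "\<lambda>c d. entry (\<phi> ^^ r) (2 * k + c) (2 * k + d)"
  obtain s t where st: "s \<noteq> 0 \<or> t \<noteq> 0" "s * (1 - ?e 0 0) + t * (- ?e 1 0) = 0"
    "s * (- ?e 0 1) + t * (1 - ?e 1 1) = 0"
    by (rule left_null_vector[of "1 - ?e 0 0" "1 - ?e 1 1" "- ?e 0 1" "- ?e 1 0"])
      (use det in \<open>auto simp: fix_det_def\<close>)
  define F where "F x = s * Poly_Mapping.lookup (deg x) (2 * k) + t * Poly_Mapping.lookup (deg x) (2 * k + 1)" for x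
  have pb: "permutes_blocks (\<phi> ^^ l) (\<sigma> ^^ l)" for l
    using permutes_blocks_funpow[OF \<phi>] .
  define x0 where "x0 = gen (if s \<noteq> 0 then 2 * k else 2 * k + 1)"
  have x0: "x0 \<in> carrier G" using k by (auto simp: x0_def)
  show ?thesis
  proof (rule reidemeister_infinite_if_power_invariant[where F = F and r = r and N = "carrier G" and ?x0.0 = x0])
    show "\<phi> \<in> hom G G" using \<phi>(1) by (rule iso_imp_hom)
    show "carrier G \<lhd> G" by (simp add: normal_inv_iff subgroup_self)
    show "\<phi> x \<in> carrier G" if "x \<in> carrier G" for x using \<phi>(1) that by (rule iso_closed)
    show "F (x \<otimes> y) = F x + F y" if "x \<in> carrier G" "y \<in> carrier G" for x y
      using that by (simp add: F_def lookup_add algebra_simps)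
    show "F ((\<phi> ^^ r) x) = F x" if x: "x \<in> carrier G" for x
    proof -
      let ?h = "\<lambda>c. Poly_Mapping.lookup (deg x) (2 * k + c)"
      have e: "Poly_Mapping.lookup (deg ((\<phi> ^^ r) x)) (2 * k + c) = ?h 0 * ?e c 0 + ?h 1 * ?e c 1"
        if "c < 2" for c
        using lookup_bar_block[OF pb[of r] k, of "2 * k + c" "deg x"] that r
        by (simp add: bar_deg[OF iso_imp_hom[OF iso_funpow[OF \<phi>(1)]] x] is_period_def)
      have "F ((\<phi> ^^ r) x) = s * (?h 0 * ?e 0 0 + ?h 1 * ?e 0 1) + t * (?h 0 * ?e 1 0 + ?h 1 * ?e 1 1)"
        using e[of 0] e[of 1] by (simp add: F_def)
      also have "\<dots> = F x - ?h 0 * (s * (1 - ?e 0 0) + t * (- ?e 1 0)) - ?h 1 * (s * (- ?e 0 1) + t * (1 - ?e 1 1))"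
        by (simp add: F_def algebra_simps)
      finally show ?thesis using st by simp
    qed
    have "F ((\<phi> ^^ l) x0) = 0" if l: "0 < l" "l < r" for l
    proof -
      have "(\<sigma> ^^ l) k \<noteq> k" using r l by (simp add: is_period_def)
      have "entry (\<phi> ^^ l) (2 * k + c) (2 * k + d) = 0" if "c < 2" "d < 2" for c d
      proof (rule ccontr)
        assume nz: "entry (\<phi> ^^ l) (2 * k + c) (2 * k + d) \<noteq> 0"
        have "(2 * k + c) div 2 = k" "(2 * k + d) div 2 = k" "2 * k + d < 2 * m"
          using that k by auto
        with nz pb[of l] have "k = (\<sigma> ^^ l) k" unfolding permutes_blocks_def by metis
        with \<open>(\<sigma> ^^ l) k \<noteq> k\<close> show False by simp
      qed
      from this[of 0 0] this[of 1 0] this[of 0 1] this[of 1 1] show ?thesis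
        by (simp add: F_def x0_def entry_def)
    qed
    then have "(\<Sum>l<r. F ((\<phi> ^^ l) x0)) = (\<Sum>l\<in>{0}. F ((\<phi> ^^ l) x0))"
      using r by (intro sum.mono_neutral_right) (auto simp: is_period_def)
    also have "\<dots> \<noteq> 0" using st(1) k by (auto simp: F_def x0_def)
    finally show "(\<Sum>l<r. F ((\<phi> ^^ l) x0)) \<noteq> 0" .
  qed (use x0 in auto)
qed

text \<open>A fixed vector of the abelianisation has, in every block, a component fixed by the return map.\<close>

lemma deg_eq_0_if_fixed:
  assumes \<phi>: "\<phi> \<in> iso G G" "permutes_blocks \<phi> \<sigma>"
    and det: "\<And>k r. k < m \<Longrightarrow> is_period \<sigma> k r \<Longrightarrow> fix_det (\<phi> ^^ r) k \<noteq> 0"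
    and g: "g \<in> carrier G" "deg (\<phi> g) = deg g"
  shows "deg g = 0"
proof (rule poly_mapping_eqI)
  fix q
  have fixed: "deg ((\<phi> ^^ l) g) = deg g" for l
  proof (induction l)
    case (Suc l)
    have "(\<phi> ^^ l) g \<in> carrier G" using iso_closed[OF iso_funpow[OF \<phi>(1)] g(1)] .
    then have "deg ((\<phi> ^^ Suc l) g) = bar \<phi> (deg ((\<phi> ^^ l) g))"
      by (simp add: bar_deg iso_imp_hom \<phi>(1))
    then show ?case using Suc g by (simp add: bar_deg iso_imp_hom \<phi>(1))
  qed simp
  show "Poly_Mapping.lookup (deg g) q = Poly_Mapping.lookup 0 q"
  proof (cases "q < 2 * m")
    case False
    then show ?thesis using lookup_deg_outside[OF g(1)] by simp
  next
    case True
    define k where "k = q div 2"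
    have k: "k < m" using True by (auto simp: k_def)
    obtain r where r: "is_period \<sigma> k r"
      using period_exists \<phi>(2) unfolding permutes_blocks_def by blast
    let ?e = "\<lambda>c d. entry (\<phi> ^^ r) (2 * k + c) (2 * k + d)"
    let ?h = "\<lambda>c. Poly_Mapping.lookup (deg g) (2 * k + c)"
    have e: "?h c = ?h 0 * ?e c 0 + ?h 1 * ?e c 1" if "c < 2" for c
      using lookup_bar_block[OF permutes_blocks_funpow[OF \<phi>, of r] k, of "2 * k + c" "deg g"] that r
      by (simp add: bar_deg[OF iso_imp_hom[OF iso_funpow[OF \<phi>(1)]] g(1)] is_period_def fixed)
    have e0: "(1 - ?e 0 0) * ?h 0 = ?e 0 1 * ?h 1" and e1: "(1 - ?e 1 1) * ?h 1 = ?e 1 0 * ?h 0"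
      using e[of 0] e[of 1] by (simp_all add: algebra_simps)
    have d: "fix_det (\<phi> ^^ r) k = (1 - ?e 0 0) * (1 - ?e 1 1) - ?e 0 1 * ?e 1 0"
      by (simp add: fix_det_def)
    have "fix_det (\<phi> ^^ r) k * ?h 0 = (1 - ?e 1 1) * ((1 - ?e 0 0) * ?h 0) - ?e 0 1 * (?e 1 0 * ?h 0)"
      unfolding d by (simp add: algebra_simps)
    also have "\<dots> = 0" unfolding e0 e1[symmetric] by (simp add: algebra_simps)
    finally have h0: "?h 0 = 0" using det[OF k r] by simp
    have "fix_det (\<phi> ^^ r) k * ?h 1 = (1 - ?e 0 0) * ((1 - ?e 1 1) * ?h 1) - ?e 1 0 * (?e 0 1 * ?h 1)"
      unfolding d by (simp add: algebra_simps)
    also have "\<dots> = 0" unfolding e1 e0[symmetric] by (simp add: algebra_simps)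
    finally have h1: "?h 1 = 0" using det[OF k r] by simp
    have "q = 2 * k \<or> q = 2 * k + 1" by (auto simp: k_def)
    then show ?thesis using h0 h1 by auto
  qed
qed

lemma reidemeister_infinite_if_kernel_invariant:
  fixes F :: "'a \<Rightarrow> int"
  assumes \<phi>: "\<phi> \<in> iso G G" "permutes_blocks \<phi> \<sigma>"
    and det: "\<And>k r. k < m \<Longrightarrow> is_period \<sigma> k r \<Longrightarrow> fix_det (\<phi> ^^ r) k \<noteq> 0"
    and F: "\<And>x y. x \<in> deg_kernel \<Longrightarrow> y \<in> deg_kernel \<Longrightarrow> F (x \<otimes> y) = F x + F y"
      "\<And>x. x \<in> deg_kernel \<Longrightarrow> F ((\<phi> ^^ r) x) = F x"
      "x0 \<in> deg_kernel" "(\<Sum>l<r. F ((\<phi> ^^ l) x0)) \<noteq> 0"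
  shows "reidemeister_number G \<phi> = \<infinity>"
proof (rule reidemeister_infinite_if_power_invariant[OF _ normal_deg_kernel _ _ F])
  show hom: "\<phi> \<in> hom G G" using \<phi>(1) by (rule iso_imp_hom)
  show "\<phi> x \<in> deg_kernel" if "x \<in> deg_kernel" for x using hom_deg_kernel[OF hom that] .
  show "g \<in> deg_kernel" if g: "g \<in> carrier G" "g \<otimes> inv \<phi> g \<in> deg_kernel" for g
    using deg_eq_0_if_fixed[OF \<phi> det g(1)] g iso_closed[OF \<phi>(1) g(1)]
    by (simp add: deg_kernel_def)
qed

end

section \<open>Direct products of free groups of rank two\<close>

text \<open>The affine map is \<open>v \<mapsto> (x0, y0) + M v\<close>, where \<open>M\<close> has the rows \<open>(a, b)\<close> and \<open>(c, d)\<close>. If \<open>det M = 1\<close> a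
  constant will do. If \<open>det M = -1\<close>, the form \<open>v \<mapsto> det (v, M v)\<close>, centred at the rational fixed point,
  changes sign; it is not zero, since it vanishes only for scalar \<open>M\<close>, and then \<open>det M\<close> is a square.\<close>

lemma anti_invariant_quadratic:
  fixes a b c d x0 y0 s :: int
  assumes s: "s = a * d - b * c" "s = 1 \<or> s = -1" and det: "(1 - a) * (1 - d) - b * c \<noteq> 0"
  obtains g :: "int \<Rightarrow> int \<Rightarrow> int" and x1 y1
    where "\<And>x y. s * g (x0 + (x * a + y * b)) (y0 + (x * c + y * d)) = g x y" "g x1 y1 \<noteq> 0"
proof (cases "s = 1")
  case True
  then show ?thesis using that[of "\<lambda>_ _. 1"] by simp
next
  case False
  then have s': "a * d - b * c = -1" using s by simp
  define e where "e = (1 - a) * (1 - d) - b * c"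
  define w z where "w = (1 - d) * x0 + b * y0" and "z = c * x0 + (1 - a) * y0"
  \<comment> \<open>The form \<open>det (v, M v)\<close>; it gets centred at \<open>(w, z) / e\<close>, the fixed point of the affine map given
    by Cramer's rule.\<close>
  define Q where "Q u v = c * u * u + (d - a) * u * v - b * v * v" for u v :: int
  define g where "g x y = Q (e * x - w) (e * y - z)" for x y
  have Q: "Q (u * a + v * b) (u * c + v * d) = (a * d - b * c) * Q u v" for u v
    unfolding Q_def by (simp add: algebra_simps)
  have 1: "e * (x0 + (x * a + y * b)) - w = (e * x - w) * a + (e * y - z) * b" for x y
    unfolding e_def w_def z_def by (simp add: algebra_simps)
  have 2: "e * (y0 + (x * c + y * d)) - z = (e * x - w) * c + (e * y - z) * d" for x y
    unfolding e_def w_def z_def by (simp add: algebra_simps)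
  have inv: "s * g (x0 + (x * a + y * b)) (y0 + (x * c + y * d)) = g x y" for x y
    unfolding g_def 1 2 Q using s(1) s' by simp
  have "\<exists>x y. g x y \<noteq> 0"
  proof (rule ccontr)
    assume "\<not> ?thesis"
    then have z: "g x y = 0" for x y by blast
    \<comment> \<open>Second differences of \<open>g\<close> recover the coefficients of the form.\<close>
    have "2 * (e * e * c) = g 1 0 + g (-1) 0 - 2 * g 0 0"
      unfolding g_def Q_def by (simp add: algebra_simps)
    then have c0: "c = 0" using z det by (simp add: e_def)
    have "2 * (e * e * b) = - (g 0 1 + g 0 (-1) - 2 * g 0 0)"
      unfolding g_def Q_def by (simp add: algebra_simps)
    then have b0: "b = 0" using z det by (simp add: e_def)
    have "e * e * (d - a) = g 1 1 - g 1 0 - g 0 1 + g 0 0"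
      unfolding g_def Q_def by (simp add: algebra_simps)
    then have "d = a" using z det by (simp add: e_def)
    then have "a * a = -1" using s' c0 b0 by simp
    then show False using zero_le_square[of a] by simp
  qed
  then show ?thesis using inv that by blast
qed

text \<open>The direct product of \<open>m\<close> free groups, each generated by one block.\<close>

locale free_group_product = commuting_generators +
  assumes comm_iff: "p < 2 * m \<Longrightarrow> q < 2 * m \<Longrightarrow> comm p q \<longleftrightarrow> p div 2 \<noteq> q div 2"
    and m_pos: "m > 0"
begin

text \<open>The Fox derivative with respect to the generator \<open>q\<close>, computed in the factor of \<open>q\<close>.\<close>

definition fox :: "nat \<Rightarrow> 'a \<Rightarrow> ((nat \<Rightarrow>\<^sub>0 int) \<Rightarrow>\<^sub>0 int)" where
  "fox q = (SOME D. crossed (proj {q div 2}) D \<and> (\<forall>p<2 * m. D (gen p) = (if p = q then 1 else 0)))"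

lemma fox: "crossed (proj {q div 2}) (fox q) \<and> (\<forall>p<2 * m. fox q (gen p) = (if p = q then 1 else 0))"
proof -
  have "\<exists>D. (\<forall>x\<in>carrier G. \<forall>y\<in>carrier G. D (x \<otimes> y) = D x + frag_of (proj {q div 2} (deg x)) * D y)
      \<and> (\<forall>p<2 * m. D (gen p) = (if p = q then 1 else 0))"
  proof (rule crossed_exists[OF additive_proj, where d = "\<lambda>p. if p = q then 1 else 0"])
    fix p p' assume "p < 2 * m" "p' < 2 * m" "comm p p'"
    then have "p div 2 \<noteq> p' div 2" using comm_iff by simp
    then show "(1 - frag_of (proj {q div 2} (frag_of p'))) * (if p = q then 1 else 0)
        = (1 - frag_of (proj {q div 2} (frag_of p))) * (if p' = q then 1 else 0)"
      by auto
  qed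
  then have "\<exists>D. crossed (proj {q div 2}) D \<and> (\<forall>p<2 * m. D (gen p) = (if p = q then 1 else 0))"
    unfolding crossed_def using additive_proj by blast
  then show ?thesis unfolding fox_def by (rule someI_ex)
qed

lemma fox_crossed: "crossed (proj {q div 2}) (fox q)"
  using fox by blast

lemma fox_gen: "p < 2 * m \<Longrightarrow> fox q (gen p) = (if p = q then 1 else 0)"
  using fox by blast

text \<open>The fundamental formula of Fox calculus, restricted to one factor and to elements of degree 0.\<close>

lemma fox_relation:
  assumes "k < m" "x \<in> deg_kernel"
  shows "(1 - frag_of (frag_of (2 * k))) * fox (2 * k) x + (1 - frag_of (frag_of (2 * k + 1))) * fox (2 * k + 1) x = 0"
proof -
  have "(1 - frag_of (frag_of (2 * k))) * fox (2 * k) x + (1 - frag_of (frag_of (2 * k + 1))) * fox (2 * k + 1) x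
      = 1 - frag_of (proj {k} (deg x))"
  proof (rule crossed_eqI)
    show "crossed (proj {k}) (\<lambda>x. (1 - frag_of (frag_of (2 * k))) * fox (2 * k) x
        + (1 - frag_of (frag_of (2 * k + 1))) * fox (2 * k + 1) x)"
      by (rule crossed_combination) (use fox_crossed[of "2 * k"] fox_crossed[of "2 * k + 1"] in auto)
    show "crossed (proj {k}) (\<lambda>x. 1 - frag_of (proj {k} (deg x)))"
      by (rule crossed_principal[OF additive_proj])
    fix p assume "p < 2 * m"
    moreover have "p div 2 = k \<Longrightarrow> p = 2 * k \<or> p = 2 * k + 1" by auto
    ultimately show "(1 - frag_of (frag_of (2 * k))) * fox (2 * k) (gen p)
        + (1 - frag_of (frag_of (2 * k + 1))) * fox (2 * k + 1) (gen p) = 1 - frag_of (proj {k} (deg (gen p)))"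
      by (auto simp: fox_gen)
  qed (use assms in \<open>auto simp: deg_kernelD\<close>)
  then show ?thesis using assms by (simp add: deg_kernelD additive.zero[OF additive_proj])
qed

text \<open>The class of an element of \<open>N\<close> in the metabelian quotient of the \<open>k\<close>-th free factor, whose derived
  subgroup is a free module of rank one over the group ring, generated by the basic commutator. The
  name refers to loops in the square lattice: the coefficients count the enclosed unit squares with sign.\<close>

definition area :: "nat \<Rightarrow> 'a \<Rightarrow> ((nat \<Rightarrow>\<^sub>0 int) \<Rightarrow>\<^sub>0 int)" where
  "area k x = (SOME e. fox (2 * k) x = (1 - frag_of (frag_of (2 * k + 1))) * e \<and>
     fox (2 * k + 1) x = - (1 - frag_of (frag_of (2 * k))) * e)"

text \<open>Existence of \<open>area\<close>: by the fundamental formula, the two derivatives are proportional to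
  \<open>1 - b\<close> and \<open>-(1 - a)\<close>, and these are coprime.\<close>

lemma fox_area:
  assumes "k < m" "x \<in> deg_kernel"
  shows "fox (2 * k) x = (1 - frag_of (frag_of (2 * k + 1))) * area k x"
    and "fox (2 * k + 1) x = - (1 - frag_of (frag_of (2 * k))) * area k x"
proof -
  have "(1 - frag_of (frag_of (2 * k + 1))) * fox (2 * k + 1) x = (1 - frag_of (frag_of (2 * k))) * - fox (2 * k) x"
    using fox_relation[OF assms] by (simp add: eq_neg_iff_add_eq_0 add.commute)
  from proportional_to_one_minus_mon[OF _ this, of "2 * k" "2 * k + 1"]
  obtain c where c: "fox (2 * k + 1) x = (1 - frag_of (frag_of (2 * k))) * c"
    "- fox (2 * k) x = (1 - frag_of (frag_of (2 * k + 1))) * c" by auto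
  have "fox (2 * k) x = - (- fox (2 * k) x)" by (rule minus_minus[symmetric])
  also have "\<dots> = (1 - frag_of (frag_of (2 * k + 1))) * - c" unfolding c(2) by (rule mult_minus_right[symmetric])
  finally have "fox (2 * k) x = (1 - frag_of (frag_of (2 * k + 1))) * - c" .
  then have "fox (2 * k) x = (1 - frag_of (frag_of (2 * k + 1))) * (- c) \<and>
     fox (2 * k + 1) x = - (1 - frag_of (frag_of (2 * k))) * (- c)"
    by (simp only: c(1) minus_mult_minus simp_thms)
  then have "fox (2 * k) x = (1 - frag_of (frag_of (2 * k + 1))) * area k x \<and>
     fox (2 * k + 1) x = - (1 - frag_of (frag_of (2 * k))) * area k x"
    unfolding area_def by (rule someI)
  then show "fox (2 * k) x = (1 - frag_of (frag_of (2 * k + 1))) * area k x"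
    and "fox (2 * k + 1) x = - (1 - frag_of (frag_of (2 * k))) * area k x" by blast+
qed

lemma one_minus_gen_cancel:
  "(1 - frag_of (frag_of q)) * a = (1 - frag_of (frag_of q)) * b \<longleftrightarrow> a = b"
  for a b :: "(nat \<Rightarrow>\<^sub>0 int) \<Rightarrow>\<^sub>0 int"
  using one_minus_mon_eq_0_iff[of "frag_of q"] by (simp only: mult_cancel_left) auto

lemma area_eqI:
  assumes "k < m" "x \<in> deg_kernel" "fox (2 * k) x = (1 - frag_of (frag_of (2 * k + 1))) * e"
  shows "area k x = e"
  using assms(3) unfolding fox_area(1)[OF assms(1,2)] by (simp only: one_minus_gen_cancel)

lemma area_add:
  assumes "k < m" "x \<in> deg_kernel" "y \<in> deg_kernel"
  shows "area k (x \<otimes> y) = area k x + area k y"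
proof (rule area_eqI)
  show "x \<otimes> y \<in> deg_kernel" using assms by (simp add: deg_kernel_def)
  show "fox (2 * k) (x \<otimes> y) = (1 - frag_of (frag_of (2 * k + 1))) * (area k x + area k y)"
    by (simp only: crossed_kernel_add[OF fox_crossed assms(2,3)] fox_area(1)[OF assms(1,2)]
        fox_area(1)[OF assms(1,3)] distrib_left)
qed (rule assms(1))

lemma area_conj:
  assumes "k < m" "x \<in> carrier G" "y \<in> deg_kernel"
  shows "area k (x \<otimes> y \<otimes> inv x) = frag_of (proj {k} (deg x)) * area k y"
proof (rule area_eqI)
  show "fox (2 * k) (x \<otimes> y \<otimes> inv x) = (1 - frag_of (frag_of (2 * k + 1))) * (frag_of (proj {k} (deg x)) * area k y)"
    using crossed_conj[OF fox_crossed[of "2 * k"] assms(2,3)] fox_area(1)[OF assms(1,3)]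
    by (simp add: mult.left_commute)
qed (use assms conj_in_deg_kernel in auto)

definition basic :: "nat \<Rightarrow> 'a" where
  "basic k = commutator (gen (2 * k)) (gen (2 * k + 1))"

lemma basic_in_kernel: "k < m \<Longrightarrow> basic k \<in> deg_kernel"
  unfolding basic_def by (rule commutator_in_kernel) auto

lemma area_basic:
  assumes "j < m" "k < m"
  shows "area j (basic k) = (if j = k then 1 else 0)"
proof (rule area_eqI)
  have "fox (2 * j) (basic k) = (1 - frag_of (proj {j} (frag_of (2 * k + 1)))) * fox (2 * j) (gen (2 * k))
      - (1 - frag_of (proj {j} (frag_of (2 * k)))) * fox (2 * j) (gen (2 * k + 1))"
    using crossed_commutator[OF fox_crossed[of "2 * j"], of "gen (2 * k)" "gen (2 * k + 1)"] assms by (simp add: basic_def)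
  moreover have "2 * k + 1 \<noteq> 2 * j" by presburger
  ultimately show "fox (2 * j) (basic k) = (1 - frag_of (frag_of (2 * j + 1))) * (if j = k then 1 else 0)"
    using assms by (simp add: fox_gen)
qed (use assms basic_in_kernel in auto)

lemma aug_fox:
  assumes "q < 2 * m" "x \<in> carrier G"
  shows "aug (fox q x) = Poly_Mapping.lookup (deg x) q"
  using assms(2)
proof (induction x rule: gen_induct)
  case one
  then show ?case by (simp add: crossed_one[OF fox_crossed])
next
  case (gen p)
  then show ?case by (simp add: fox_gen)
next
  case (inv x)
  have "aug (frag_of (proj {q div 2} (deg x)) * fox q (inv x)) = aug (- fox q x)"
    by (simp only: crossed_inv[OF fox_crossed inv(1)])
  then show ?case using inv by (simp add: lin_mon_mult)
next
  case (mult x y)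
  then show ?case by (simp add: crossed_mult[OF fox_crossed] lin_mon_mult lookup_add)
qed

text \<open>The total enclosed area of a commutator is a determinant. It appears as the linear part of a Fox
  derivative, because the factor \<open>1 - a\<close> contributes just its derivative at the trivial character.\<close>

lemma aug_area_commutator:
  assumes "k < m" "x \<in> carrier G" "y \<in> carrier G"
  shows "aug (area k (commutator x y)) = Poly_Mapping.lookup (deg x) (2 * k) * Poly_Mapping.lookup (deg y) (2 * k + 1)
    - Poly_Mapping.lookup (deg x) (2 * k + 1) * Poly_Mapping.lookup (deg y) (2 * k)"
proof -
  let ?l = "\<lambda>h. Poly_Mapping.lookup h (2 * k) :: int"
  let ?D = "fox (2 * k + 1)"
  have "aug (area k (commutator x y)) = lin ?l (?D (commutator x y))"
    unfolding fox_area(2)[OF assms(1) commutator_in_kernel[OF assms(2,3)]]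
    by (simp add: lin_mult[OF additive_lookup])
  also have "?D (commutator x y) = (1 - frag_of (proj {k} (deg y))) * ?D x - (1 - frag_of (proj {k} (deg x))) * ?D y"
    using crossed_commutator[OF fox_crossed[of "2 * k + 1"] assms(2,3)] by simp
  also have "lin ?l \<dots> = ?l (deg x) * aug (?D y) - ?l (deg y) * aug (?D x)"
    by (simp add: lin_mult[OF additive_lookup] lookup_proj)
  finally show ?thesis using assms by (simp add: aug_fox mult.commute)
qed

text \<open>If \<open>\<theta>\<close> were nonzero on generators of two blocks, the commutation relations between blocks would make
  \<open>D\<close> proportional to the principal crossed homomorphism \<open>1 - \<theta>\<close>, which vanishes on elements of degree
  0. So \<open>\<theta>\<close> lives on one block, and then commutation with that block kills \<open>D\<close> on all others.\<close>

lemma crossed_supported_on_block: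
  assumes D: "crossed \<theta> D" and p0: "p0 < 2 * m" "\<theta> (frag_of p0) \<noteq> 0"
    and x: "x \<in> deg_kernel" "D x \<noteq> 0"
    and p: "p < 2 * m" "p div 2 \<noteq> p0 div 2"
  shows "\<theta> (frag_of p) = 0 \<and> D (gen p) = 0"
proof -
  let ?c = "\<lambda>p. 1 - frag_of (\<theta> (frag_of p))"
  have rel: "?c q * D (gen p) = ?c p * D (gen q)" if "p < 2 * m" "q < 2 * m" "p div 2 \<noteq> q div 2" for p q
    using crossed_commuting[OF D, of "gen p" "gen q"] gen_comm[of p q] that comm_iff by simp
  have nz: "?c p0 \<noteq> 0" using p0 by (simp add: one_minus_mon_eq_0_iff)
  have "\<theta> (frag_of p) = 0"
  proof (rule ccontr)
    assume "\<theta> (frag_of p) \<noteq> 0"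
    then have nz': "?c p \<noteq> 0" by (simp add: one_minus_mon_eq_0_iff)
    have "?c p0 * D x + (- D (gen p0)) * (1 - frag_of (\<theta> (deg x))) = 0"
    proof (rule crossed_eqI)
      show "crossed \<theta> (\<lambda>x. ?c p0 * D x + (- D (gen p0)) * (1 - frag_of (\<theta> (deg x))))"
        by (rule crossed_combination[OF D crossed_principal[OF crossed_additive[OF D]]])
      show "crossed \<theta> (\<lambda>_. 0)" by (rule crossed_zero[OF crossed_additive[OF D]])
      fix q assume q: "q < 2 * m"
      have "?c p0 * D (gen q) = ?c q * D (gen p0)"
      proof (cases "q div 2 = p0 div 2")
        case True
        then have 1: "?c p * D (gen q) = ?c q * D (gen p)" "?c p * D (gen p0) = ?c p0 * D (gen p)"
          using rel p p0(1) q by metis+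
        have "?c p * (?c p0 * D (gen q)) = ?c p0 * (?c q * D (gen p))"
          by (simp only: 1 mult.left_commute[of "?c p"])
        also have "\<dots> = ?c p * (?c q * D (gen p0))"
          by (simp only: 1 mult.left_commute[of "?c p"] mult.left_commute[of "?c p0"])
        finally show ?thesis using nz' by (simp only: mult_cancel_left) simp
      next
        case False
        then show ?thesis using rel[OF q p0(1)] by simp
      qed
      then show "?c p0 * D (gen q) + (- D (gen p0)) * (1 - frag_of (\<theta> (deg (gen q)))) = 0"
        using q by (simp add: mult.commute)
    qed (use x deg_kernelD in auto)
    then have "?c p0 * D x = 0"
      using x(1) by (simp add: deg_kernelD additive.zero[OF crossed_additive[OF D]])
    then show False using nz x(2) by simp
  qed
  moreover have "D (gen p) = 0"
    using rel[OF p(1) p0(1) p(2)] nz \<open>\<theta> (frag_of p) = 0\<close> by simp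
  ultimately show ?thesis ..
qed

lemma crossed_fox_comp:
  "\<phi> \<in> iso G G \<Longrightarrow> crossed (\<lambda>h. proj {q div 2} (bar \<phi> h)) (\<lambda>x. fox q (\<phi> x))"
  by (rule crossed_comp[OF fox_crossed iso_imp_hom])

lemma fox_comp_nonzero:
  assumes "\<phi> \<in> iso G G" "j < m"
  shows "\<exists>x\<in>deg_kernel. fox (2 * j + 1) (\<phi> x) \<noteq> 0"
proof -
  obtain \<psi> where \<psi>: "\<psi> \<in> iso G G" "\<And>x. x \<in> carrier G \<Longrightarrow> \<phi> (\<psi> x) = x"
    by (rule iso_inverseE[OF assms(1)]) (simp add: that)
  have "\<psi> (basic j) \<in> deg_kernel"
    using hom_deg_kernel[OF iso_imp_hom[OF \<psi>(1)] basic_in_kernel[OF assms(2)]] .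
  moreover have "fox (2 * j + 1) (\<phi> (\<psi> (basic j))) \<noteq> 0"
    using fox_area(2)[OF assms(2) basic_in_kernel[OF assms(2)]] \<psi>(2) basic_in_kernel[OF assms(2)]
    by (simp add: deg_kernelD area_basic assms(2) one_minus_mon_eq_0_iff)
  ultimately show ?thesis by blast
qed

text \<open>Pulling back a Fox derivative of factor \<open>j\<close> along \<open>\<phi>\<close> gives a crossed homomorphism that does not
  vanish on \<open>N\<close>, so only one block \<open>\<tau> j\<close> maps nontrivially to block \<open>j\<close>. Since no block maps to \<open>0\<close>,
  \<open>\<tau>\<close> is a permutation; its inverse is the permutation wanted.\<close>

lemma iso_permutes_blocks:
  assumes \<phi>: "\<phi> \<in> iso G G"
  shows "\<exists>\<sigma>. permutes_blocks \<phi> \<sigma>"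
proof -
  have "\<exists>k<m. \<forall>p<2 * m. p div 2 \<noteq> k \<longrightarrow> proj {j} (bar \<phi> (frag_of p)) = 0" if j: "j < m" for j
  proof -
    obtain x where x: "x \<in> deg_kernel" "fox (2 * j + 1) (\<phi> x) \<noteq> 0"
      using fox_comp_nonzero[OF \<phi> j] by blast
    have D: "crossed (\<lambda>h. proj {j} (bar \<phi> h)) (\<lambda>x. fox (2 * j + 1) (\<phi> x))"
      using crossed_fox_comp[OF \<phi>, of "2 * j + 1"] by simp
    obtain \<psi> where \<psi>: "\<psi> \<in> iso G G" "\<And>x. x \<in> carrier G \<Longrightarrow> \<phi> (\<psi> x) = x"
      by (rule iso_inverseE[OF \<phi>]) (simp add: that)
    have "\<exists>p<2 * m. proj {j} (bar \<phi> (frag_of p)) \<noteq> 0"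
    proof (rule ccontr)
      assume "\<not> ?thesis"
      then have "proj {j} (bar \<phi> (deg (\<psi> (gen (2 * j))))) = 0"
        using additive_eq_on_deg[OF additive_proj_bar[of "{j}" \<phi>] additive_zero_map, of "\<psi> (gen (2 * j))"]
          iso_closed[OF \<psi>(1)] j by auto
      moreover have "bar \<phi> (deg (\<psi> (gen (2 * j)))) = frag_of (2 * j)"
        using bar_deg[OF iso_imp_hom[OF \<phi>], of "\<psi> (gen (2 * j))"] iso_closed[OF \<psi>(1)] \<psi>(2) j by simp
      ultimately show False by simp
    qed
    then obtain p0 where p0: "p0 < 2 * m" "proj {j} (bar \<phi> (frag_of p0)) \<noteq> 0" by blast
    show ?thesis
      using crossed_supported_on_block[OF D p0 x] p0(1) by (intro exI[of _ "p0 div 2"]) auto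
  qed
  then obtain \<tau> where \<tau>: "\<And>j. j < m \<Longrightarrow> \<tau> j < m"
    "\<And>j p. j < m \<Longrightarrow> p < 2 * m \<Longrightarrow> p div 2 \<noteq> \<tau> j \<Longrightarrow> proj {j} (bar \<phi> (frag_of p)) = 0"
    by metis
  have supp: "q div 2 < m \<and> p div 2 = \<tau> (q div 2)" if "p < 2 * m" "entry \<phi> q p \<noteq> 0" for p q
  proof -
    have "q < 2 * m" using that lookup_deg_outside[of "\<phi> (gen p)" q] iso_closed[OF \<phi>, of "gen p"]
      by (force simp: entry_def not_less)
    then have q: "q div 2 < m" by auto
    have "Poly_Mapping.lookup (proj {q div 2} (bar \<phi> (frag_of p))) q \<noteq> 0"
      using that by (simp add: lookup_proj bar_gen entry_def)
    then show ?thesis using \<tau>(2)[OF q that(1)] q by fastforce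
  qed
  have "\<tau> ` {..<m} = {..<m}"
  proof
    show "\<tau> ` {..<m} \<subseteq> {..<m}" using \<tau>(1) by auto
    show "{..<m} \<subseteq> \<tau> ` {..<m}"
    proof
      fix k assume "k \<in> {..<m}"
      then have k: "2 * k < 2 * m" by simp
      have "deg (\<phi> (gen (2 * k))) \<noteq> 0" using deg_iso_eq_0_iff[OF \<phi>, of "gen (2 * k)"] k by simp
      then obtain q where "entry \<phi> q (2 * k) \<noteq> 0"
        unfolding entry_def by (metis lookup_zero poly_mapping_eqI)
      with supp[OF k] show "k \<in> \<tau> ` {..<m}" by force
    qed
  qed
  then have inj: "inj_on \<tau> {..<m}" by (intro eq_card_imp_inj_on) auto
  define \<sigma> where "\<sigma> x = (if x \<in> {..<m} then inv_into {..<m} \<tau> x else x)" for x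
  have "bij_betw (inv_into {..<m} \<tau>) {..<m} {..<m}"
    by (rule bij_betw_inv_into) (simp add: bij_betw_def inj \<open>\<tau> ` {..<m} = {..<m}\<close>)
  then have "bij_betw \<sigma> {..<m} {..<m}"
    by (rule iffD1[OF bij_betw_cong, rotated]) (simp add: \<sigma>_def)
  then have "\<sigma> permutes {..<m}"
    by (rule bij_imp_permutes) (simp add: \<sigma>_def)
  moreover have "q div 2 = \<sigma> (p div 2)" if "p < 2 * m" "entry \<phi> q p \<noteq> 0" for p q
    using supp[OF that] \<tau>(1) inj by (simp add: \<sigma>_def)
  ultimately show ?thesis unfolding permutes_blocks_def by blast
qed

text \<open>A crossed homomorphism that lives on one free factor is the combination of the two Fox derivatives
  with its values at the generators as coefficients. On \<open>N\<close> this becomes a multiple of \<open>area\<close>.\<close>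

lemma area_iso:
  assumes \<phi>: "\<phi> \<in> iso G G" "permutes_blocks \<phi> \<sigma>" and k: "k < m" and x: "x \<in> deg_kernel"
  shows "area (\<sigma> k) (\<phi> x) = area (\<sigma> k) (\<phi> (basic k)) * push (\<lambda>h. proj {\<sigma> k} (bar \<phi> h)) (area k x)"
proof -
  define j where "j = \<sigma> k"
  let ?\<theta> = "\<lambda>h. proj {j} (bar \<phi> h)" and ?D = "\<lambda>x. fox (2 * j + 1) (\<phi> x)"
  let ?a = "gen (2 * k)" and ?b = "gen (2 * k + 1)"
  have \<sigma>: "\<sigma> permutes {..<m}" using \<phi>(2) by (simp add: permutes_blocks_def)
  have j: "j < m" using permutes_in_image[OF \<sigma>, of k] k by (simp add: j_def)
  have D: "crossed ?\<theta> ?D" using crossed_fox_comp[OF \<phi>(1), of "2 * j + 1"] by simp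
  have add: "additive ?\<theta>" by (rule additive_proj_bar)
  have out: "?\<theta> (frag_of p) = 0" if "p < 2 * m" "p div 2 \<noteq> k" for p
  proof (rule poly_mapping_eqI)
    fix q
    have "\<sigma> (p div 2) \<noteq> j" using that(2) permutes_inj[OF \<sigma>] by (auto simp: j_def inj_eq)
    then have "entry \<phi> q p = 0" if "q div 2 = j"
      using \<phi>(2) that \<open>p < 2 * m\<close> unfolding permutes_blocks_def by metis
    then show "Poly_Mapping.lookup (?\<theta> (frag_of p)) q = Poly_Mapping.lookup 0 q"
      using that(1) by (simp add: lookup_proj bar_gen entry_def)
  qed
  have "?\<theta> (frag_of (2 * k)) \<noteq> 0"
  proof
    assume 0: "?\<theta> (frag_of (2 * k)) = 0"
    have "deg (\<phi> ?a) = 0"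
    proof (rule poly_mapping_eqI)
      fix q
      have "Poly_Mapping.lookup (?\<theta> (frag_of (2 * k))) q = 0" by (simp add: 0)
      then have in_j: "q div 2 = j \<Longrightarrow> entry \<phi> q (2 * k) = 0"
        using k by (simp add: lookup_proj bar_gen entry_def)
      have "entry \<phi> q (2 * k) \<noteq> 0 \<Longrightarrow> q div 2 = \<sigma> ((2 * k) div 2)"
        using \<phi>(2) k unfolding permutes_blocks_def by (metis mult_less_cancel1 zero_less_numeral)
      with in_j show "Poly_Mapping.lookup (deg (\<phi> ?a)) q = Poly_Mapping.lookup 0 q"
        by (auto simp: j_def entry_def)
    qed
    then show False using deg_iso_eq_0_iff[OF \<phi>(1), of ?a] k by simp
  qed
  moreover obtain x' where "x' \<in> deg_kernel" "?D x' \<noteq> 0" using fox_comp_nonzero[OF \<phi>(1) j] by blast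
  ultimately have D_out: "?D (gen p) = 0" if "p < 2 * m" "p div 2 \<noteq> k" for p
    using crossed_supported_on_block[OF D, of "2 * k"] k that by simp
  have expand: "?D y = ?D ?a * push ?\<theta> (fox (2 * k) y) + ?D ?b * push ?\<theta> (fox (2 * k + 1) y)"
    if y: "y \<in> carrier G" for y
  proof (rule crossed_eqI[OF D _ _ _ y])
    show "crossed (\<lambda>h. ?\<theta> (proj {k} h)) (\<lambda>y. ?D ?a * push ?\<theta> (fox (2 * k) y) + ?D ?b * push ?\<theta> (fox (2 * k + 1) y))"
      by (rule crossed_combination; rule crossed_push[OF _ add])
        (use fox_crossed[of "2 * k"] fox_crossed[of "2 * k + 1"] in auto)
    fix p assume p: "p < 2 * m"
    show "?\<theta> (frag_of p) = ?\<theta> (proj {k} (frag_of p))"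
      using out[OF p] by (simp add: additive.zero[OF add])
    have "push ?\<theta> 1 = 1" by (rule push_one) (rule additive.zero[OF add])
    moreover have "p div 2 = k \<Longrightarrow> p = 2 * k \<or> p = 2 * k + 1" by auto
    ultimately show "?D (gen p) = ?D ?a * push ?\<theta> (fox (2 * k) (gen p)) + ?D ?b * push ?\<theta> (fox (2 * k + 1) (gen p))"
      using p D_out[OF p] by (auto simp: fox_gen)
  qed
  have push1: "push ?\<theta> (1 - frag_of h) = 1 - frag_of (?\<theta> h)" for h
    using push_one[of ?\<theta>] additive.zero[OF add] by simp
  have Dcomm: "?D (basic k) = (1 - frag_of (?\<theta> (frag_of (2 * k + 1)))) * ?D ?a - (1 - frag_of (?\<theta> (frag_of (2 * k)))) * ?D ?b"
    using crossed_commutator[OF D, of ?a ?b] k by (simp add: basic_def)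
  have "?D x = ?D (basic k) * push ?\<theta> (area k x)"
    unfolding expand[OF deg_kernelD(1)[OF x]] fox_area[OF k x] Dcomm
    by (simp add: push_mult[OF add] push_one additive.zero[OF add] algebra_simps)
  moreover have "?D y = (1 - frag_of (frag_of (2 * j))) * - area j (\<phi> y)" if "y \<in> deg_kernel" for y
    using fox_area(2)[OF j hom_deg_kernel[OF iso_imp_hom[OF \<phi>(1)] that]] by (simp only: mult_minus_left mult_minus_right)
  ultimately have "(1 - frag_of (frag_of (2 * j))) * - area j (\<phi> x)
      = (1 - frag_of (frag_of (2 * j))) * (- area j (\<phi> (basic k)) * push ?\<theta> (area k x))"
    using x basic_in_kernel[OF k] by (simp add: mult.assoc)
  then have "- area j (\<phi> x) = - area j (\<phi> (basic k)) * push ?\<theta> (area k x)"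
    by (simp only: one_minus_gen_cancel)
  then show ?thesis by (simp add: j_def)
qed

text \<open>Applying \<open>area_iso\<close> to the preimage of the basic commutator, whose area is \<open>1\<close>, shows that the factor is
  a unit. Its sign is the determinant of the block, by \<open>aug_area_commutator\<close>.\<close>

lemma area_iso_fixed_block:
  assumes \<phi>: "\<phi> \<in> iso G G" "permutes_blocks \<phi> \<sigma>" and k: "k < m" "\<sigma> k = k"
  defines "s \<equiv> entry \<phi> (2 * k) (2 * k) * entry \<phi> (2 * k + 1) (2 * k + 1)
    - entry \<phi> (2 * k) (2 * k + 1) * entry \<phi> (2 * k + 1) (2 * k)"
  obtains h where "s = 1 \<or> s = -1"
    "\<And>x. x \<in> deg_kernel \<Longrightarrow> area k (\<phi> x) = Poly_Mapping.single h s * push (\<lambda>h. proj {k} (bar \<phi> h)) (area k x)"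
proof -
  obtain \<psi> where \<psi>: "\<psi> \<in> iso G G" "\<And>x. x \<in> carrier G \<Longrightarrow> \<phi> (\<psi> x) = x"
    by (rule iso_inverseE[OF \<phi>(1)]) (simp add: that)
  have b: "\<psi> (basic k) \<in> deg_kernel"
    using hom_deg_kernel[OF iso_imp_hom[OF \<psi>(1)] basic_in_kernel[OF k(1)]] .
  have "area k (\<phi> (basic k)) * push (\<lambda>h. proj {k} (bar \<phi> h)) (area k (\<psi> (basic k))) = 1"
    using area_iso[OF \<phi> k(1) b] \<psi>(2) deg_kernelD(1)[OF basic_in_kernel[OF k(1)]]
    by (simp add: k area_basic)
  then obtain h t where t: "area k (\<phi> (basic k)) = Poly_Mapping.single h t" "t = 1 \<or> t = -1"
    by (rule group_ring_unit)
  have "t = aug (area k (\<phi> (basic k)))" by (simp add: t(1))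
  also have "\<dots> = s"
    using aug_area_commutator[OF k(1), of "\<phi> (gen (2 * k))" "\<phi> (gen (2 * k + 1))"] k(1)
    by (simp add: basic_def hom_commutator iso_imp_hom \<phi>(1) iso_closed s_def entry_def mult.commute)
  finally have "t = s" .
  then show ?thesis using that[of h] t area_iso[OF \<phi> k(1)] by (simp add: k)
qed

theorem reidemeister_infinite:
  assumes \<phi>: "\<phi> \<in> iso G G"
  shows "reidemeister_number G \<phi> = \<infinity>"
proof -
  obtain \<sigma> where pb: "permutes_blocks \<phi> \<sigma>" using iso_permutes_blocks[OF \<phi>] by blast
  have \<sigma>: "\<sigma> permutes {..<m}" using pb by (simp add: permutes_blocks_def)
  show ?thesis
  proof (cases "\<exists>k r. k < m \<and> is_period \<sigma> k r \<and> fix_det (\<phi> ^^ r) k = 0")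
    case True
    then show ?thesis using reidemeister_infinite_if_fix_det_eq_0[OF \<phi> pb] by blast
  next
    case False
    then have det: "\<And>k r. k < m \<Longrightarrow> is_period \<sigma> k r \<Longrightarrow> fix_det (\<phi> ^^ r) k \<noteq> 0" by blast
    define k :: nat where "k = 0"
    have k: "k < m" using m_pos by (simp add: k_def)
    obtain r where r: "is_period \<sigma> k r" using period_exists[OF \<sigma>] by blast
    let ?\<psi> = "\<phi> ^^ r"
    have \<psi>: "?\<psi> \<in> iso G G" "permutes_blocks ?\<psi> (\<sigma> ^^ r)" "(\<sigma> ^^ r) k = k"
      using iso_funpow[OF \<phi>] permutes_blocks_funpow[OF \<phi> pb] r by (auto simp: is_period_def)
    let ?e = "\<lambda>c d. entry ?\<psi> (2 * k + c) (2 * k + d)"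
    obtain h s where s: "s = ?e 0 0 * ?e 1 1 - ?e 0 1 * ?e 1 0" "s = 1 \<or> s = -1"
      and area_\<psi>: "\<And>x. x \<in> deg_kernel \<Longrightarrow>
        area k (?\<psi> x) = Poly_Mapping.single h s * push (\<lambda>h. proj {k} (bar ?\<psi> h)) (area k x)"
      using area_iso_fixed_block[OF \<psi>(1,2) k \<psi>(3)] by (metis add_0_right)
    have "(1 - ?e 0 0) * (1 - ?e 1 1) - ?e 0 1 * ?e 1 0 \<noteq> 0"
      using det[OF k r] by (simp add: fix_det_def)
    then obtain g x1 y1 where g: "\<And>x y. s * g (Poly_Mapping.lookup h (2 * k) + (x * ?e 0 0 + y * ?e 0 1))
        (Poly_Mapping.lookup h (2 * k + 1) + (x * ?e 1 0 + y * ?e 1 1)) = g x y" "g x1 y1 \<noteq> 0"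
      using anti_invariant_quadratic[OF s] by metis
    define f where "f h = g (Poly_Mapping.lookup h (2 * k)) (Poly_Mapping.lookup h (2 * k + 1))" for h
    have f: "s * f (h + proj {k} (bar ?\<psi> i)) = f i" for i
    proof -
      have "Poly_Mapping.lookup (bar ?\<psi> i) (2 * k + c)
          = Poly_Mapping.lookup i (2 * k) * ?e c 0 + Poly_Mapping.lookup i (2 * k + 1) * ?e c 1" if "c < 2" for c
        using lookup_bar_block[OF \<psi>(2) k, of "2 * k + c" i] that by (simp add: \<psi>(3))
      from this[of 0] this[of 1] show ?thesis
        using g(1)[of "Poly_Mapping.lookup i (2 * k)" "Poly_Mapping.lookup i (2 * k + 1)"]
        by (simp add: f_def lookup_add lookup_proj)
    qed
    obtain y where y: "y \<in> carrier G" "Poly_Mapping.lookup (deg y) (2 * k) = x1" "Poly_Mapping.lookup (deg y) (2 * k + 1) = y1"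
      using ex_with_deg[of "\<lambda>q. if q = 2 * k then x1 else y1"] k by auto
    define x0 where "x0 = y \<otimes> basic k \<otimes> inv y"
    have x0: "x0 \<in> deg_kernel" using conj_in_deg_kernel[OF y(1) basic_in_kernel[OF k]] by (simp add: x0_def)
    have area_x0: "area j x0 = (if j = k then frag_of (proj {k} (deg y)) else 0)" if "j < m" for j
      using area_conj[OF that y(1) basic_in_kernel[OF k]] area_basic[OF that k] by (auto simp: x0_def)
    show ?thesis
    proof (rule reidemeister_infinite_if_kernel_invariant[OF \<phi> pb det, where F = "\<lambda>x. lin f (area k x)" and r = r and ?x0.0 = x0])
      show "lin f (area k (x \<otimes> y)) = lin f (area k x) + lin f (area k y)"
        if "x \<in> deg_kernel" "y \<in> deg_kernel" for x y using area_add[OF k that] by simp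
      show "lin f (area k (?\<psi> x)) = lin f (area k x)" if x: "x \<in> deg_kernel" for x
      proof -
        have sgn: "lin f (Poly_Mapping.single h s * z) = s * lin (\<lambda>i. f (h + i)) z" for z
          using s(2) by (auto simp: lin_mon_mult single_uminus)
        have "lin f (area k (?\<psi> x)) = s * lin (\<lambda>i. f (h + proj {k} (bar ?\<psi> i))) (area k x)"
          by (simp add: area_\<psi>[OF x] sgn lin_push)
        also have "\<dots> = lin (\<lambda>i. s * f (h + proj {k} (bar ?\<psi> i))) (area k x)"
          using s(2) by (auto simp: lin_uminus)
        finally show ?thesis by (simp add: f)
      qed
      have "lin f (area k ((\<phi> ^^ l) x0)) = 0" if l: "0 < l" "l < r" for l
      proof -
        have p: "(\<sigma> ^^ l) permutes {..<m}"
          using permutes_blocks_funpow[OF \<phi> pb, of l] by (simp add: permutes_blocks_def)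
        define j where "j = inv_into UNIV (\<sigma> ^^ l) k"
        have j: "j < m" "(\<sigma> ^^ l) j = k"
          using k permutes_in_image[OF permutes_inv[OF p], of k] by (simp_all add: j_def permutes_inverses[OF p])
        then have "j \<noteq> k" using r l unfolding is_period_def by metis
        then show ?thesis
          using area_iso[OF iso_funpow[OF \<phi>] permutes_blocks_funpow[OF \<phi> pb] j(1) x0, of l] j
          by (simp add: area_x0)
      qed
      then have "(\<Sum>l<r. lin f (area k ((\<phi> ^^ l) x0))) = (\<Sum>l\<in>{0}. lin f (area k ((\<phi> ^^ l) x0)))"
        using r by (intro sum.mono_neutral_right) (auto simp: is_period_def)
      also have "\<dots> = g x1 y1"
        using y k by (simp add: area_x0 f_def lookup_proj)
      finally show "(\<Sum>l<r. lin f (area k ((\<phi> ^^ l) x0))) \<noteq> 0" using g(2) by simp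
    qed (use x0 in auto)
  qed
qed

end

section \<open>Free products of free abelian groups of rank two\<close>

text \<open>Multiply by the adjugate matrix.\<close>

lemma dvd_of_unimodular:
  fixes a b c d u v P :: int
  assumes det: "a * d - b * c = 1 \<or> a * d - b * c = -1"
    and "P dvd u * a + v * b" "P dvd u * c + v * d"
  shows "P dvd u \<and> P dvd v"
proof -
  have "P dvd d * (u * a + v * b) - b * (u * c + v * d)"
    "P dvd a * (u * c + v * d) - c * (u * a + v * b)"
    using assms(2,3) by (auto intro: dvd_diff dvd_mult)
  moreover have "d * (u * a + v * b) - b * (u * c + v * d) = (a * d - b * c) * u"
    "a * (u * c + v * d) - c * (u * a + v * b) = (a * d - b * c) * v"
    by (simp_all add: algebra_simps)
  ultimately have "P dvd (a * d - b * c) * u" "P dvd (a * d - b * c) * v" by simp_all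
  then show ?thesis using det by auto
qed

text \<open>The condition \<open>e v \<equiv> (w, z)\<close> modulo \<open>P\<close>, where \<open>(w, z) / e\<close> is the fixed point of the affine map. As
  \<open>e\<close> is invertible modulo \<open>P\<close>, it describes a single coset of the lattice of multiples of \<open>P\<close>.\<close>

lemma invariant_coset:
  fixes a b c d x0 y0 P :: int
  assumes det: "a * d - b * c = 1 \<or> a * d - b * c = -1"
    and cop: "coprime P ((1 - a) * (1 - d) - b * c)"
  obtains A :: "int \<Rightarrow> int \<Rightarrow> bool"
  where "\<And>x y. A (x0 + (x * a + y * b)) (y0 + (x * c + y * d)) \<longleftrightarrow> A x y"
    "\<And>x y x' y'. A x y \<Longrightarrow> A x' y' \<Longrightarrow> P dvd x' - x \<and> P dvd y' - y"
    "\<And>x y u v. A x y \<Longrightarrow> A (x + P * u) (y + P * v)"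
    "\<exists>x y. A x y"
proof -
  define e where "e = (1 - a) * (1 - d) - b * c"
  define w z where "w = (1 - d) * x0 + b * y0" and "z = c * x0 + (1 - a) * y0"
  define A where "A x y \<longleftrightarrow> P dvd e * x - w \<and> P dvd e * y - z" for x y
  have 1: "e * (x0 + (x * a + y * b)) - w = (e * x - w) * a + (e * y - z) * b" for x y
    unfolding e_def w_def z_def by (simp add: algebra_simps)
  have 2: "e * (y0 + (x * c + y * d)) - z = (e * x - w) * c + (e * y - z) * d" for x y
    unfolding e_def w_def z_def by (simp add: algebra_simps)
  have inv: "A (x0 + (x * a + y * b)) (y0 + (x * c + y * d)) \<longleftrightarrow> A x y" for x y
    unfolding A_def 1 2 using dvd_of_unimodular[OF det, of P "e * x - w" "e * y - z"]
    by (auto intro: dvd_add)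
  have sep1: "P dvd x' - x" if "P dvd e * x - t" "P dvd e * x' - t" for x x' t
  proof -
    have "P dvd (e * x' - t) - (e * x - t)" using that(2,1) by (rule dvd_diff)
    then have "P dvd e * (x' - x)" by (simp add: algebra_simps)
    then show ?thesis using cop by (simp add: e_def coprime_dvd_mult_right_iff)
  qed
  have sep: "P dvd x' - x \<and> P dvd y' - y" if "A x y" "A x' y'" for x y x' y'
    using that sep1 unfolding A_def by blast
  have step1: "P dvd e * (x + P * u) - t" if "P dvd e * x - t" for x u t
  proof -
    have eq: "e * (x + P * u) - t = (e * x - t) + P * (e * u)" by (simp add: algebra_simps)
    show ?thesis unfolding eq using that by (intro dvd_add dvd_triv_left)
  qed
  obtain g s where gs: "g * e + s * P = gcd e P" using bezout_int by blast
  have "gcd e P = 1" using cop by (simp add: e_def coprime_iff_gcd_eq_1 gcd.commute)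
  then have "e * g - 1 = P * - s" using gs by (simp add: algebra_simps)
  then have g: "P dvd e * g - 1" by (rule dvdI)
  have ex1: "P dvd e * (g * t) - t" for t
  proof -
    have "e * (g * t) - t = (e * g - 1) * t" by (simp add: algebra_simps)
    then show ?thesis using g by simp
  qed
  have "A (g * w) (g * z)" by (simp add: A_def ex1)
  then show ?thesis
    using inv sep step1 that[of A] unfolding A_def by blast
qed

text \<open>Inside one coset modulo \<open>Q\<close>, the three points that differ by \<open>0, Q, 2 Q\<close> in the second coordinate are
  incongruent modulo \<open>P > 2 Q\<close>, so each of the two conditions to be avoided excludes at most one.\<close>

lemma avoiding_point:
  fixes P Q :: int
  assumes B: "\<And>x y u v. B x y \<Longrightarrow> B (x + Q * u) (y + Q * v)" "\<exists>x y. B x y"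
    and A: "\<And>x y x' y'. A x y \<Longrightarrow> A x' y' \<Longrightarrow> P dvd x' - x \<and> P dvd y' - y"
    and PQ: "0 < Q" "2 * Q < P"
  obtains x y where "B x y" "\<not> A x y" "\<not> A (x + 1) y"
proof -
  obtain x y where xy: "B x y" using B(2) by blast
  have Bt: "B x (y + Q * t)" for t using B(1)[OF xy, of 0 t] by simp
  have uniq: "s = t" if st: "s \<in> {0, 1, 2}" "t \<in> {0, 1, 2}" and A': "A x' (y + Q * s)" "A x' (y + Q * t)" for s t x'
  proof (rule ccontr)
    assume "s \<noteq> t"
    have "P dvd (y + Q * t) - (y + Q * s)" using A[OF A'] by blast
    then have "P dvd Q * (t - s)" by (simp add: algebra_simps)
    moreover have "Q * (t - s) \<noteq> 0" using PQ \<open>s \<noteq> t\<close> by simp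
    ultimately have "P \<le> \<bar>Q * (t - s)\<bar>" using PQ zdvd_imp_le[of P "\<bar>Q * (t - s)\<bar>"] by simp
    also have "\<dots> \<le> Q * 2" unfolding abs_mult using st PQ by (intro mult_mono) auto
    finally show False using PQ by simp
  qed
  have "\<exists>t\<in>{0, 1, 2}. \<not> A x (y + Q * t) \<and> \<not> A (x + 1) (y + Q * t)"
  proof (rule ccontr)
    assume "\<not> ?thesis"
    then have "A x (y + Q * t) \<or> A (x + 1) (y + Q * t)" if "t \<in> {0, 1, 2}" for t using that by blast
    from this[of 0] this[of 1] this[of 2] show False
      using uniq[of 0 1] uniq[of 0 2] uniq[of 1 2] by auto
  qed
  then show ?thesis using that Bt by blast
qed

text \<open>The free product of \<open>m\<close> free abelian groups, each generated by one block.\<close>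

locale plane_free_product = commuting_generators +
  assumes comm_iff: "p < 2 * m \<Longrightarrow> q < 2 * m \<Longrightarrow> comm p q \<longleftrightarrow> p div 2 = q div 2"
    and m_ge_2: "m \<ge> 2"
begin

lemma proj_UNIV [simp]: "proj UNIV h = h"
  by (rule poly_mapping_eqI) (simp add: lookup_proj)

text \<open>The crossed homomorphism that is principal on plane \<open>j\<close> and zero on the other planes, after killing
  the blocks outside \<open>S\<close>. Two choices of \<open>S\<close> matter: all blocks, where nothing is killed, and \<open>{i, j}\<close>.\<close>

definition slope :: "nat set \<Rightarrow> nat \<Rightarrow> 'a \<Rightarrow> ((nat \<Rightarrow>\<^sub>0 int) \<Rightarrow>\<^sub>0 int)" where
  "slope S j = (SOME D. crossed (proj S) D \<and>
     (\<forall>p<2 * m. D (gen p) = (if p div 2 = j then 1 - frag_of (proj S (frag_of p)) else 0)))"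

lemma slope: "crossed (proj S) (slope S j) \<and>
  (\<forall>p<2 * m. slope S j (gen p) = (if p div 2 = j then 1 - frag_of (proj S (frag_of p)) else 0))"
proof -
  have "\<exists>D. (\<forall>x\<in>carrier G. \<forall>y\<in>carrier G. D (x \<otimes> y) = D x + frag_of (proj S (deg x)) * D y)
      \<and> (\<forall>p<2 * m. D (gen p) = (if p div 2 = j then 1 - frag_of (proj S (frag_of p)) else 0))"
  proof (rule crossed_exists[OF additive_proj, where d = "\<lambda>p. if p div 2 = j then 1 - frag_of (proj S (frag_of p)) else 0"])
    fix p p' assume "p < 2 * m" "p' < 2 * m" "comm p p'"
    then have "p div 2 = p' div 2" using comm_iff by simp
    then show "(1 - frag_of (proj S (frag_of p'))) * (if p div 2 = j then 1 - frag_of (proj S (frag_of p)) else 0)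
        = (1 - frag_of (proj S (frag_of p))) * (if p' div 2 = j then 1 - frag_of (proj S (frag_of p')) else 0)"
      by (simp add: mult.commute)
  qed
  then have "\<exists>D. crossed (proj S) D \<and>
      (\<forall>p<2 * m. D (gen p) = (if p div 2 = j then 1 - frag_of (proj S (frag_of p)) else 0))"
    unfolding crossed_def using additive_proj by blast
  then show ?thesis unfolding slope_def by (rule someI_ex)
qed

lemma slope_crossed: "crossed (proj S) (slope S j)"
  using slope by blast

lemma slope_gen: "p < 2 * m \<Longrightarrow> slope S j (gen p) = (if p div 2 = j then 1 - frag_of (proj S (frag_of p)) else 0)"
  using slope by blast

lemma slope_eq_push:
  assumes "x \<in> carrier G"
  shows "slope S j x = push (proj S) (slope UNIV j x)"
proof (rule crossed_eqI[OF slope_crossed _ _ _ assms])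
  show "crossed (\<lambda>h. proj S (proj UNIV h)) (\<lambda>x. push (proj S) (slope UNIV j x))"
    by (rule crossed_push[OF slope_crossed additive_proj])
  fix p assume "p < 2 * m"
  then show "slope S j (gen p) = push (proj S) (slope UNIV j (gen p))"
    by (simp add: slope_gen push_one additive.zero[OF additive_proj])
qed simp

lemma aug_slope: "x \<in> carrier G \<Longrightarrow> aug (slope UNIV j x) = 0"
proof (induction x rule: gen_induct)
  case one
  then show ?case by (simp add: crossed_one[OF slope_crossed])
next
  case (gen p)
  then show ?case by (simp add: slope_gen)
next
  case (inv x)
  have "aug (frag_of (proj UNIV (deg x)) * slope UNIV j (inv x)) = aug (- slope UNIV j x)"
    by (simp only: crossed_inv[OF slope_crossed inv(1)])
  then show ?case using inv by (simp add: lin_mon_mult)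
next
  case (mult x y)
  then show ?case by (simp add: crossed_mult[OF slope_crossed] lin_mon_mult)
qed

lemma linear_part_slope:
  assumes "x \<in> carrier G"
  shows "lin (\<lambda>h. Poly_Mapping.lookup h q) (slope UNIV j x)
    = - (if q div 2 = j then Poly_Mapping.lookup (deg x) q else 0)"
  using assms
proof (induction x rule: gen_induct)
  case one
  then show ?case by (simp add: crossed_one[OF slope_crossed])
next
  case (gen p)
  then show ?case by (auto simp: slope_gen)
next
  case (inv x)
  have "lin (\<lambda>h. Poly_Mapping.lookup h q) (frag_of (proj UNIV (deg x)) * slope UNIV j (inv x))
      = lin (\<lambda>h. Poly_Mapping.lookup h q) (- slope UNIV j x)"
    by (simp only: crossed_inv[OF slope_crossed inv(1)])
  then show ?case using inv by (simp add: lin_mult[OF additive_lookup] aug_slope split: if_splits)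
next
  case (mult x y)
  then show ?case
    by (simp add: crossed_mult[OF slope_crossed] lin_mult[OF additive_lookup] aug_slope lookup_add split: if_splits)
qed

text \<open>A dependency between the images of two generators would be carried back by the inverse.\<close>

lemma image_of_block_independent:
  assumes \<phi>: "\<phi> \<in> iso G G" and i: "i < m"
  shows "\<exists>p q. entry \<phi> p (2 * i) * entry \<phi> q (2 * i + 1) \<noteq> entry \<phi> q (2 * i) * entry \<phi> p (2 * i + 1)"
proof (rule ccontr)
  assume dep: "\<not> ?thesis"
  let ?x = "gen (2 * i)" and ?y = "gen (2 * i + 1)"
  obtain \<psi> where \<psi>: "\<psi> \<in> iso G G" "\<And>x. x \<in> carrier G \<Longrightarrow> \<psi> (\<phi> x) = x"
    by (rule iso_inverseE[OF \<phi>]) (simp add: that)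
  have bar_back: "bar \<psi> (deg (\<phi> g)) = deg g" if "g \<in> carrier G" for g
    using bar_deg[OF iso_imp_hom[OF \<psi>(1)] iso_closed[OF \<phi> that]] \<psi>(2)[OF that] by simp
  have "deg (\<phi> ?x) \<noteq> 0" using deg_iso_eq_0_iff[OF \<phi>, of ?x] i by simp
  then obtain p where p: "entry \<phi> p (2 * i) \<noteq> 0"
    unfolding entry_def by (metis lookup_zero poly_mapping_eqI)
  have "frag_cmul (entry \<phi> p (2 * i + 1)) (deg (\<phi> ?x)) - frag_cmul (entry \<phi> p (2 * i)) (deg (\<phi> ?y)) = 0"
    using dep by (intro poly_mapping_eqI) (simp add: lookup_minus mult.commute flip: entry_def)
  then have "bar \<psi> (frag_cmul (entry \<phi> p (2 * i + 1)) (deg (\<phi> ?x)) - frag_cmul (entry \<phi> p (2 * i)) (deg (\<phi> ?y))) = 0"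
    by (simp add: additive.zero[OF additive_bar])
  then have "frag_cmul (entry \<phi> p (2 * i + 1)) (bar \<psi> (deg (\<phi> ?x))) - frag_cmul (entry \<phi> p (2 * i)) (bar \<psi> (deg (\<phi> ?y))) = 0"
    by (simp only: additive.diff[OF additive_bar]) (simp only: bar_def frag_extend_cmul)
  then have "Poly_Mapping.lookup (frag_cmul (entry \<phi> p (2 * i + 1)) (frag_of (2 * i)) - frag_cmul (entry \<phi> p (2 * i)) (frag_of (2 * i + 1))) (2 * i + 1) = 0"
    using i by (simp add: bar_back)
  then show False using p by (simp add: lookup_minus)
qed

text \<open>The images of the two generators of plane \<open>i\<close> commute, and their degrees are independent. Hence every
  \<open>slope UNIV j\<close> is a multiple \<open>c j\<close> of the principal crossed homomorphism on that image. Comparing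
  linear parts, the \<open>j\<close>-th component of each degree \<open>\<alpha>\<close> in the image equals \<open>aug (c j)\<close> times \<open>\<alpha>\<close>.
  A nonzero component can therefore occur for one \<open>j\<close> only, and there the augmentation is \<open>1\<close>.\<close>

lemma image_of_block:
  assumes \<phi>: "\<phi> \<in> iso G G" and i: "i < m"
  obtains k where "k < m" "\<And>p q. p div 2 = i \<Longrightarrow> entry \<phi> q p \<noteq> 0 \<Longrightarrow> q div 2 = k"
    "\<And>j. \<exists>c. aug c = (if j = k then 1 else 0) \<and>
      (\<forall>p. p div 2 = i \<longrightarrow> slope UNIV j (\<phi> (gen p)) = (1 - frag_of (deg (\<phi> (gen p)))) * c)"
proof -
  let ?x = "gen (2 * i)" and ?y = "gen (2 * i + 1)"
  have xy: "\<phi> ?x \<in> carrier G" "\<phi> ?y \<in> carrier G" using iso_closed[OF \<phi>] i by simp_all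
  have "?x \<otimes> ?y = ?y \<otimes> ?x" using gen_comm[of "2 * i" "2 * i + 1"] comm_iff i by simp
  then have commute: "\<phi> ?x \<otimes> \<phi> ?y = \<phi> ?y \<otimes> \<phi> ?x"
    using hom_mult[OF iso_imp_hom[OF \<phi>], of ?x ?y] hom_mult[OF iso_imp_hom[OF \<phi>], of ?y ?x] i by simp
  have two: "p = 2 * i \<or> p = 2 * i + 1" if "p div 2 = i" for p using that by auto
  obtain a b where indep: "entry \<phi> a (2 * i) * entry \<phi> b (2 * i + 1) \<noteq> entry \<phi> b (2 * i) * entry \<phi> a (2 * i + 1)"
    using image_of_block_independent[OF \<phi> i] by blast
  have "\<exists>c. slope UNIV j (\<phi> ?x) = (1 - frag_of (deg (\<phi> ?x))) * c \<and> slope UNIV j (\<phi> ?y) = (1 - frag_of (deg (\<phi> ?y))) * c" for j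
    using proportional_to_one_minus_mon[OF indep[unfolded entry_def]]
      crossed_commuting[OF slope_crossed[of UNIV j] xy commute] by simp
  then obtain c where c: "slope UNIV j (\<phi> ?x) = (1 - frag_of (deg (\<phi> ?x))) * c j"
    "slope UNIV j (\<phi> ?y) = (1 - frag_of (deg (\<phi> ?y))) * c j" for j by metis
  have lin_c: "(if q div 2 = j then entry \<phi> q p else 0) = entry \<phi> q p * aug (c j)" if "p div 2 = i" for p q j
  proof -
    have "p < 2 * m" using that i by auto
    then have g: "\<phi> (gen p) \<in> carrier G" using iso_closed[OF \<phi>] by simp
    have "lin (\<lambda>h. Poly_Mapping.lookup h q) (slope UNIV j (\<phi> (gen p)))
        = lin (\<lambda>h. Poly_Mapping.lookup h q) ((1 - frag_of (deg (\<phi> (gen p)))) * c j)"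
      using two[OF that] c by auto
    then show ?thesis
      by (simp add: linear_part_slope[OF g] lin_mult[OF additive_lookup] entry_def split: if_splits)
  qed
  have "deg (\<phi> ?x) \<noteq> 0" using deg_iso_eq_0_iff[OF \<phi>, of ?x] i by simp
  then obtain q0 where q0: "entry \<phi> q0 (2 * i) \<noteq> 0"
    unfolding entry_def by (metis lookup_zero poly_mapping_eqI)
  define k where "k = q0 div 2"
  have "q0 < 2 * m" using q0 lookup_deg_outside[OF xy(1), of q0] by (force simp: entry_def not_less)
  then have "k < m" by (auto simp: k_def)
  have aug_c: "aug (c j) = (if j = k then 1 else 0)" for j
    using lin_c[of "2 * i" q0 j] q0 by (auto simp: k_def split: if_splits)
  have "q div 2 = k" if "p div 2 = i" "entry \<phi> q p \<noteq> 0" for p q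
    using lin_c[OF that(1), of q k] that(2) by (auto simp: aug_c split: if_splits)
  moreover have "\<exists>c. aug c = (if j = k then 1 else 0) \<and>
      (\<forall>p. p div 2 = i \<longrightarrow> slope UNIV j (\<phi> (gen p)) = (1 - frag_of (deg (\<phi> (gen p)))) * c)" for j
  proof (intro exI[of _ "c j"] conjI allI impI)
    show "aug (c j) = (if j = k then 1 else 0)" by (rule aug_c)
    show "slope UNIV j (\<phi> (gen p)) = (1 - frag_of (deg (\<phi> (gen p)))) * c j" if "p div 2 = i" for p
      using two[OF that] c[of j] by (elim disjE) simp_all
  qed
  ultimately show ?thesis using that \<open>k < m\<close> by blast
qed

text \<open>The map of blocks is injective because the inverse automorphism undoes it.\<close>

lemma iso_block_data:
  assumes \<phi>: "\<phi> \<in> iso G G"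
  shows "\<exists>\<sigma>. permutes_blocks \<phi> \<sigma> \<and> (\<forall>i<m. \<forall>j. \<exists>c. aug c = (if j = \<sigma> i then 1 else 0) \<and>
      (\<forall>p. p div 2 = i \<longrightarrow> slope UNIV j (\<phi> (gen p)) = (1 - frag_of (deg (\<phi> (gen p)))) * c))"
proof -
  define image_block where "image_block \<phi> i k \<longleftrightarrow> k < m \<and> (\<forall>p q. p div 2 = i \<longrightarrow> entry \<phi> q p \<noteq> 0 \<longrightarrow> q div 2 = k) \<and>
      (\<forall>j. \<exists>c. aug c = (if j = k then 1 else 0) \<and>
      (\<forall>p. p div 2 = i \<longrightarrow> slope UNIV j (\<phi> (gen p)) = (1 - frag_of (deg (\<phi> (gen p)))) * c))" for \<phi> i k
  have data: "\<exists>\<kappa>. \<forall>i. i < m \<longrightarrow> image_block \<phi> i (\<kappa> i)" if \<phi>: "\<phi> \<in> iso G G" for \<phi>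
  proof (rule choice, rule allI)
    fix i
    show "\<exists>k. i < m \<longrightarrow> image_block \<phi> i k"
    proof (cases "i < m")
      case True
      show ?thesis
      proof (rule image_of_block[OF \<phi> True])
        fix k
        assume "k < m" "\<And>p q. p div 2 = i \<Longrightarrow> entry \<phi> q p \<noteq> 0 \<Longrightarrow> q div 2 = k"
          "\<And>j. \<exists>c. aug c = (if j = k then 1 else 0) \<and>
            (\<forall>p. p div 2 = i \<longrightarrow> slope UNIV j (\<phi> (gen p)) = (1 - frag_of (deg (\<phi> (gen p)))) * c)"
        then have "image_block \<phi> i k" unfolding image_block_def by blast
        then show ?thesis by blast
      qed
    qed blast
  qed
  obtain \<psi> where \<psi>: "\<psi> \<in> iso G G" "\<And>x. x \<in> carrier G \<Longrightarrow> \<psi> (\<phi> x) = x"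
    by (rule iso_inverseE[OF \<phi>]) (simp add: that)
  obtain \<kappa> where \<kappa>_block: "\<forall>i. i < m \<longrightarrow> image_block \<phi> i (\<kappa> i)"
    using data[OF \<phi>] by (elim exE) (rule that)
  have \<kappa>: "\<kappa> i < m" "p div 2 = i \<Longrightarrow> entry \<phi> q p \<noteq> 0 \<Longrightarrow> q div 2 = \<kappa> i"
    "\<exists>c. aug c = (if j = \<kappa> i then 1 else 0) \<and>
      (\<forall>p. p div 2 = i \<longrightarrow> slope UNIV j (\<phi> (gen p)) = (1 - frag_of (deg (\<phi> (gen p)))) * c)"
    if "i < m" for i j p q
    using \<kappa>_block that unfolding image_block_def by (simp_all)
  obtain \<kappa>' where "\<forall>i. i < m \<longrightarrow> image_block \<psi> i (\<kappa>' i)"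
    using data[OF \<psi>(1)] by (elim exE) (rule that)
  then have \<kappa>': "q div 2 = \<kappa>' i" if "i < m" "p div 2 = i" "entry \<psi> q p \<noteq> 0" for i p q
    using that unfolding image_block_def by simp
  have inv: "\<kappa>' (\<kappa> k) = k" if k: "k < m" for k
  proof -
    have g: "gen (2 * k) \<in> carrier G" using k by simp
    have "Poly_Mapping.lookup (bar \<psi> (deg (\<phi> (gen (2 * k))))) (2 * k) \<noteq> 0"
      using bar_deg[OF iso_imp_hom[OF \<psi>(1)] iso_closed[OF \<phi> g]] \<psi>(2)[OF g] k by simp
    then obtain p where p: "entry \<phi> p (2 * k) * entry \<psi> (2 * k) p \<noteq> 0"
      unfolding lookup_bar entry_def by (meson lessThan_iff sum.not_neutral_contains_not_neutral)
    then have "p div 2 = \<kappa> k" using \<kappa>(2)[OF k, of "2 * k" p] by simp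
    then show ?thesis using \<kappa>'[OF \<kappa>(1)[OF k], of p "2 * k"] p by simp
  qed
  have inj: "inj_on \<kappa> {..<m}" using inv by (metis inj_on_inverseI lessThan_iff)
  define \<sigma> where "\<sigma> i = (if i < m then \<kappa> i else i)" for i
  have "bij_betw \<kappa> {..<m} {..<m}"
    unfolding bij_betw_def using inj endo_inj_surj[of "{..<m}" \<kappa>] \<kappa>(1) by auto
  then have "bij_betw \<sigma> {..<m} {..<m}"
    by (rule iffD1[OF bij_betw_cong, rotated]) (simp add: \<sigma>_def)
  then have "\<sigma> permutes {..<m}"
    by (rule bij_imp_permutes) (simp add: \<sigma>_def)
  moreover have "q div 2 = \<sigma> (p div 2)" if "p < 2 * m" "entry \<phi> q p \<noteq> 0" for p q
  proof -
    have "p div 2 < m" using that(1) by auto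
    then show ?thesis using \<kappa>(2)[of "p div 2" p q] that(2) by (simp add: \<sigma>_def)
  qed
  ultimately have "permutes_blocks \<phi> \<sigma>" unfolding permutes_blocks_def by blast
  then show ?thesis using \<kappa>(3) by (intro exI[of _ \<sigma>]) (simp add: \<sigma>_def)
qed

text \<open>The two slopes add up to the principal crossed homomorphism, which vanishes in degree 0.\<close>

lemma slope_antisym:
  assumes "i \<noteq> j" "x \<in> deg_kernel"
  shows "slope {i, j} i x = - slope {i, j} j x"
proof -
  have "1 * slope {i, j} i x + 1 * slope {i, j} j x = 1 - frag_of (proj {i, j} (deg x))"
    by (rule crossed_eqI[OF crossed_combination[OF slope_crossed slope_crossed] crossed_principal[OF additive_proj]])
      (use assms in \<open>auto simp: slope_gen deg_kernelD\<close>)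
  then show ?thesis
    using assms(2) by (simp add: deg_kernelD additive.zero[OF additive_proj] eq_neg_iff_add_eq_0)
qed

text \<open>Pull back along \<open>\<phi>\<close>: the result is principal on every plane, with factor \<open>c k\<close> on plane \<open>k\<close>, and the
  planes other than \<open>i\<close> and \<open>j\<close> become trivial. So it is a combination of the two slopes for \<open>{i, j}\<close>,
  and these are opposite on \<open>N\<close>.\<close>

lemma slope_iso_aux:
  assumes \<phi>: "\<phi> \<in> iso G G" "permutes_blocks \<phi> \<sigma>" and ij: "i < m" "j < m" "i \<noteq> j"
  shows "\<exists>u. aug u = 1 \<and> (\<forall>x\<in>deg_kernel. slope {\<sigma> i, \<sigma> j} (\<sigma> j) (\<phi> x)
    = u * push (\<lambda>h. proj {\<sigma> i, \<sigma> j} (bar \<phi> h)) (slope {i, j} j x))"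
proof -
  let ?S = "{\<sigma> i, \<sigma> j}"
  let ?\<theta> = "\<lambda>h. proj ?S (bar \<phi> h)"
  have \<sigma>: "\<sigma> permutes {..<m}" using \<phi>(2) by (simp add: permutes_blocks_def)
  have \<sigma>ij: "\<sigma> i \<noteq> \<sigma> j" using permutes_inj[OF \<sigma>] ij(3) by (simp add: inj_eq)
  obtain \<tau> where \<tau>: "permutes_blocks \<phi> \<tau>" "\<And>i j. i < m \<Longrightarrow> \<exists>c. aug c = (if j = \<tau> i then 1 else 0) \<and>
      (\<forall>p. p div 2 = i \<longrightarrow> slope UNIV j (\<phi> (gen p)) = (1 - frag_of (deg (\<phi> (gen p)))) * c)"
    using iso_block_data[OF \<phi>(1)] by blast
  have "\<exists>c. i < m \<longrightarrow> aug c = (if \<sigma> j = \<sigma> i then 1 else 0) \<and>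
      (\<forall>p. p div 2 = i \<longrightarrow> slope UNIV (\<sigma> j) (\<phi> (gen p)) = (1 - frag_of (deg (\<phi> (gen p)))) * c)" for i
    using \<tau>(2)[of i "\<sigma> j"] block_permutation_unique[OF \<phi>(2) \<tau>(1) \<phi>(1)] by metis
  then obtain c where c: "\<And>i. i < m \<Longrightarrow> aug (c i) = (if \<sigma> j = \<sigma> i then 1 else 0)"
      "\<And>i p. i < m \<Longrightarrow> p div 2 = i \<Longrightarrow> slope UNIV (\<sigma> j) (\<phi> (gen p)) = (1 - frag_of (deg (\<phi> (gen p)))) * c i"
    by metis
  have add: "additive ?\<theta>" by (rule additive_proj_bar)
  have add0: "?\<theta> 0 = 0" by (rule additive.zero[OF add])
  let ?\<gamma> = "\<lambda>i. push (proj ?S) (c i)"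
  have out: "?\<theta> (frag_of p) = 0" if p: "p < 2 * m" "p div 2 \<notin> {i, j}" for p
  proof (rule poly_mapping_eqI)
    fix q
    have "\<sigma> (p div 2) \<notin> ?S" using p(2) permutes_inj[OF \<sigma>] by (auto simp: inj_eq)
    then have "entry \<phi> q p = 0" if "q div 2 \<in> ?S"
      using \<phi>(2) that p(1) unfolding permutes_blocks_def by metis
    then show "Poly_Mapping.lookup (?\<theta> (frag_of p)) q = Poly_Mapping.lookup 0 q"
      using p(1) by (simp add: lookup_proj bar_gen entry_def)
  qed
  have gens: "slope ?S (\<sigma> j) (\<phi> (gen p)) = (1 - frag_of (?\<theta> (frag_of p))) * ?\<gamma> (p div 2)" if p: "p < 2 * m" for p
  proof -
    have pm: "p div 2 < m" using p by auto
    have "slope ?S (\<sigma> j) (\<phi> (gen p)) = push (proj ?S) ((1 - frag_of (deg (\<phi> (gen p)))) * c (p div 2))"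
      using slope_eq_push[OF iso_closed[OF \<phi>(1), of "gen p"], of ?S "\<sigma> j"] p
      unfolding c(2)[OF pm HOL.refl] by simp
    then show ?thesis
      using p by (simp add: push_mult[OF additive_proj] push_one additive.zero[OF additive_proj] bar_gen)
  qed
  have expand: "slope ?S (\<sigma> j) (\<phi> x) = ?\<gamma> i * push ?\<theta> (slope {i, j} i x) + ?\<gamma> j * push ?\<theta> (slope {i, j} j x)"
    if x: "x \<in> carrier G" for x
  proof (rule crossed_eqI[OF crossed_comp[OF slope_crossed iso_imp_hom[OF \<phi>(1)]] _ _ _ x])
    show "crossed (\<lambda>h. ?\<theta> (proj {i, j} h)) (\<lambda>x. ?\<gamma> i * push ?\<theta> (slope {i, j} i x) + ?\<gamma> j * push ?\<theta> (slope {i, j} j x))"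
      by (rule crossed_combination; rule crossed_push[OF slope_crossed add])
    fix p assume p: "p < 2 * m"
    show "?\<theta> (frag_of p) = ?\<theta> (proj {i, j} (frag_of p))"
      using out[OF p] by (simp add: add0)
    show "slope ?S (\<sigma> j) (\<phi> (gen p)) = ?\<gamma> i * push ?\<theta> (slope {i, j} i (gen p)) + ?\<gamma> j * push ?\<theta> (slope {i, j} j (gen p))"
    proof (cases "p div 2 \<in> {i, j}")
      case True
      then show ?thesis using ij(3) by (auto simp: gens[OF p] slope_gen[OF p] push_one add0 mult.commute)
    next
      case False
      then show ?thesis using out[OF p False] by (simp add: gens[OF p] slope_gen[OF p])
    qed
  qed
  have "slope ?S (\<sigma> j) (\<phi> x) = (?\<gamma> j - ?\<gamma> i) * push ?\<theta> (slope {i, j} j x)" if x: "x \<in> deg_kernel" for x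
    unfolding expand[OF deg_kernelD(1)[OF x]] slope_antisym[OF ij(3) x]
    by (simp add: algebra_simps)
  moreover have "aug (?\<gamma> j - ?\<gamma> i) = 1"
    using c(1) ij \<sigma>ij by (simp add: lin_push)
  ultimately show ?thesis by blast
qed

definition basic :: "nat \<Rightarrow> nat \<Rightarrow> 'a" where
  "basic i j = commutator (gen (2 * i)) (gen (2 * j))"

lemma basic_in_kernel: "i < m \<Longrightarrow> j < m \<Longrightarrow> basic i j \<in> deg_kernel"
  unfolding basic_def by (rule commutator_in_kernel) auto

lemma slope_basic:
  assumes "i < m" "j < m" "i \<noteq> j"
  shows "slope {i, j} j (basic i j) = - ((1 - frag_of (frag_of (2 * i))) * (1 - frag_of (frag_of (2 * j))))"
  using crossed_commutator[OF slope_crossed[of "{i, j}" j], of "gen (2 * i)" "gen (2 * j)"] assms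
  by (simp add: basic_def slope_gen)

lemma slope_basic_other:
  assumes "i < m" "j < m" "{i, j} \<noteq> {k, l}" "i \<noteq> j"
  shows "slope {k, l} l (basic i j) = 0"
proof -
  have "i \<notin> {k, l} \<or> j \<notin> {k, l}" using assms(3,4) by auto
  then show ?thesis
    using crossed_commutator[OF slope_crossed[of "{k, l}" l], of "gen (2 * i)" "gen (2 * j)"] assms
    by (auto simp: basic_def slope_gen)
qed

text \<open>Applying \<open>slope_iso_aux\<close> to \<open>\<phi>\<close> and to its inverse shows that the factor \<open>u\<close> is a unit, hence a monomial
  up to sign, and its augmentation is \<open>1\<close>.\<close>

lemma slope_iso:
  assumes \<phi>: "\<phi> \<in> iso G G" "permutes_blocks \<phi> \<sigma>" and ij: "i < m" "j < m" "i \<noteq> j"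
  obtains h where "\<And>x. x \<in> deg_kernel \<Longrightarrow> slope {\<sigma> i, \<sigma> j} (\<sigma> j) (\<phi> x)
    = frag_of h * push (\<lambda>h. proj {\<sigma> i, \<sigma> j} (bar \<phi> h)) (slope {i, j} j x)"
proof -
  define k l where "k = \<sigma> i" and "l = \<sigma> j"
  let ?\<theta> = "\<lambda>h. proj {k, l} (bar \<phi> h)"
  have \<sigma>: "\<sigma> permutes {..<m}" using \<phi>(2) by (simp add: permutes_blocks_def)
  have kl: "k \<noteq> l" "k < m" "l < m"
    using permutes_inj[OF \<sigma>] ij permutes_in_image[OF \<sigma>, of i] permutes_in_image[OF \<sigma>, of j]
    by (simp_all add: inj_eq k_def l_def)
  obtain \<psi> where \<psi>: "\<psi> \<in> iso G G" "\<And>x. x \<in> carrier G \<Longrightarrow> \<psi> (\<phi> x) = x" "\<And>x. x \<in> carrier G \<Longrightarrow> \<phi> (\<psi> x) = x"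
    by (rule iso_inverseE[OF \<phi>(1)]) (simp add: that)
  obtain \<tau> where \<tau>: "permutes_blocks \<psi> \<tau>" using iso_block_data[OF \<psi>(1)] by blast
  have \<tau>kl: "\<tau> k = i" "\<tau> l = j"
    using block_permutation_inverse[OF \<phi>(2) \<tau> \<phi>(1) \<psi>(1,2)] ij by (simp_all add: k_def l_def)
  obtain u where u: "aug u = 1" "\<And>x. x \<in> deg_kernel \<Longrightarrow> slope {k, l} l (\<phi> x) = u * push ?\<theta> (slope {i, j} j x)"
    using slope_iso_aux[OF \<phi> ij] unfolding k_def l_def by blast
  let ?\<theta>' = "\<lambda>h. proj {i, j} (bar \<psi> h)"
  obtain v where v: "\<And>x. x \<in> deg_kernel \<Longrightarrow> slope {i, j} j (\<psi> x) = v * push ?\<theta>' (slope {k, l} l x)"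
    using slope_iso_aux[OF \<psi>(1) \<tau> kl(2,3,1)] unfolding \<tau>kl by blast
  have add: "additive ?\<theta>" "additive ?\<theta>'" by (rule additive_proj_bar)+
  have bar_back: "?\<theta> (?\<theta>' (frag_of p)) = frag_of p" if p: "p < 2 * m" "p div 2 \<in> {k, l}" for p
  proof -
    have "?\<theta>' (frag_of p) = deg (\<psi> (gen p))"
    proof (rule poly_mapping_eqI)
      fix q
      have "entry \<psi> q p \<noteq> 0 \<Longrightarrow> q div 2 \<in> {i, j}"
        using \<tau> p \<tau>kl unfolding permutes_blocks_def by auto
      then show "Poly_Mapping.lookup (?\<theta>' (frag_of p)) q = Poly_Mapping.lookup (deg (\<psi> (gen p))) q"
        using p(1) by (auto simp: lookup_proj bar_gen entry_def)
    qed
    then show ?thesis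
      using bar_deg[OF iso_imp_hom[OF \<phi>(1)] iso_closed[OF \<psi>(1), of "gen p"]] \<psi>(3) p by simp
  qed
  have b: "basic k l \<in> deg_kernel" by (rule basic_in_kernel[OF kl(2,3)])
  let ?\<kappa> = "(1 - frag_of (frag_of (2 * k))) * (1 - frag_of (frag_of (2 * l))) :: (nat \<Rightarrow>\<^sub>0 int) \<Rightarrow>\<^sub>0 int"
  have push_\<kappa>: "push ?\<theta> (push ?\<theta>' ?\<kappa>) = ?\<kappa>"
    using bar_back[of "2 * k"] bar_back[of "2 * l"] kl
    by (simp add: push_mult[OF add(1)] push_mult[OF add(2)] push_one additive.zero[OF add(1)] additive.zero[OF add(2)])
  have "- ?\<kappa> = slope {k, l} l (\<phi> (\<psi> (basic k l)))"
    using \<psi>(3)[OF deg_kernelD(1)[OF b]] slope_basic[OF kl(2,3,1)] by simp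
  also have "\<dots> = u * push ?\<theta> (v * push ?\<theta>' (- ?\<kappa>))"
    using u(2)[OF hom_deg_kernel[OF iso_imp_hom[OF \<psi>(1)] b]] v[OF b] slope_basic[OF kl(2,3,1)] by simp
  also have "\<dots> = (u * push ?\<theta> v) * - ?\<kappa>"
    by (simp only: push_mult[OF add(1)] push_simps push_\<kappa> mult.assoc)
  finally have "(u * push ?\<theta> v) * - ?\<kappa> = 1 * - ?\<kappa>" by simp
  moreover have "- ?\<kappa> \<noteq> 0" by simp
  ultimately have "u * push ?\<theta> v = 1" by (simp only: mult_cancel_right simp_thms)
  then obtain h s where "u = Poly_Mapping.single h s" "s = 1 \<or> s = -1" by (rule group_ring_unit)
  with u show ?thesis using that[of h] by (simp add: k_def l_def)
qed

text \<open>Both planes must return after the same number \<open>r\<close> of steps, their common period, so that the return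
  maps have no eigenvalue 1. Consecutive planes of a cycle do, and so do any two fixed planes.\<close>

lemma pair_choice:
  assumes \<sigma>: "\<sigma> permutes {..<m}"
  obtains i j r where "i < m" "j < m" "i \<noteq> j" "is_period \<sigma> i r" "is_period \<sigma> j r" "j = \<sigma> i \<or> r = 1"
proof (cases "\<exists>i<m. \<sigma> i \<noteq> i")
  case True
  then obtain i where i: "i < m" "\<sigma> i \<noteq> i" by blast
  obtain r where r: "is_period \<sigma> i r" using period_exists[OF \<sigma>] by blast
  have "(\<sigma> ^^ l) (\<sigma> i) = \<sigma> i \<longleftrightarrow> (\<sigma> ^^ l) i = i" for l
    using permutes_inj[OF \<sigma>] by (metis funpow_swap1 inj_eq)
  then have "is_period \<sigma> (\<sigma> i) r" using r by (simp add: is_period_def)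
  then show ?thesis using that[of i "\<sigma> i" r] i r permutes_in_image[OF \<sigma>, of i] by simp
next
  case False
  then have "is_period \<sigma> 0 1" "is_period \<sigma> 1 1" using m_ge_2 by (auto simp: is_period_def)
  then show ?thesis using that[of 0 1 1] m_ge_2 by simp
qed

theorem reidemeister_infinite:
  assumes \<phi>: "\<phi> \<in> iso G G"
  shows "reidemeister_number G \<phi> = \<infinity>"
proof -
  obtain \<sigma> where pb: "permutes_blocks \<phi> \<sigma>" using iso_block_data[OF \<phi>] by blast
  have \<sigma>: "\<sigma> permutes {..<m}" using pb by (simp add: permutes_blocks_def)
  show ?thesis
  proof (cases "\<exists>k r. k < m \<and> is_period \<sigma> k r \<and> fix_det (\<phi> ^^ r) k = 0")
    case True
    then show ?thesis using reidemeister_infinite_if_fix_det_eq_0[OF \<phi> pb] by blast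
  next
    case False
    then have det: "\<And>k r. k < m \<Longrightarrow> is_period \<sigma> k r \<Longrightarrow> fix_det (\<phi> ^^ r) k \<noteq> 0" by blast
    obtain i j r where ij: "i < m" "j < m" "i \<noteq> j" and r: "is_period \<sigma> i r" "is_period \<sigma> j r"
      and choice: "j = \<sigma> i \<or> r = 1" by (rule pair_choice[OF \<sigma>])
    let ?\<psi> = "\<phi> ^^ r" and ?D = "slope {i, j} j"
    have \<psi>: "?\<psi> \<in> iso G G" "permutes_blocks ?\<psi> (\<sigma> ^^ r)" "(\<sigma> ^^ r) i = i" "(\<sigma> ^^ r) j = j"
      using iso_funpow[OF \<phi>] permutes_blocks_funpow[OF \<phi> pb] r by (auto simp: is_period_def)
    obtain h where h: "\<And>x. x \<in> deg_kernel \<Longrightarrow> ?D (?\<psi> x) = frag_of h * push (\<lambda>h. proj {i, j} (bar ?\<psi> h)) (?D x)"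
      using slope_iso[OF \<psi>(1,2) ij] unfolding \<psi>(3,4) by metis
    obtain \<chi> where \<chi>: "\<chi> \<in> iso G G" "\<And>x. x \<in> carrier G \<Longrightarrow> \<chi> (?\<psi> x) = x"
      by (rule iso_inverseE[OF \<psi>(1)]) (simp add: that)
    obtain \<tau> where \<tau>: "permutes_blocks \<chi> \<tau>" using iso_block_data[OF \<chi>(1)] by blast
    let ?e = "\<lambda>k c d. entry ?\<psi> (2 * k + c) (2 * k + d)"
    let ?c = "\<lambda>k c h. Poly_Mapping.lookup h (2 * k + c) :: int"
    have unimodular: "?e k 0 0 * ?e k 1 1 - ?e k 0 1 * ?e k 1 0 = 1 \<or> ?e k 0 0 * ?e k 1 1 - ?e k 0 1 * ?e k 1 0 = -1"
      if "k < m" "(\<sigma> ^^ r) k = k" for k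
      using block_unimodular[OF \<psi>(1,2) \<chi>(1) \<tau> \<chi>(2) that(1), of k] that(2) by simp
    \<comment> \<open>The moduli are coprime to the determinants, greater than 1, and \<open>P > 2 * Q\<close>.\<close>
    define Q P where "Q = \<bar>fix_det ?\<psi> j\<bar> + 1" and "P = \<bar>fix_det ?\<psi> i\<bar> * (2 * Q) + 1"
    have nz: "fix_det ?\<psi> i \<noteq> 0" "fix_det ?\<psi> j \<noteq> 0" using det ij r by auto
    have Q: "Q > 1" using nz by (simp add: Q_def)
    have "1 * (2 * Q) \<le> \<bar>fix_det ?\<psi> i\<bar> * (2 * Q)" using nz Q by (intro mult_right_mono) auto
    then have P: "2 * Q < P" by (simp add: P_def)
    have cop: "coprime Q (fix_det ?\<psi> j)" "coprime P (fix_det ?\<psi> i)"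
    proof -
      have aux: "coprime (\<bar>x\<bar> * y + 1) x" for x y :: int
      proof (rule coprimeI)
        fix z assume "z dvd \<bar>x\<bar> * y + 1" "z dvd x"
        then have "z dvd (\<bar>x\<bar> * y + 1) - \<bar>x\<bar> * y" by (intro dvd_diff) auto
        then show "is_unit z" by simp
      qed
      show "coprime Q (fix_det ?\<psi> j)" using aux[of "fix_det ?\<psi> j" 1] by (simp add: Q_def)
      show "coprime P (fix_det ?\<psi> i)" using aux by (simp add: P_def)
    qed
    have cop': "coprime Q ((1 - ?e j 0 0) * (1 - ?e j 1 1) - ?e j 0 1 * ?e j 1 0)"
      "coprime P ((1 - ?e i 0 0) * (1 - ?e i 1 1) - ?e i 0 1 * ?e i 1 0)"
      using cop by (simp_all add: fix_det_def)
    obtain A where A: "\<And>x y. A (?c i 0 h + (x * ?e i 0 0 + y * ?e i 0 1)) (?c i 1 h + (x * ?e i 1 0 + y * ?e i 1 1)) \<longleftrightarrow> A x y"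
      "\<And>x y x' y'. A x y \<Longrightarrow> A x' y' \<Longrightarrow> P dvd x' - x \<and> P dvd y' - y"
      "\<And>x y u v. A x y \<Longrightarrow> A (x + P * u) (y + P * v)" "\<exists>x y. A x y"
      by (rule invariant_coset[OF unimodular[OF ij(1) \<psi>(3)] cop'(2)]) (rule that)
    obtain B where B: "\<And>x y. B (?c j 0 h + (x * ?e j 0 0 + y * ?e j 0 1)) (?c j 1 h + (x * ?e j 1 0 + y * ?e j 1 1)) \<longleftrightarrow> B x y"
      "\<And>x y x' y'. B x y \<Longrightarrow> B x' y' \<Longrightarrow> Q dvd x' - x \<and> Q dvd y' - y"
      "\<And>x y u v. B x y \<Longrightarrow> B (x + Q * u) (y + Q * v)" "\<exists>x y. B x y"
      by (rule invariant_coset[OF unimodular[OF ij(2) \<psi>(4)] cop'(1)]) (rule that)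
    define f where "f z = (if A (?c i 0 z) (?c i 1 z) \<and> B (?c j 0 z) (?c j 1 z) then 1 else 0 :: int)" for z
    have f: "f (h + proj {i, j} (bar ?\<psi> z)) = f z" for z
    proof -
      have "?c k c (bar ?\<psi> z) = ?c k 0 z * ?e k c 0 + ?c k 1 z * ?e k c 1" if "k \<in> {i, j}" "c < 2" for c k
        using lookup_bar_block[OF \<psi>(2), of k "2 * k + c" z] that ij \<psi>(3,4) by auto
      from this[of i 0] this[of i 1] this[of j 0] this[of j 1] show ?thesis
        using A(1)[of "?c i 0 z" "?c i 1 z"] B(1)[of "?c j 0 z" "?c j 1 z"]
        by (simp add: f_def lookup_add lookup_proj)
    qed
    \<comment> \<open>If \<open>\<phi>\<close> exchanges the two planes, the averaged functional has a second term at the commutator of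
      the chosen generators. The predicate \<open>A'\<close> below describes where that term can be nonzero, and
      the evaluation point is chosen to avoid it.\<close>
    define swapped where "swapped \<longleftrightarrow> \<sigma> i = j \<and> \<sigma> j = i"
    obtain h1 where h1: "swapped \<Longrightarrow> x \<in> deg_kernel \<Longrightarrow> ?D (\<phi> x) = - (frag_of h1 * push (\<lambda>h. proj {i, j} (bar \<phi> h)) (?D x))" for x
    proof (cases swapped)
      case True
      then have s: "\<sigma> i = j" "\<sigma> j = i" by (simp_all add: swapped_def)
      obtain h1 where "\<And>x. x \<in> deg_kernel \<Longrightarrow> ?D (\<phi> x) = frag_of h1 * push (\<lambda>h. proj {i, j} (bar \<phi> h)) (slope {j, i} i x)"
        using slope_iso[OF \<phi> pb ij(2,1)] ij(3) unfolding s by metis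
      then show ?thesis
        using that[of h1] slope_antisym[OF ij(3)] by (simp add: insert_commute)
    qed (use that in blast)
    let ?n = "\<lambda>c d. entry \<phi> (2 * i + c) (2 * j + d)"
    define A' where "A' x y \<longleftrightarrow> swapped \<and> A (?c i 0 h1 + (x * ?n 0 0 + y * ?n 0 1)) (?c i 1 h1 + (x * ?n 1 0 + y * ?n 1 1))" for x y
    have A': "P dvd x' - x \<and> P dvd y' - y" if a: "A' x y" "A' x' y'" for x y x' y'
    proof -
      have s: "i = \<sigma> j" using a by (simp add: A'_def swapped_def)
      obtain \<chi> where \<chi>: "\<chi> \<in> iso G G" "\<And>x. x \<in> carrier G \<Longrightarrow> \<chi> (\<phi> x) = x"
        by (rule iso_inverseE[OF \<phi>]) (simp add: that)
      obtain \<tau> where \<tau>: "permutes_blocks \<chi> \<tau>" using iso_block_data[OF \<chi>(1)] by blast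
      have u: "?n 0 0 * ?n 1 1 - ?n 0 1 * ?n 1 0 = 1 \<or> ?n 0 0 * ?n 1 1 - ?n 0 1 * ?n 1 0 = -1"
        using block_unimodular[OF \<phi> pb \<chi>(1) \<tau> \<chi>(2) ij(2) s] by simp
      have "P dvd (x' - x) * ?n 0 0 + (y' - y) * ?n 0 1" "P dvd (x' - x) * ?n 1 0 + (y' - y) * ?n 1 1"
        using A(2)[of "?c i 0 h1 + (x * ?n 0 0 + y * ?n 0 1)" "?c i 1 h1 + (x * ?n 1 0 + y * ?n 1 1)"
            "?c i 0 h1 + (x' * ?n 0 0 + y' * ?n 0 1)" "?c i 1 h1 + (x' * ?n 1 0 + y' * ?n 1 1)"] a
        by (simp_all add: A'_def algebra_simps)
      then show ?thesis by (rule dvd_of_unimodular[OF u])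
    qed
    obtain x1 x2 where x: "A x1 x2" using A(4) by blast
    obtain y1 y2 where y: "B y1 y2" "\<not> A' y1 y2" "\<not> A' (y1 + 1) y2"
      using avoiding_point[OF B(3,4) A' _ P] Q by auto
    have not_A: "\<not> A (x1 + 1) x2" using A(2)[OF x, of "x1 + 1" x2] P Q by auto
    have not_B: "\<not> B (y1 + 1) y2" using B(2)[OF y(1), of "y1 + 1" y2] Q by auto
    obtain g where g: "g \<in> carrier G" "?c i 0 (deg g) = x1" "?c i 1 (deg g) = x2" "?c j 0 (deg g) = y1" "?c j 1 (deg g) = y2"
    proof -
      have "2 * i + 1 \<noteq> 2 * j" "2 * j + 1 \<noteq> 2 * i" by presburger+
      then show ?thesis
        using ex_with_deg[of "\<lambda>q. if q = 2 * i then x1 else if q = 2 * i + 1 then x2 else if q = 2 * j then y1 else y2"]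
          ij that by auto
    qed
    define x0 where "x0 = g \<otimes> basic i j \<otimes> inv g"
    have b: "basic i j \<in> deg_kernel" by (rule basic_in_kernel[OF ij(1,2)])
    have x0: "x0 \<in> deg_kernel" using conj_in_deg_kernel[OF g(1) b] by (simp add: x0_def)
    define z where "z = proj {i, j} (deg g)"
    have slope_x0: "slope {k, l} l x0 = (frag_of (proj {k, l} (deg g))) * slope {k, l} l (basic i j)" for k l
      unfolding x0_def by (rule crossed_conj[OF slope_crossed g(1) b])
    have D_x0: "?D x0 = frag_of z * - ((1 - frag_of (frag_of (2 * i))) * (1 - frag_of (frag_of (2 * j))))"
      by (simp only: slope_x0 slope_basic[OF ij] z_def)
    let ?a = "frag_of (2 * i)" and ?b = "frag_of (2 * j)"
    have ne: "2 * i + 1 \<noteq> 2 * j" "2 * j + 1 \<noteq> 2 * i" by presburger+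
    have cz: "?c i 0 z = x1" "?c i 1 z = x2" "?c j 0 z = y1" "?c j 1 z = y2"
      using g by (simp_all add: z_def lookup_proj)
    \<comment> \<open>Of the four corners of the mixed difference, only \<open>z\<close> satisfies both congruences.\<close>
    have F0: "lin f (?D x0) = -1"
      unfolding D_x0 lin_mixed_difference
      using x y(1) not_A not_B cz ij(3) ne by (simp add: f_def lookup_add)
    show ?thesis
    proof (rule reidemeister_infinite_if_kernel_invariant[OF \<phi> pb det, where F = "\<lambda>x. lin f (?D x)" and r = r and ?x0.0 = x0])
      show "lin f (?D (x \<otimes> y)) = lin f (?D x) + lin f (?D y)"
        if "x \<in> deg_kernel" "y \<in> deg_kernel" for x y by (simp add: crossed_kernel_add[OF slope_crossed that])
      show "lin f (?D (?\<psi> x)) = lin f (?D x)" if x: "x \<in> deg_kernel" for x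
        by (simp add: h[OF x] lin_mon_mult lin_push f)
      have rest: "lin f (?D ((\<phi> ^^ l) x0)) = 0" if l: "0 < l" "l < r" for l
      proof -
        have p: "(\<sigma> ^^ l) permutes {..<m}"
          using permutes_blocks_funpow[OF \<phi> pb, of l] by (simp add: permutes_blocks_def)
        define i' j' where "i' = inv_into UNIV (\<sigma> ^^ l) i" and "j' = inv_into UNIV (\<sigma> ^^ l) j"
        have i': "i' < m" "(\<sigma> ^^ l) i' = i" and j': "j' < m" "(\<sigma> ^^ l) j' = j"
          using ij permutes_in_image[OF permutes_inv[OF p]]
          by (simp_all add: i'_def j'_def permutes_inverses[OF p])
        have ne': "i' \<noteq> j'" using i' j' ij(3) by auto
        obtain h2 where h2: "?D ((\<phi> ^^ l) x0)
            = frag_of h2 * push (\<lambda>h. proj {i, j} (bar (\<phi> ^^ l) h)) (slope {i', j'} j' x0)"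
          using slope_iso[OF iso_funpow[OF \<phi>] permutes_blocks_funpow[OF \<phi> pb] i'(1) j'(1) ne', of l] x0
          unfolding i'(2) j'(2) by metis
        show ?thesis
        proof (cases "{i, j} = {i', j'}")
          case False
          then show ?thesis
            by (simp add: h2 slope_x0 slope_basic_other[OF ij(1,2) False ij(3)])
        next
          case True
          have "i' \<noteq> i" using i' r l unfolding is_period_def by metis
          then have ij': "i' = j" "j' = i" using True by (auto simp: doubleton_eq_iff)
          have "j = \<sigma> i" using choice l by auto
          obtain l' where l': "l = Suc l'" using l by (cases l) auto
          have "\<sigma> ((\<sigma> ^^ l') i) = \<sigma> i" using j' ij' \<open>j = \<sigma> i\<close> l' by simp
          then have "(\<sigma> ^^ l') i = i" using permutes_inj[OF \<sigma>] by (simp add: inj_eq)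
          then have "l' = 0" using r(1) l l' unfolding is_period_def by (metis Suc_lessD not_gr_zero)
          then have l1: "l = 1" using l' by simp
          then have sw: swapped using i' j' ij' by (simp add: swapped_def)
          have "lin f (?D (\<phi> x0)) = - lin (\<lambda>k. f (h1 + proj {i, j} (bar \<phi> k))) (?D x0)"
            by (simp add: h1[OF sw x0] lin_mon_mult lin_push)
          also have "\<dots> = 0"
          proof -
            have zero: "f (h1 + proj {i, j} (bar \<phi> k)) = 0" if "\<not> A' (?c j 0 k) (?c j 1 k)" for k
            proof -
              have "?c i c (bar \<phi> k) = ?c j 0 k * ?n c 0 + ?c j 1 k * ?n c 1" if "c < 2" for c
                using lookup_bar_block[OF pb ij(2), of "2 * i + c" k] that sw by (simp add: swapped_def)
              from this[of 0] this[of 1] show ?thesis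
                using that sw by (simp add: f_def A'_def lookup_add lookup_proj)
            qed
            show ?thesis
              unfolding D_x0 lin_mixed_difference
              using y(2,3) cz ij(3) ne by (simp add: zero lookup_add)
          qed
          finally show ?thesis by (simp add: l1)
        qed
      qed
      then have "(\<Sum>l<r. lin f (?D ((\<phi> ^^ l) x0))) = (\<Sum>l\<in>{0}. lin f (?D ((\<phi> ^^ l) x0)))"
        using r by (intro sum.mono_neutral_right) (auto simp: is_period_def)
      then show "(\<Sum>l<r. lin f (?D ((\<phi> ^^ l) x0))) \<noteq> 0" using F0 by simp
    qed (use x0 in auto)
  qed
qed

end

section \<open>Right-angled Artin groups as groups with commuting generators\<close>

fun eval_word :: "('k, 'n) monoid_scheme \<Rightarrow> ('a \<Rightarrow> 'k) \<Rightarrow> 'a word \<Rightarrow> 'k" where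
  "eval_word K f [] = \<one>\<^bsub>K\<^esub>"
| "eval_word K f ((x, b) # w) = (if b then f x else inv\<^bsub>K\<^esub> (f x)) \<otimes>\<^bsub>K\<^esub> eval_word K f w"

context group
begin

lemma eval_word_closed:
  "f \<in> S \<rightarrow> carrier G \<Longrightarrow> w \<in> words_over S \<Longrightarrow> eval_word G f w \<in> carrier G"
  by (induction w) (auto simp: words_over_def Pi_iff)

lemma eval_word_append:
  "f \<in> S \<rightarrow> carrier G \<Longrightarrow> v \<in> words_over S \<Longrightarrow> w \<in> words_over S \<Longrightarrow>
    eval_word G f (v @ w) = eval_word G f v \<otimes> eval_word G f w"
proof (induction v)
  case Nil
  then show ?case using eval_word_closed[of f S w] by simp
next
  case (Cons l v)
  obtain x b where l: "l = (x, b)" by force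
  have "v \<in> words_over S" "x \<in> S" using Cons.prems l by (auto simp: words_over_def)
  then show ?case
    using Cons eval_word_closed[of f S v] eval_word_closed[of f S w]
    by (auto simp: l Pi_iff m_assoc)
qed

lemma eval_word_pres_eq:
  assumes f: "f \<in> S \<rightarrow> carrier G" and R: "\<And>r. r \<in> R \<Longrightarrow> r \<in> words_over S \<Longrightarrow> eval_word G f r = \<one>"
    and "pres_eq S R v w"
  shows "eval_word G f v = eval_word G f w"
  using assms(3)
proof (induction rule: pres_eq.induct)
  case (cancel u v x b)
  have x: "f x \<in> carrier G" using f cancel(3) by blast
  have xw: "[(x, b), (x, \<not> b)] \<in> words_over S" using cancel(3) by (simp add: words_over_def)
  have "eval_word G f ([(x, b), (x, \<not> b)] @ v) = eval_word G f v"
    using x eval_word_closed[OF f cancel(2)] by (auto simp: m_assoc[symmetric])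
  then show ?case
    using eval_word_append[OF f cancel(1), of v] eval_word_append[OF f cancel(1), of "[(x, b), (x, \<not> b)] @ v"]
      cancel(2) xw by (simp only: append_in_words_over simp_thms)
next
  case (relator u v r)
  then show ?case
    using eval_word_closed[OF f] by (simp add: eval_word_append[OF f] R)
qed simp_all

end

lemma presented_group_hom:
  fixes K :: "('k, 'n) monoid_scheme"
  assumes K: "group K" and f: "f \<in> S \<rightarrow> carrier K"
    and R: "\<And>r. r \<in> R \<Longrightarrow> r \<in> words_over S \<Longrightarrow> eval_word K f r = \<one>\<^bsub>K\<^esub>"
  shows "\<exists>h\<in>hom (presented_group S R) K. \<forall>x\<in>S. h (pres_rel S R `` {[(x, True)]}) = f x"
proof -
  interpret K: group K by (rule K)
  let ?cl = "\<lambda>w. pres_rel S R `` {w}"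
  define h where "h C = eval_word K f (SOME w. w \<in> C)" for C
  have h: "h (?cl w) = eval_word K f w" if w: "w \<in> words_over S" for w
  proof -
    have "w \<in> ?cl w" using equiv_class_self[OF equiv_pres_rel w] .
    then have "(SOME v. v \<in> ?cl w) \<in> ?cl w" by (rule someI)
    then have "pres_eq S R w (SOME v. v \<in> ?cl w)" by (simp add: pres_rel_def)
    then show ?thesis unfolding h_def using K.eval_word_pres_eq[OF f R] by metis
  qed
  have carrierE: "\<exists>a\<in>words_over S. x = ?cl a" if "x \<in> carrier (presented_group S R)" for x
    using that by (auto simp: presented_group_def elim: quotientE)
  have "h \<in> hom (presented_group S R) K"
  proof (rule homI)
    fix x assume "x \<in> carrier (presented_group S R)"
    then obtain a where "a \<in> words_over S" "x = ?cl a" using carrierE by blast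
    then show "h x \<in> carrier K" using h K.eval_word_closed[OF f] by simp
  next
    fix x y assume "x \<in> carrier (presented_group S R)" "y \<in> carrier (presented_group S R)"
    then obtain a b where a: "a \<in> words_over S" "x = ?cl a" and b: "b \<in> words_over S" "y = ?cl b"
      using carrierE by meson
    then show "h (x \<otimes>\<^bsub>presented_group S R\<^esub> y) = h x \<otimes>\<^bsub>K\<^esub> h y"
      using h[of "a @ b"] h[of a] h[of b] K.eval_word_append[OF f]
      by (simp add: presented_group_mult_class del: Image_singleton_iff)
  qed
  moreover have "h (?cl [(x, True)]) = f x" if "x \<in> S" for x
  proof -
    have "[(x, True)] \<in> words_over S" using that by (simp add: words_over_def)
    moreover have "f x \<in> carrier K" using that f by blast
    ultimately show ?thesis using h by simp
  qed
  ultimately show ?thesis by blast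
qed

lemma presented_group_generated:
  "carrier (presented_group S R)
    = generate (presented_group S R) ((\<lambda>x. pres_rel S R `` {[(x, True)]}) ` S)"
proof -
  let ?G = "presented_group S R" and ?cl = "\<lambda>w. pres_rel S R `` {w}"
  let ?gens = "(\<lambda>x. ?cl [(x, True)]) ` S"
  interpret G: group ?G by (rule group_presented_group)
  have one: "\<one>\<^bsub>?G\<^esub> = ?cl []" by (simp add: presented_group_def)
  have closed: "?cl w \<in> carrier ?G" if "w \<in> words_over S" for w
    using that by (auto simp: presented_group_def intro: quotientI)
  have letter: "?cl [(x, b)] \<in> generate ?G ?gens" if x: "x \<in> S" for x b
  proof (cases b)
    case True
    then show ?thesis using x by (auto intro: generate.incl)
  next
    case False
    have w: "[(x, b)] \<in> words_over S" for b using x by (simp add: words_over_def)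
    have "pres_eq S R ([] @ [(x, False), (x, \<not> False)] @ []) ([] @ [])"
      by (rule pres_eq.cancel) (simp_all add: x)
    then have "?cl [(x, False)] \<otimes>\<^bsub>?G\<^esub> ?cl [(x, True)] = \<one>\<^bsub>?G\<^esub>"
      unfolding one presented_group_mult_class[OF w w]
      by (intro equiv_class_eq[OF equiv_pres_rel]) (simp add: pres_rel_def)
    then have "?cl [(x, False)] = inv\<^bsub>?G\<^esub> ?cl [(x, True)]"
      using closed[OF w] by (simp add: G.inv_equality del: Image_singleton_iff)
    then show ?thesis using False x by (auto intro: generate.inv)
  qed
  have word: "w \<in> words_over S \<Longrightarrow> ?cl w \<in> generate ?G ?gens" for w
  proof (induction w)
    case Nil
    then show ?case using generate.one[of ?G ?gens] by (simp only: one)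
  next
    case (Cons l w)
    obtain x b where l: "l = (x, b)" by force
    have w: "w \<in> words_over S" "x \<in> S" using Cons.prems l by (auto simp: words_over_def)
    have "?cl (l # w) = ?cl [(x, b)] \<otimes>\<^bsub>?G\<^esub> ?cl w"
      using presented_group_mult_class[of "[(x, b)]" S w R] w by (simp add: words_over_def l)
    then show ?case using generate.eng[OF letter[OF w(2), of b] Cons.IH[OF w(1)]] by simp
  qed
  have "carrier ?G \<subseteq> generate ?G ?gens"
  proof
    fix x assume "x \<in> carrier ?G"
    then obtain w where "w \<in> words_over S" "x = ?cl w"
      by (auto simp: presented_group_def elim: quotientE)
    then show "x \<in> generate ?G ?gens" using word by simp
  qed
  moreover have "?gens \<subseteq> carrier ?G"
    using closed by (auto simp: words_over_def)
  then have "generate ?G ?gens \<subseteq> carrier ?G" using G.generate_incl by simp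
  ultimately show ?thesis by blast
qed

text \<open>The semidirect product of the group ring with its exponent group; a homomorphism into it is a pair
  of a crossed homomorphism and a homomorphism to the exponent group.\<close>

definition twisted_affine :: "('h::ab_group_add \<Rightarrow> 'h) \<Rightarrow> (('h \<Rightarrow>\<^sub>0 int) \<times> 'h) monoid" where
  "twisted_affine \<theta> = \<lparr>carrier = UNIV,
     monoid.mult = (\<lambda>(r, h) (r', h'). (r + frag_of (\<theta> h) * r', h + h')), monoid.one = (0, 0)\<rparr>"

lemma group_twisted_affine:
  assumes "additive \<theta>"
  shows "group (twisted_affine \<theta>)"
proof (rule groupI)
  fix x assume "x \<in> carrier (twisted_affine \<theta>)"
  obtain r h where x: "x = (r, h)" by force
  show "\<exists>y\<in>carrier (twisted_affine \<theta>). y \<otimes>\<^bsub>twisted_affine \<theta>\<^esub> x = \<one>\<^bsub>twisted_affine \<theta>\<^esub>"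
    by (rule bexI[of _ "(- (frag_of (\<theta> (- h)) * r), - h)"]) (auto simp: twisted_affine_def x)
qed (auto simp: twisted_affine_def additive.add[OF assms] additive.zero[OF assms] mon_add distrib_left add.assoc mult.assoc)

lemma commutator_word_eval:
  assumes K: "group K" and f: "f v \<in> carrier K" "f w \<in> carrier K"
    and comm: "f v \<otimes>\<^bsub>K\<^esub> f w = f w \<otimes>\<^bsub>K\<^esub> f v"
  shows "eval_word K f (commutator_word v w) = \<one>\<^bsub>K\<^esub>"
proof -
  interpret K: group K by (rule K)
  have "eval_word K f (commutator_word v w) = (f v \<otimes>\<^bsub>K\<^esub> f w) \<otimes>\<^bsub>K\<^esub> inv\<^bsub>K\<^esub> (f w \<otimes>\<^bsub>K\<^esub> f v)"
    using f by (simp add: commutator_word_def K.inv_mult_group K.m_assoc)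
  then show ?thesis using f comm by simp
qed

lemma raag_hom:
  assumes K: "group K" and f: "\<And>v. v \<in> V \<Longrightarrow> f v \<in> carrier K"
    and comm: "\<And>v w. v \<in> V \<Longrightarrow> w \<in> V \<Longrightarrow> {v, w} \<in> E \<Longrightarrow> f v \<otimes>\<^bsub>K\<^esub> f w = f w \<otimes>\<^bsub>K\<^esub> f v"
  shows "\<exists>h\<in>hom (raag V E) K. \<forall>x\<in>V.
    h (pres_rel V {commutator_word v w | v w. {v, w} \<in> E} `` {[(x, True)]}) = f x"
proof -
  let ?R = "{commutator_word v w | v w. {v, w} \<in> E}"
  have R: "eval_word K f r = \<one>\<^bsub>K\<^esub>" if r_rel: "r \<in> ?R" and r: "r \<in> words_over V" for r
  proof -
    obtain v w where vw: "r = commutator_word v w" "{v, w} \<in> E" using r_rel by blast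
    have V: "v \<in> V" "w \<in> V" using r by (auto simp: vw(1) commutator_word_def words_over_def)
    show ?thesis
      unfolding vw(1) using commutator_word_eval[of K f v w] K f[OF V(1)] f[OF V(2)] comm[OF V vw(2)] by simp
  qed
  have "f \<in> V \<rightarrow> carrier K" using f by blast
  then show ?thesis unfolding raag_def by (rule presented_group_hom[OF K]) (rule R)
qed

lemma raag_gen_commute:
  assumes "v \<in> V" "w \<in> V" "{v, w} \<in> E"
  defines "R \<equiv> {commutator_word v w | v w. {v, w} \<in> E}"
  shows "pres_rel V R `` {[(v, True)]} \<otimes>\<^bsub>raag V E\<^esub> pres_rel V R `` {[(w, True)]}
    = pres_rel V R `` {[(w, True)]} \<otimes>\<^bsub>raag V E\<^esub> pres_rel V R `` {[(v, True)]}"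
proof -
  have words: "[(v, b)] \<in> words_over V" "[(w, b)] \<in> words_over V" for b
    using assms by (auto simp: words_over_def)
  let ?c = "[(v, True), (w, True)]" and ?d = "[(w, True), (v, True)]"
  have c: "[(v, True), (w, True), (v, False), (w, False)] \<in> words_over V" "?c \<in> words_over V" "?d \<in> words_over V"
    using assms by (auto simp: words_over_def)
  have 1: "pres_eq V R ([] @ [(v, True), (w, True), (v, False), (w, False)] @ ?d) ([] @ ?d)"
    by (rule pres_eq.relator) (use assms c in \<open>auto simp: R_def commutator_word_def\<close>)
  have 2: "pres_eq V R ([(v, True), (w, True), (v, False)] @ [(w, False), (w, \<not> False)] @ [(v, True)])
      ([(v, True), (w, True), (v, False)] @ [(v, True)])"
    by (rule pres_eq.cancel) (use assms in \<open>auto simp: words_over_def\<close>)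
  have 3: "pres_eq V R (?c @ [(v, False), (v, \<not> False)] @ []) (?c @ [])"
    by (rule pres_eq.cancel) (use assms in \<open>auto simp: words_over_def\<close>)
  have "pres_eq V R ?c ?d"
    using pres_eq.trans[OF pres_eq.sym[OF 3]] pres_eq.trans[OF pres_eq.sym[OF 2]] 1 by simp
  then have "pres_rel V R `` {?c} = pres_rel V R `` {?d}"
    by (intro equiv_class_eq[OF equiv_pres_rel]) (simp add: pres_rel_def)
  then show ?thesis
    using presented_group_mult_class[OF words(1)[of True] words(2)[of True], of R]
      presented_group_mult_class[OF words(2)[of True] words(1)[of True], of R]
    by (simp add: raag_def R_def)
qed

text \<open>The degree map comes from the trivial twist; for general \<open>\<theta>\<close>, the first component of a homomorphism
  to the semidirect product is the crossed homomorphism, because the second one is again \<open>deg\<close>.\<close>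

lemma raag_commuting_generators:
  assumes e: "bij_betw e {..<2 * m} V"
    and comm: "\<And>p q. p < 2 * m \<Longrightarrow> q < 2 * m \<Longrightarrow> p \<noteq> q \<Longrightarrow> comm p q \<longleftrightarrow> {e p, e q} \<in> E"
    and loopless: "\<And>v. {v} \<notin> E"
  shows "\<exists>gen deg. commuting_generators (raag V E) m gen deg comm"
proof -
  define R where "R = {commutator_word v w | v w. {v, w} \<in> E}"
  let ?G = "raag V E"
  have G: "?G = presented_group V R" by (simp add: raag_def R_def)
  interpret G: group ?G unfolding G by (rule group_presented_group)
  define gen where "gen p = pres_rel V R `` {[(e p, True)]}" for p
  define ix where "ix = inv_into {..<2 * m} e"
  have ix: "ix v < 2 * m" "e (ix v) = v" if "v \<in> V" for v
    using that e bij_betwE[OF bij_betw_inv_into[OF e]] by (auto simp: ix_def bij_betw_inv_into_right)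
  have ix_e: "ix (e p) = p" if "p < 2 * m" for p
    using that e by (simp add: ix_def bij_betw_inv_into_left)
  have eV: "e p \<in> V" if "p < 2 * m" for p using bij_betwE[OF e] that by simp
  have gen_closed: "gen p \<in> carrier ?G" if "p < 2 * m" for p
    using eV[OF that] by (auto simp: G presented_group_def gen_def words_over_def intro: quotientI)
  have "(\<lambda>x. pres_rel V R `` {[(x, True)]}) ` V = gen ` {..<2 * m}"
    using bij_betw_imp_surj_on[OF e] by (auto simp: gen_def image_image)
  then have generated: "carrier ?G = generate ?G (gen ` {..<2 * m})"
    using presented_group_generated[of V R] by (simp add: G)
  have edge_comm: "ix v \<noteq> ix w" "comm (ix v) (ix w)" if "v \<in> V" "w \<in> V" "{v, w} \<in> E" for v w
  proof -
    show "ix v \<noteq> ix w" using that ix loopless by (metis insert_absorb2)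
    then show "comm (ix v) (ix w)" using comm ix that by simp
  qed
  have affine: "\<exists>h\<in>hom ?G (twisted_affine \<theta>). \<forall>p<2 * m. h (gen p) = (d p, frag_of p)"
    if \<theta>: "additive \<theta>" and d: "\<And>p q. p < 2 * m \<Longrightarrow> q < 2 * m \<Longrightarrow> comm p q \<Longrightarrow>
        (1 - frag_of (\<theta> (frag_of q))) * d p = (1 - frag_of (\<theta> (frag_of p))) * d q"
    for \<theta> :: "(nat \<Rightarrow>\<^sub>0 int) \<Rightarrow> (nat \<Rightarrow>\<^sub>0 int)" and d
  proof -
    have rel: "(d (ix v), frag_of (ix v)) \<otimes>\<^bsub>twisted_affine \<theta>\<^esub> (d (ix w), frag_of (ix w))
        = (d (ix w), frag_of (ix w)) \<otimes>\<^bsub>twisted_affine \<theta>\<^esub> (d (ix v), frag_of (ix v))"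
      if "v \<in> V" "w \<in> V" "{v, w} \<in> E" for v w
    proof -
      have "(1 - frag_of (\<theta> (frag_of (ix w)))) * d (ix v) = (1 - frag_of (\<theta> (frag_of (ix v)))) * d (ix w)"
        using d ix that edge_comm by blast
      then show ?thesis by (simp add: twisted_affine_def algebra_simps)
    qed
    have "\<exists>h\<in>hom ?G (twisted_affine \<theta>). \<forall>x\<in>V. h (pres_rel V R `` {[(x, True)]}) = (d (ix x), frag_of (ix x))"
      unfolding R_def by (rule raag_hom[OF group_twisted_affine[OF \<theta>] _ rel]) (simp add: twisted_affine_def)
    then obtain h where h: "h \<in> hom ?G (twisted_affine \<theta>)"
      "\<And>x. x \<in> V \<Longrightarrow> h (pres_rel V R `` {[(x, True)]}) = (d (ix x), frag_of (ix x))"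
      by blast
    have "h (gen p) = (d p, frag_of p)" if "p < 2 * m" for p
      using h(2)[OF eV[OF that]] that by (simp add: gen_def ix_e)
    with h(1) show ?thesis by blast
  qed
  obtain k where k: "k \<in> hom ?G (twisted_affine (\<lambda>_. 0))" "\<And>p. p < 2 * m \<Longrightarrow> k (gen p) = (0, frag_of p)"
    using affine[OF additive_zero_map, of "\<lambda>_. 0"] by auto
  define deg where "deg x = snd (k x)" for x
  have deg_mult: "deg (x \<otimes>\<^bsub>?G\<^esub> y) = deg x + deg y" if "x \<in> carrier ?G" "y \<in> carrier ?G" for x y
    using hom_mult[OF k(1) that] by (simp add: deg_def twisted_affine_def case_prod_beta)
  have deg_gen: "deg (gen p) = frag_of p" if "p < 2 * m" for p using k(2)[OF that] by (simp add: deg_def)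
  have "commuting_generators ?G m gen deg comm"
  proof (unfold_locales)
    show "gen p \<otimes>\<^bsub>?G\<^esub> gen q = gen q \<otimes>\<^bsub>?G\<^esub> gen p" if "p < 2 * m" "q < 2 * m" "comm p q" for p q
    proof (cases "p = q")
      case False
      then have "{e p, e q} \<in> E" using comm that by blast
      then show ?thesis using raag_gen_commute[OF eV[OF that(1)] eV[OF that(2)]] by (simp add: gen_def R_def)
    qed simp
    fix \<theta> :: "(nat \<Rightarrow>\<^sub>0 int) \<Rightarrow> (nat \<Rightarrow>\<^sub>0 int)" and d
    assume \<theta>: "additive \<theta>" and d: "\<And>p q. p < 2 * m \<Longrightarrow> q < 2 * m \<Longrightarrow> comm p q \<Longrightarrow>
        (1 - frag_of (\<theta> (frag_of q))) * d p = (1 - frag_of (\<theta> (frag_of p))) * d q"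
    obtain h where h: "h \<in> hom ?G (twisted_affine \<theta>)" "\<And>p. p < 2 * m \<Longrightarrow> h (gen p) = (d p, frag_of p)"
      using affine[OF \<theta> d] by blast
    have h_mult: "h (x \<otimes>\<^bsub>?G\<^esub> y) = (fst (h x) + frag_of (\<theta> (snd (h x))) * fst (h y), snd (h x) + snd (h y))"
      if "x \<in> carrier ?G" "y \<in> carrier ?G" for x y
      using hom_mult[OF h(1) that] by (simp add: twisted_affine_def case_prod_beta)
    have snd_one: "snd (h \<one>\<^bsub>?G\<^esub>) = 0" "deg \<one>\<^bsub>?G\<^esub> = 0"
      using h_mult[of "\<one>\<^bsub>?G\<^esub>" "\<one>\<^bsub>?G\<^esub>"] deg_mult[of "\<one>\<^bsub>?G\<^esub>" "\<one>\<^bsub>?G\<^esub>"]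
      by (metis G.one_closed G.r_one add_cancel_right_right snd_conv)+
    have snd_h: "snd (h x) = deg x" if x: "x \<in> carrier ?G" for x
    proof -
      have "x \<in> generate ?G (gen ` {..<2 * m})" using x generated by simp
      then show ?thesis
      proof (induction rule: generate.induct)
        case (inv y)
        then have y: "y \<in> carrier ?G" "snd (h y) = deg y" using gen_closed h(2) deg_gen by auto
        have "deg y + deg (inv\<^bsub>?G\<^esub> y) = deg y + snd (h (inv\<^bsub>?G\<^esub> y))"
          using h_mult[of y "inv\<^bsub>?G\<^esub> y"] deg_mult[of y "inv\<^bsub>?G\<^esub> y"] y snd_one
          by (metis G.inv_closed G.r_inv snd_conv)
        then show ?case by simp
      next
        case (eng y z)
        then show ?case using h_mult deg_mult generated by (metis snd_conv)
      qed (use snd_one h(2) deg_gen in auto)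
    qed
    show "\<exists>D. (\<forall>x\<in>carrier ?G. \<forall>y\<in>carrier ?G. D (x \<otimes>\<^bsub>?G\<^esub> y) = D x + frag_of (\<theta> (deg x)) * D y) \<and>
        (\<forall>p<2 * m. D (gen p) = d p)"
      by (rule exI[of _ "\<lambda>x. fst (h x)"]) (simp add: h_mult h(2) snd_h)
  qed (use gen_closed generated deg_mult deg_gen in auto)
  then show ?thesis by blast
qed

section \<open>Graphs given by a perfect matching or its complement\<close>

lemma involution_enumeration:
  assumes "finite V" "\<And>v. v \<in> V \<Longrightarrow> \<tau> v \<in> V \<and> \<tau> v \<noteq> v \<and> \<tau> (\<tau> v) = v"
  shows "\<exists>(m::nat) e. bij_betw e {..<2 * m} V \<and> (\<forall>i<m. e (2 * i + 1) = \<tau> (e (2 * i)))"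
  using assms
proof (induction "card V" arbitrary: V rule: less_induct)
  case less
  show ?case
  proof (cases "V = {}")
    case True
    then show ?thesis by (intro exI[of _ 0]) (simp add: bij_betw_def)
  next
    case False
    then obtain v where v: "v \<in> V" by blast
    let ?V = "V - {v, \<tau> v}"
    have "card ?V < card V" using v less.prems(1) by (intro psubset_card_mono) auto
    moreover have "\<tau> w \<in> ?V \<and> \<tau> w \<noteq> w \<and> \<tau> (\<tau> w) = w" if "w \<in> ?V" for w
      using that less.prems(2) v by (metis Diff_iff insert_iff singletonD)
    ultimately obtain m :: nat and e where e: "bij_betw e {..<2 * m} ?V" "\<And>i. i < m \<Longrightarrow> e (2 * i + 1) = \<tau> (e (2 * i))"
      using less.hyps[of ?V] less.prems(1) by blast
    define e' where "e' = e(2 * m := v, 2 * m + 1 := \<tau> v)"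
    have "bij_betw e' {..<2 * m} ?V"
      using e(1) by (rule iffD1[OF bij_betw_cong, rotated]) (simp add: e'_def)
    moreover have "bij_betw e' {2 * m, 2 * m + 1} {v, \<tau> v}"
      using less.prems(2)[OF v] by (auto simp: bij_betw_def e'_def)
    ultimately have "bij_betw e' ({..<2 * m} \<union> {2 * m, 2 * m + 1}) (?V \<union> {v, \<tau> v})"
      by (rule bij_betw_combine) auto
    moreover have "{..<2 * m} \<union> {2 * m, 2 * m + 1} = {..<2 * Suc m}" by auto
    moreover have "?V \<union> {v, \<tau> v} = V" using v less.prems(2)[OF v] by auto
    ultimately have "bij_betw e' {..<2 * Suc m} V" by simp
    moreover have "e' (2 * i + 1) = \<tau> (e' (2 * i))" if "i < Suc m" for i
    proof (cases "i = m")
      case False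
      then have "i < m" using that by simp
      then show ?thesis using e(2) by (simp add: e'_def)
    qed (simp add: e'_def)
    ultimately show ?thesis by blast
  qed
qed

text \<open>Used for the adjacency relation of a 1-regular graph, and for non-adjacency of distinct vertices in
  an \<open>(n - 2)\<close>-regular one.\<close>

lemma perfect_matching_enumeration:
  assumes V: "finite V"
    and sym: "\<And>v w. A v w \<Longrightarrow> A w v" and irrefl: "\<And>v. \<not> A v v"
    and one: "\<And>v. v \<in> V \<Longrightarrow> card {w \<in> V. A v w} = 1"
  obtains m :: nat and e where "bij_betw e {..<2 * m} V"
    "\<And>p q. p < 2 * m \<Longrightarrow> q < 2 * m \<Longrightarrow> A (e p) (e q) \<longleftrightarrow> p \<noteq> q \<and> p div 2 = q div 2"
proof -
  have "\<forall>v. \<exists>w. v \<in> V \<longrightarrow> {w \<in> V. A v w} = {w}" using one by (meson card_1_singletonE)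
  then obtain \<tau> where \<tau>: "\<And>v. v \<in> V \<Longrightarrow> {w \<in> V. A v w} = {\<tau> v}" by metis
  have A: "A v w \<longleftrightarrow> w = \<tau> v" if "v \<in> V" "w \<in> V" for v w using \<tau>[OF that(1)] that(2) by blast
  have \<tau>V: "\<tau> v \<in> V" if "v \<in> V" for v using \<tau>[OF that] by blast
  have \<tau>\<tau>: "\<tau> v \<in> V \<and> \<tau> v \<noteq> v \<and> \<tau> (\<tau> v) = v" if "v \<in> V" for v
    using A \<tau>V sym irrefl that by metis
  obtain m :: nat and e where e: "bij_betw e {..<2 * m} V" "\<And>i. i < m \<Longrightarrow> e (2 * i + 1) = \<tau> (e (2 * i))"
    using involution_enumeration[OF V \<tau>\<tau>] by blast
  have eV: "e p \<in> V" if "p < 2 * m" for p using bij_betwE[OF e(1)] that by simp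
  have inj: "e p = e q \<longleftrightarrow> p = q" if "p < 2 * m" "q < 2 * m" for p q
    using bij_betw_imp_inj_on[OF e(1)] that by (auto simp: inj_on_def)
  define \<rho> :: "nat \<Rightarrow> nat" where "\<rho> p = (if even p then p + 1 else p - 1)" for p
  have \<rho>: "\<rho> p < 2 * m" "\<tau> (e p) = e (\<rho> p)" if p: "p < 2 * m" for p
  proof -
    define i where "i = p div 2"
    have i: "p = 2 * i \<or> p = 2 * i + 1" "i < m" using p by (auto simp: i_def)
    show "\<rho> p < 2 * m" using i by (auto simp: \<rho>_def)
    show "\<tau> (e p) = e (\<rho> p)"
    proof (cases "even p")
      case True
      then have "p = 2 * i" using i(1) by auto
      then show ?thesis using e(2)[OF i(2)] by (simp add: \<rho>_def)
    next
      case False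
      then have "p = 2 * i + 1" using i(1) by auto
      moreover have "\<tau> (\<tau> (e (2 * i))) = e (2 * i)" using \<tau>\<tau>[OF eV] i(2) by simp
      ultimately show ?thesis using e(2)[OF i(2)] by (simp add: \<rho>_def)
    qed
  qed
  have "A (e p) (e q) \<longleftrightarrow> p \<noteq> q \<and> p div 2 = q div 2" if "p < 2 * m" "q < 2 * m" for p q
  proof -
    have "A (e p) (e q) \<longleftrightarrow> q = \<rho> p" 
      by (simp only: A[OF eV[OF that(1)] eV[OF that(2)]] \<rho>(2)[OF that(1)] inj[OF that(2) \<rho>(1)[OF that(1)]])
    also have "\<dots> \<longleftrightarrow> p \<noteq> q \<and> p div 2 = q div 2" 
    proof (cases "even p")
      case True
      then obtain i where p: "p = 2 * i" by (rule evenE)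
      have "q = 2 * i + 1 \<longleftrightarrow> 2 * i \<noteq> q \<and> i = q div 2" by presburger
      then show ?thesis by (simp add: p \<rho>_def)
    next
      case False
      then obtain i where p: "p = 2 * i + 1" by (rule oddE)
      have "q = 2 * i \<longleftrightarrow> 2 * i + 1 \<noteq> q \<and> i = q div 2" by presburger
      then show ?thesis by (simp add: p \<rho>_def)
    qed
    finally show ?thesis .
  qed
  then show ?thesis using that e(1) by blast
qed

lemma vertex_degree_eq_card_neighbours:
  assumes "simple_graph V E" "v \<in> V"
  shows "vertex_degree E v = card {w \<in> V. {v, w} \<in> E}"
proof -
  have "{x \<in> E. v \<in> x} = (\<lambda>w. {v, w}) ` {w \<in> V. {v, w} \<in> E}"
  proof (rule Set.set_eqI, rule iffI)
    fix x assume "x \<in> {x \<in> E. v \<in> x}"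
    then have x: "x \<in> E" "v \<in> x" by simp_all
    then obtain a b where ab: "a \<in> V" "b \<in> V" "x = {a, b}"
      using assms(1) unfolding simple_graph_def by blast
    then have "x = {v, if v = a then b else a}" using x(2) by auto
    then show "x \<in> (\<lambda>w. {v, w}) ` {w \<in> V. {v, w} \<in> E}" using x(1) ab by auto
  qed auto
  moreover have "inj_on (\<lambda>w. {v, w}) {w \<in> V. {v, w} \<in> E}"
    by (auto simp: inj_on_def doubleton_eq_iff)
  ultimately show ?thesis by (simp add: vertex_degree_def card_image)
qed

lemma R_infinityI:
  assumes "\<And>\<phi>. \<phi> \<in> iso G G \<Longrightarrow> reidemeister_number G \<phi> = \<infinity>"
  shows "R_infinity G"
  using assms by (auto simp: R_infinity_def auto_def Bij_def iso_def)

theorem corollary5p2p6: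
  fixes V :: "'v set" and E :: "'v set set" and n :: nat
  assumes "simple_graph V E"
    and "card V = n"
    and "\<not> complete_graph V E"
    and "regular_graph V E 1 \<or> regular_graph V E (n - 2)"
  shows "R_infinity (raag V E)"
proof -
  have V: "finite V" "V \<noteq> {}" using assms(1) by (auto simp: simple_graph_def)
  have loopless: "{v} \<notin> E" for v
    using assms(1) unfolding simple_graph_def by (metis doubleton_eq_iff insert_absorb2)
  have edge_V: "v \<in> V" "w \<in> V" if "{v, w} \<in> E" for v w
    using assms(1) that unfolding simple_graph_def by (auto simp: doubleton_eq_iff)
  obtain a b where ab: "a \<in> V" "b \<in> V" "a \<noteq> b" "{a, b} \<notin> E"
    using assms(3) by (auto simp: complete_graph_def)
  from assms(4) show ?thesis
  proof
    assume "regular_graph V E 1"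
    then have deg1: "card {w \<in> V. {v, w} \<in> E} = 1" if "v \<in> V" for v
      using that vertex_degree_eq_card_neighbours[OF assms(1) that] by (simp add: regular_graph_def)
    obtain m :: nat and e where e: "bij_betw e {..<2 * m} V"
      "\<And>p q. p < 2 * m \<Longrightarrow> q < 2 * m \<Longrightarrow> {e p, e q} \<in> E \<longleftrightarrow> p \<noteq> q \<and> p div 2 = q div 2"
      by (rule perfect_matching_enumeration[OF V(1), of "\<lambda>v w. {v, w} \<in> E"])
        (use deg1 loopless in \<open>auto simp: insert_commute\<close>)
    have m: "m \<ge> 2"
    proof (rule ccontr)
      assume "\<not> m \<ge> 2"
      obtain p q where "p < 2 * m" "q < 2 * m" "a = e p" "b = e q"
        using ab bij_betw_imp_surj_on[OF e(1)] by auto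
      moreover from this have "p \<noteq> q" "p div 2 = q div 2" using ab \<open>\<not> m \<ge> 2\<close> by auto
      ultimately show False using e(2) ab by blast
    qed
    obtain gen deg where "commuting_generators (raag V E) m gen deg (\<lambda>p q. p div 2 = q div 2)"
      using raag_commuting_generators[OF e(1), of "\<lambda>p q. p div 2 = q div 2" E] e(2) loopless by blast
    then have "plane_free_product (raag V E) m gen deg (\<lambda>p q. p div 2 = q div 2)"
      using m by (simp add: plane_free_product_def plane_free_product_axioms_def)
    then show ?thesis by (intro R_infinityI) (rule plane_free_product.reidemeister_infinite)
  next
    assume reg: "regular_graph V E (n - 2)"
    have "card {a, b} \<le> card V" using ab V by (intro card_mono) auto
    then have n: "n \<ge> 2" using ab assms(2) by simp
    have deg1: "card {w \<in> V. v \<noteq> w \<and> {v, w} \<notin> E} = 1" if v: "v \<in> V" for v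
    proof -
      have "{w \<in> V. v \<noteq> w \<and> {v, w} \<notin> E} = V - insert v {w \<in> V. {v, w} \<in> E}" by auto
      moreover have "card {w \<in> V. {v, w} \<in> E} = n - 2"
        using reg v vertex_degree_eq_card_neighbours[OF assms(1) v] by (simp add: regular_graph_def)
      then have "card (insert v {w \<in> V. {v, w} \<in> E}) = n - 1"
        using V loopless[of v] n by (subst card_insert_disjoint) auto
      ultimately show ?thesis
        using V v n assms(2) by (simp add: card_Diff_subset)
    qed
    obtain m :: nat and e where e: "bij_betw e {..<2 * m} V"
      "\<And>p q. p < 2 * m \<Longrightarrow> q < 2 * m \<Longrightarrow> e p \<noteq> e q \<and> {e p, e q} \<notin> E \<longleftrightarrow> p \<noteq> q \<and> p div 2 = q div 2"
      by (rule perfect_matching_enumeration[OF V(1), of "\<lambda>v w. v \<noteq> w \<and> {v, w} \<notin> E"])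
        (use deg1 in \<open>auto simp: insert_commute\<close>)
    have m: "m > 0" using e(1) V by (auto simp: bij_betw_def intro: ccontr)
    have "p div 2 \<noteq> q div 2 \<longleftrightarrow> {e p, e q} \<in> E" if "p < 2 * m" "q < 2 * m" "p \<noteq> q" for p q
    proof -
      have "e p \<noteq> e q" using bij_betw_imp_inj_on[OF e(1)] that by (auto simp: inj_on_def)
      then show ?thesis using e(2)[OF that(1,2)] that(3) by blast
    qed
    then obtain gen deg where "commuting_generators (raag V E) m gen deg (\<lambda>p q. p div 2 \<noteq> q div 2)"
      using raag_commuting_generators[OF e(1), of "\<lambda>p q. p div 2 \<noteq> q div 2" E] loopless by blast
    then have "free_group_product (raag V E) m gen deg (\<lambda>p q. p div 2 \<noteq> q div 2)"
      using m by (simp add: free_group_product_def free_group_product_axioms_def)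
    then show ?thesis by (intro R_infinityI) (rule free_group_product.reidemeister_infinite)
  qed
qed

end
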